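(* Let $k\ge2$, $2\le d\le m$ and $0<\alpha<1$. Among all $k$-uniform hypertrees with $m$ hyperedges and diameter $d$, the last hypertree in $S_\alpha$-order is the starlike hypertree $S^{(k)}_{t,d-t,1,\dots,1}$ with $t=\lfloor\frac d2\rfloor$ (where the number of trailing $1$'s is $m-d$).
   Context: Hypergraphs are finite; $k$-uniform means every hyperedge has exactly $k$ vertices; a hypertree is a connected hypergraph without cycles; the diameter is the maximum distance between two vertices, where distance is the minimum number of hyperedges of a path joining them. The hyperpath $P_r^{(k)}$ of length $r$ is obtained from the path graph with $r$ edges by inserting $k-2$ new vertices (of degree one) into each edge. The starlike hypertree $S^{(k)}_{n_1,\dots,n_p}$ ($p\ge1$, $n_i\ge1$) is obtained from $p$ hyperpaths of lengths $n_1,\dots,n_p$ by identifying one end vertex of each into a single common vertex; it has $n_1+\dots+n_p$ hyperedges. For a $k$-uniform hypergraph $\mathcal{H}$ on $[n]$, $\mathcal{A}(\mathcal{H})$ is the $k$-order $n$-dimensional tensor with entry $\frac1{(k-1)!}$ at $(i_1,\dots,i_k)$ if $\{i_1,\dots,i_k\}\in E(\mathcal{H})$ and $0$ otherwise; $\mathcal{D}(\mathcal{H})$ is the diagonal tensor of vertex degrees; $\mathcal{A}_\alpha(\mathcal{H})=\alpha\mathcal{D}(\mathcal{H})+(1-\alpha)\mathcal{A}(\mathcal{H})$. For a tensor $\mathcal{T}$, $\mathrm{Tr}_s(\mathcal{T})$ is the sum of the $s$-th powers of all $n(k-1)^{n-1}$ eigenvalues of $\mathcal{T}$ (roots of its characteristic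 polynomial, with multiplicity); in particular $\mathrm{Tr}_0(\mathcal{T})=n(k-1)^{n-1}$, and for $s\ge1$ $$\mathrm{Tr}_{s}(\mathcal{T})=(k-1)^{n-1}\sum_{s_1+\cdots+s_n=s}\ \prod_{i=1}^{n}\frac{1}{(s_i(k-1))!}\Big(\sum_{\gamma\in[n]^{k-1}}(\mathcal{T})_{i\gamma}\frac{\partial}{\partial a_{i\gamma}}\Big)^{s_i}\mathrm{tr}\big(A^{s(k-1)}\big),$$ with $A=(a_{ij})$ an $n\times n$ matrix of indeterminates, $s_i\ge0$ integers, $\frac{\partial}{\partial a_{i\gamma}}=\frac{\partial}{\partial a_{i i_2}}\cdots\frac{\partial}{\partial a_{i i_k}}$ for $\gamma=i_2\cdots i_k$. $S_\alpha$-order: for $k$-uniform hypergraphs $\mathcal{H}_1,\mathcal{H}_2$ with $n$ vertices, $\mathcal{H}_1\prec_\alpha\mathcal{H}_2$ if there is $s\in\{1,\dots,n(k-1)^{n-1}-1\}$ with $\mathrm{Tr}_r(\mathcal{A}_\alpha(\mathcal{H}_1))=\mathrm{Tr}_r(\mathcal{A}_\alpha(\mathcal{H}_2))$ for $r=0,\dots,s-1$ and $\mathrm{Tr}_s(\mathcal{A}_\alpha(\mathcal{H}_1))<\mathrm{Tr}_s(\mathcal{A}_\alpha(\mathcal{H}_2))$. "$X$ is the last hypertree in a class" means $X$ is in the class and $\mathcal{H}\prec_\alpha X$ for every $\mathcal{H}$ in the class not isomorphic to $X$. *)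

theory Defs
  imports Complex_Main "HOL-Library.Poly_Mapping" "HOL-Library.FuncSet"
begin

section \<open>Hypergraphs\<close>

record 'a hypergraph =
  verts :: "'a set"
  edges :: "'a set set"

definition hypergraph_on :: "nat \<Rightarrow> 'a hypergraph \<Rightarrow> bool" where
  "hypergraph_on k H \<longleftrightarrow>
     finite (verts H) \<and> verts H \<noteq> {} \<and> (\<forall>e\<in>edges H. e \<subseteq> verts H \<and> card e = k)"

definition degree :: "'a hypergraph \<Rightarrow> 'a \<Rightarrow> nat" where
  "degree H v = card {e \<in> edges H. v \<in> e}"

text \<open>A path is the alternating sequence \<open>vs ! 0, es ! 0, vs ! 1, \<dots>, es ! (q - 1), vs ! q\<close>
  with all vertices and all hyperedges distinct; its length is \<open>q = length es\<close>.\<close>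

definition is_path :: "'a hypergraph \<Rightarrow> 'a list \<Rightarrow> 'a set list \<Rightarrow> bool" where
  "is_path H vs es \<longleftrightarrow>
     length vs = Suc (length es) \<and> distinct vs \<and> distinct es \<and>
     set vs \<subseteq> verts H \<and> set es \<subseteq> edges H \<and>
     (\<forall>i<length es. vs ! i \<in> es ! i \<and> vs ! Suc i \<in> es ! i)"

text \<open>Cycles in the sense of Berge. Length two is included, so two different hyperedges
  sharing at least two vertices already form a cycle.\<close>

definition is_cycle :: "'a hypergraph \<Rightarrow> 'a list \<Rightarrow> 'a set list \<Rightarrow> bool" where
  "is_cycle H vs es \<longleftrightarrow>
     length es \<ge> 2 \<and> length vs = length es \<and> distinct vs \<and> distinct es \<and>
     set vs \<subseteq> verts H \<and> set es \<subseteq> edges H \<and>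
     (\<forall>i<length es. vs ! i \<in> es ! i \<and> vs ! (Suc i mod length es) \<in> es ! i)"

definition joins :: "'a hypergraph \<Rightarrow> 'a \<Rightarrow> 'a \<Rightarrow> nat \<Rightarrow> bool" where
  "joins H u v q \<longleftrightarrow>
     (\<exists>vs es. is_path H vs es \<and> hd vs = u \<and> last vs = v \<and> length es = q)"

definition connected_hypergraph :: "'a hypergraph \<Rightarrow> bool" where
  "connected_hypergraph H \<longleftrightarrow> (\<forall>u\<in>verts H. \<forall>v\<in>verts H. \<exists>q. joins H u v q)"

definition hdist :: "'a hypergraph \<Rightarrow> 'a \<Rightarrow> 'a \<Rightarrow> nat" where
  "hdist H u v = (LEAST q. joins H u v q)"

definition diameter :: "'a hypergraph \<Rightarrow> nat" where
  "diameter H = Max {hdist H u v | u v. u \<in> verts H \<and> v \<in> verts H}"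

definition hypertree :: "nat \<Rightarrow> 'a hypergraph \<Rightarrow> bool" where
  "hypertree k H \<longleftrightarrow>
     hypergraph_on k H \<and> connected_hypergraph H \<and> \<not> (\<exists>vs es. is_cycle H vs es)"

definition hypertrees :: "nat \<Rightarrow> nat \<Rightarrow> nat \<Rightarrow> 'a hypergraph set" where
  "hypertrees k m d = {H. hypertree k H \<and> card (edges H) = m \<and> diameter H = d}"

definition isomorphic :: "'a hypergraph \<Rightarrow> 'b hypergraph \<Rightarrow> bool" where
  "isomorphic G H \<longleftrightarrow> (\<exists>f. bij_betw f (verts G) (verts H) \<and> edges H = (`) f ` edges G)"


section \<open>Hyperpaths and starlike hypertrees\<close>

text \<open>\<open>Joint j\<close> is the \<open>j\<close>-th vertex of the underlying path graph; \<open>Inner j i\<close> is the \<open>i\<close>-th of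
  the \<open>k - 2\<close> vertices inserted into the edge between \<open>Joint j\<close> and \<open>Joint (Suc j)\<close>.\<close>

datatype path_vertex = Joint nat | Inner nat nat

definition hyperpath_edge :: "nat \<Rightarrow> nat \<Rightarrow> path_vertex set" where
  "hyperpath_edge k j = {Joint j, Joint (Suc j)} \<union> Inner j ` {..<k - 2}"

definition hyperpath :: "nat \<Rightarrow> nat \<Rightarrow> path_vertex hypergraph" where
  "hyperpath k r =
     \<lparr> verts = Joint ` {..r} \<union> (\<Union>j<r. Inner j ` {..<k - 2}),
       edges = hyperpath_edge k ` {..<r} \<rparr>"

text \<open>Vertex \<open>v\<close> of the \<open>b\<close>-th hyperpath is \<open>(b, v)\<close>, except that the end vertices \<open>Joint 0\<close> of
  all hyperpaths are identified in the single vertex \<open>(0, Joint 0)\<close>.\<close>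

definition glue :: "nat \<Rightarrow> path_vertex \<Rightarrow> nat \<times> path_vertex" where
  "glue b v = (if v = Joint 0 then (0, v) else (b, v))"

definition starlike :: "nat \<Rightarrow> nat list \<Rightarrow> (nat \<times> path_vertex) hypergraph" where
  "starlike k ns =
     \<lparr> verts = (\<Union>b<length ns. glue b ` verts (hyperpath k (ns ! b))),
       edges = (\<Union>b<length ns. (`) (glue b) ` edges (hyperpath k (ns ! b))) \<rparr>"


section \<open>Tensors of a hypergraph\<close>

text \<open>A tensor of order \<open>k\<close> whose indices range over \<open>V\<close> is a function on the lists of length \<open>k\<close>
  over \<open>V\<close>; values at other lists are irrelevant. The index set is the vertex set
  itself rather than \<open>{1, \<dots>, n}\<close>, so no numbering of the vertices is needed.\<close>

type_synonym 'a tensor = "'a list \<Rightarrow> real"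

definition adj_tensor :: "nat \<Rightarrow> 'a hypergraph \<Rightarrow> 'a tensor" where
  "adj_tensor k H is = (if set is \<in> edges H then 1 / fact (k - 1) else 0)"

definition degree_tensor :: "nat \<Rightarrow> 'a hypergraph \<Rightarrow> 'a tensor" where
  "degree_tensor k H is = (if is = replicate k (hd is) then real (degree H (hd is)) else 0)"

definition A_tensor :: "real \<Rightarrow> nat \<Rightarrow> 'a hypergraph \<Rightarrow> 'a tensor" where
  "A_tensor \<alpha> k H is = \<alpha> * degree_tensor k H is + (1 - \<alpha>) * adj_tensor k H is"


section \<open>Traces of a tensor\<close>

text \<open>Polynomials over the reals in indeterminates \<open>'v\<close>: finitely supported maps from monomials
  (exponent functions of finite support) to coefficients.\<close>

type_synonym 'v mpoly = "('v \<Rightarrow>\<^sub>0 nat) \<Rightarrow>\<^sub>0 real"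

definition Const :: "real \<Rightarrow> 'v mpoly" where
  "Const c = Poly_Mapping.single 0 c"

definition Indet :: "'v \<Rightarrow> 'v mpoly" where
  "Indet x = Poly_Mapping.single (Poly_Mapping.single x 1) 1"

definition const_coeff :: "'v mpoly \<Rightarrow> real" where
  "const_coeff p = Poly_Mapping.lookup p 0"

text \<open>Subtraction of exponents is truncated, but where it truncates the coefficient is \<open>0\<close>.\<close>

definition pdiff :: "'v \<Rightarrow> 'v mpoly \<Rightarrow> 'v mpoly" where
  "pdiff x p = (\<Sum>m\<in>Poly_Mapping.keys p.
     Poly_Mapping.single (m - Poly_Mapping.single x 1)
       (real (Poly_Mapping.lookup m x) * Poly_Mapping.lookup p m))"

primrec mat_power ::
    "'a set \<Rightarrow> ('a \<Rightarrow> 'a \<Rightarrow> 'r::comm_ring_1) \<Rightarrow> nat \<Rightarrow> 'a \<Rightarrow> 'a \<Rightarrow> 'r" where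
  "mat_power V A 0 = (\<lambda>i j. if i = j then 1 else 0)"
| "mat_power V A (Suc q) = (\<lambda>i j. \<Sum>l\<in>V. mat_power V A q i l * A l j)"

text \<open>\<open>trace_power V q\<close> is \<open>tr (A\<^sup>q)\<close> for the \<open>V \<times> V\<close> matrix \<open>A\<close> of indeterminates \<open>a\<^sub>i\<^sub>j\<close>, the
  indeterminate \<open>a\<^sub>i\<^sub>j\<close> being indexed by the pair \<open>(i, j)\<close>.\<close>

definition trace_power :: "'a set \<Rightarrow> nat \<Rightarrow> ('a \<times> 'a) mpoly" where
  "trace_power V q = (\<Sum>i\<in>V. mat_power V (\<lambda>i j. Indet (i, j)) q i i)"

text \<open>The operator \<open>\<Sum>\<^sub>\<gamma> T\<^sub>i\<^sub>\<gamma> \<partial>/\<partial>a\<^sub>i\<^sub>\<gamma>\<close> with \<open>\<gamma> \<in> V\<^sup>k\<^sup>-\<^sup>1\<close>.\<close>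

definition tensor_diff_op ::
    "'a set \<Rightarrow> nat \<Rightarrow> 'a tensor \<Rightarrow> 'a \<Rightarrow> ('a \<times> 'a) mpoly \<Rightarrow> ('a \<times> 'a) mpoly" where
  "tensor_diff_op V k T i p =
     (\<Sum>\<gamma> | set \<gamma> \<subseteq> V \<and> length \<gamma> = k - 1.
        Const (T (i # \<gamma>)) * fold (\<lambda>j. pdiff (i, j)) \<gamma> p)"

text \<open>\<open>tensor_trace V k T s\<close> is \<open>Tr\<^sub>s(T)\<close>, the sum of the \<open>s\<close>-th powers of the eigenvalues of \<open>T\<close>,
  in the Morozov--Shakirov form. The operators for different \<open>i\<close> commute (proved below), so the
  fold over the set \<open>V\<close> is their product. The operators in a summand have
  total order \<open>s (k - 1)\<close>, which is the degree of the homogeneous polynomial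
  \<open>tr (A\<^sup>s\<^sup>(\<^sup>k\<^sup>-\<^sup>1\<^sup>))\<close> they are applied to, so the result is a constant polynomial
  and \<open>const_coeff\<close> merely reads off its value.\<close>

definition tensor_trace :: "'a set \<Rightarrow> nat \<Rightarrow> 'a tensor \<Rightarrow> nat \<Rightarrow> real" where
  "tensor_trace V k T s =
     (if s = 0 then real (card V) * real (k - 1) ^ (card V - 1)
      else real (k - 1) ^ (card V - 1) *
        (\<Sum>c | c \<in> V \<rightarrow>\<^sub>E UNIV \<and> (\<Sum>i\<in>V. c i) = s.
           (\<Prod>i\<in>V. 1 / fact (c i * (k - 1))) *
           const_coeff
             (Finite_Set.fold (\<lambda>i. tensor_diff_op V k T i ^^ c i)
               (trace_power V (s * (k - 1))) V)))"

definition S_trace :: "real \<Rightarrow> nat \<Rightarrow> 'a hypergraph \<Rightarrow> nat \<Rightarrow> real" where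
  "S_trace \<alpha> k H s = tensor_trace (verts H) k (A_tensor \<alpha> k H) s"

definition S_less :: "real \<Rightarrow> nat \<Rightarrow> 'a hypergraph \<Rightarrow> 'b hypergraph \<Rightarrow> bool" where
  "S_less \<alpha> k G H \<longleftrightarrow>
     card (verts G) = card (verts H) \<and>
     (\<exists>s\<in>{1..card (verts H) * (k - 1) ^ (card (verts H) - 1) - 1}.
        (\<forall>r<s. S_trace \<alpha> k G r = S_trace \<alpha> k H r) \<and> S_trace \<alpha> k G s < S_trace \<alpha> k H s)"


section \<open>Commutation of the differential operators\<close>

lemma lookup_pdiff:
  "Poly_Mapping.lookup (pdiff x p) m =
     real (Suc (Poly_Mapping.lookup m x)) * Poly_Mapping.lookup p (m + Poly_Mapping.single x 1)"
proof -
  let ?e = "Poly_Mapping.single x (1::nat)"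
  have key: "real (Poly_Mapping.lookup n x) * Poly_Mapping.lookup p n * (if n - ?e = m then 1 else 0)
      = (if n = m + ?e then real (Poly_Mapping.lookup n x) * Poly_Mapping.lookup p n else 0)" for n
  proof (cases "Poly_Mapping.lookup n x = 0")
    case True
    then show ?thesis by (cases "n = m + ?e") auto
  next
    case False
    then have "n = (n - ?e) + ?e"
      by (intro poly_mapping_eqI) (auto simp: lookup_add lookup_minus lookup_single when_def)
    then have "n - ?e = m \<longleftrightarrow> n = m + ?e" by auto
    then show ?thesis by simp
  qed
  have "Poly_Mapping.lookup (pdiff x p) m =
      (\<Sum>n\<in>Poly_Mapping.keys p.
         real (Poly_Mapping.lookup n x) * Poly_Mapping.lookup p n * (if n - ?e = m then 1 else 0))"
    unfolding pdiff_def lookup_sum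
    by (intro sum.cong) (auto simp: lookup_single when_def)
  also have "\<dots> = (\<Sum>n\<in>Poly_Mapping.keys p.
      (if n = m + ?e then real (Poly_Mapping.lookup n x) * Poly_Mapping.lookup p n else 0))"
    by (simp only: key)
  also have "\<dots> = real (Poly_Mapping.lookup (m + ?e) x) * Poly_Mapping.lookup p (m + ?e)"
    by (auto simp: in_keys_iff)
  finally show ?thesis by (simp add: lookup_add)
qed

lemma lookup_Const_times: "Poly_Mapping.lookup (Const c * p) m = c * Poly_Mapping.lookup p m"
  unfolding Const_def mult_map_scale_conv_mult [symmetric]
  by (simp add: Poly_Mapping.map.rep_eq when_def)

lemma pdiff_commute: "pdiff x (pdiff y p) = pdiff y (pdiff x p)"
  by (rule poly_mapping_eqI)
    (auto simp: lookup_pdiff lookup_add lookup_single when_def add_ac)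

lemma pdiff_sum: "pdiff x (\<Sum>b\<in>B. f b) = (\<Sum>b\<in>B. pdiff x (f b))"
  by (rule poly_mapping_eqI) (simp add: lookup_pdiff lookup_sum sum_distrib_left)

lemma pdiff_Const_times: "pdiff x (Const c * p) = Const c * pdiff x p"
  by (rule poly_mapping_eqI) (simp add: lookup_pdiff lookup_Const_times)

lemma pdiff_tensor_diff_op:
  "pdiff x (tensor_diff_op V k T i p) = tensor_diff_op V k T i (pdiff x p)"
proof -
  have "pdiff x (fold (\<lambda>j. pdiff (i, j)) \<gamma> p) = fold (\<lambda>j. pdiff (i, j)) \<gamma> (pdiff x p)" for \<gamma>
    by (induction \<gamma> arbitrary: p) (simp_all add: pdiff_commute)
  then show ?thesis
    by (simp add: tensor_diff_op_def pdiff_sum pdiff_Const_times)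
qed

lemma tensor_diff_op_sum:
  "tensor_diff_op V k T i (\<Sum>b\<in>B. f b) = (\<Sum>b\<in>B. tensor_diff_op V k T i (f b))"
proof -
  have "fold (\<lambda>j. pdiff (i, j)) \<gamma> (\<Sum>b\<in>B. f b) = (\<Sum>b\<in>B. fold (\<lambda>j. pdiff (i, j)) \<gamma> (f b))" for \<gamma>
    by (induction \<gamma> arbitrary: f) (simp_all add: pdiff_sum)
  then show ?thesis
    unfolding tensor_diff_op_def by (simp add: sum_distrib_left sum.swap [of _ B])
qed

lemma tensor_diff_op_Const_times:
  "tensor_diff_op V k T i (Const c * p) = Const c * tensor_diff_op V k T i p"
proof -
  have "fold (\<lambda>j. pdiff (i, j)) \<gamma> (Const c * p) = Const c * fold (\<lambda>j. pdiff (i, j)) \<gamma> p" for \<gamma>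
    by (induction \<gamma> arbitrary: p) (simp_all add: pdiff_Const_times)
  then show ?thesis
    by (simp add: tensor_diff_op_def sum_distrib_left mult.left_commute)
qed

lemma tensor_diff_op_commute:
  "tensor_diff_op V k T i (tensor_diff_op V k T j p) =
   tensor_diff_op V k T j (tensor_diff_op V k T i p)"
proof -
  have "fold (\<lambda>l. pdiff (j, l)) \<gamma> (tensor_diff_op V k T i p) =
      tensor_diff_op V k T i (fold (\<lambda>l. pdiff (j, l)) \<gamma> p)" for \<gamma>
    by (induction \<gamma> arbitrary: p) (simp_all add: pdiff_tensor_diff_op)
  then show ?thesis
    unfolding tensor_diff_op_def [of V k T j]
    by (simp add: tensor_diff_op_sum tensor_diff_op_Const_times)
qed

lemma comp_fun_commute_tensor_diff_op:
  "comp_fun_commute (\<lambda>i. tensor_diff_op V k T i ^^ c i)"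
proof -
  have *: "tensor_diff_op V k T i ((tensor_diff_op V k T j ^^ a) p) =
      (tensor_diff_op V k T j ^^ a) (tensor_diff_op V k T i p)" for i j a p
    by (induction a) (simp_all add: tensor_diff_op_commute [of V k T i j])
  have "(tensor_diff_op V k T i ^^ a) ((tensor_diff_op V k T j ^^ b) p) =
      (tensor_diff_op V k T j ^^ b) ((tensor_diff_op V k T i ^^ a) p)" for i j a b p
    by (induction a) (simp_all add: *)
  then show ?thesis by unfold_locales (simp add: fun_eq_iff)
qed

end

theory Submission
  imports Defs "HOL-Library.Multiset" "HOL-Library.Indicator_Function"
begin

text \<open>The trace \<open>Tr\<^sub>s\<close> is a sum, with positive coefficients, over closed walks whose arcs are grouped into
  \<open>s\<close> bundles, each bundle weighted by a tensor entry. As \<open>Tr\<^sub>0\<close> and \<open>Tr\<^sub>1\<close> agree on the class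
  and \<open>Tr\<^sub>2\<close> is an affine function of the sum of the squared degrees, a maximal hypertree has all its excess
  degree at one inner vertex of a diametral path, so it is \<open>S_{j, d - j, 1, \<dots>, 1}\<close> with \<open>j \<le> d / 2\<close>.
  For \<open>j < t\<close> subtract from both traces that of the bare path. What remains comes from walks seeing
  the branching vertex, and if \<open>s \<le> k j + 2\<close> such a walk stays within distance \<open>j\<close> of it. Shifting that
  ball along the path from the \<open>j\<close>-th to the \<open>t\<close>-th joint preserves all weights except that of the loop at the
  end of the short leg, which grows because that vertex has degree \<open>1\<close> for \<open>j\<close> and degree \<open>2\<close> for \<open>t\<close>.
  A walk sees both the branching vertex and this loop only if it has at least \<open>k j + 2\<close> bundles, and
  then the trace for \<open>t\<close> is larger.\<close>


section \<open>Traces as sums over closed walks\<close>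

text \<open>The threshold \<open>k * j + 2\<close> comes from a cut argument. If an axis edge
  separates two vertices of a closed walk, then each of its \<open>k\<close> vertices has to be the
  source of a bundle supported on that edge (\<open>gate_all_used\<close>), so crossing an edge
  costs \<open>k\<close> bundles. Joining the branching joint to the end of the short leg costs
  \<open>k * j\<close>; the bundle that sees the pendant edges and the loop bundle at the end are
  the other two. Leaving the ball of radius \<open>j\<close> costs at least
  \<open>k * (j + 1) + 1\<close> bundles, which exceeds \<open>k * j + 2\<close> since
  \<open>k \<ge> 2\<close>, so up to that size the ball can be treated in isolation. The shift of
  the ball is not induced by an isomorphism of the brooms. It is therefore extended to some
  permutation of the common vertex set. Relabelling by a permutation does not change the total of
  the bare path, so this total can be subtracted on both sides although single walks change their
  weights. Inside the ball the weight of a walk changes by a factor 2 for each loop bundle at the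
  end, which leaves a comparison of nonnegative products.\<close>

definition monom_of :: "'v multiset \<Rightarrow> 'v \<Rightarrow>\<^sub>0 nat" where
  "monom_of M = (\<Sum>x\<in>#M. Poly_Mapping.single x 1)"

lemma monom_of_empty [simp]: "monom_of {#} = 0"
  by (simp add: monom_of_def)

lemma monom_of_add_mset: "monom_of (add_mset x M) = monom_of M + Poly_Mapping.single x 1"
  by (simp add: monom_of_def add.commute)

lemma lookup_monom_of [simp]: "Poly_Mapping.lookup (monom_of M) x = count M x"
  by (induction M) (auto simp: monom_of_add_mset lookup_add lookup_single when_def)

lemma monom_of_eq_iff [simp]: "monom_of M = monom_of N \<longleftrightarrow> M = N"
  by (metis lookup_monom_of multiset_eqI)

text \<open>The constant that remains when the monomial of \<open>M\<close> is differentiated once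
  along every member of \<open>M\<close>.\<close>

definition fact_prod :: "'v multiset \<Rightarrow> real" where
  "fact_prod M = (\<Prod>x\<in>set_mset M. fact (count M x))"

lemma fact_prod_pos: "fact_prod M > 0"
  by (simp add: fact_prod_def prod_pos)

lemma fact_prod_add_mset: "fact_prod (add_mset x M) = real (Suc (count M x)) * fact_prod M"
proof -
  have *: "fact_prod N = fact (count N x) * (\<Prod>y\<in>set_mset N - {x}. fact (count N y))"
    for N :: "'a multiset"
    by (cases "x \<in># N")
      (simp_all add: fact_prod_def prod.remove [of "set_mset N" x] not_in_iff)
  have "(\<Prod>y\<in>set_mset M - {x}. fact (count (add_mset x M) y)) =
      (\<Prod>y\<in>set_mset M - {x}. fact (count M y) :: real)"
    by (intro prod.cong) auto
  then show ?thesis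
    by (subst (1 2) *) (simp add: algebra_simps)
qed

definition pdiffs :: "'v multiset \<Rightarrow> 'v mpoly \<Rightarrow> 'v mpoly" where
  "pdiffs M p = fold_mset pdiff p M"

interpretation pdiff: comp_fun_commute pdiff
  by unfold_locales (simp add: fun_eq_iff pdiff_commute)

lemma pdiffs_empty [simp]: "pdiffs {#} p = p"
  by (simp add: pdiffs_def)

lemma pdiffs_add_mset: "pdiffs (add_mset x M) p = pdiff x (pdiffs M p)"
  by (simp add: pdiffs_def pdiff.fold_mset_add_mset)

lemma pdiffs_union: "pdiffs (M + N) p = pdiffs M (pdiffs N p)"
  by (induction M) (simp_all add: pdiffs_add_mset)

lemma pdiffs_pdiff: "pdiffs M (pdiff x p) = pdiff x (pdiffs M p)"
  by (induction M) (simp_all add: pdiffs_add_mset pdiff_commute)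

lemma pdiffs_sum: "pdiffs M (\<Sum>b\<in>B. f b) = (\<Sum>b\<in>B. pdiffs M (f b))"
  by (induction M) (simp_all add: pdiffs_add_mset pdiff_sum)

lemma pdiffs_Const_times: "pdiffs M (Const c * p) = Const c * pdiffs M p"
  by (induction M) (simp_all add: pdiffs_add_mset pdiff_Const_times)

lemma fold_pdiff: "fold (\<lambda>j. pdiff (i, j)) \<gamma> p = pdiffs (image_mset (Pair i) (mset \<gamma>)) p"
  by (induction \<gamma> arbitrary: p) (simp_all add: pdiffs_add_mset pdiffs_pdiff)

text \<open>Each derivative lowers the monomial by one member and contributes the exponent that this
  member has at that moment. The derivatives commute, so the induction can apply
  \<open>pdiff x\<close> first and use its hypothesis for \<open>pdiff x p\<close>.\<close>

lemma const_coeff_pdiffs: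
  "const_coeff (pdiffs M p) = fact_prod M * Poly_Mapping.lookup p (monom_of M)"
proof (induction M arbitrary: p)
  case empty
  then show ?case by (simp add: const_coeff_def fact_prod_def)
next
  case (add x M)
  have "const_coeff (pdiffs (add_mset x M) p) = const_coeff (pdiffs M (pdiff x p))"
    by (simp add: pdiffs_add_mset pdiffs_pdiff)
  also have "\<dots> = fact_prod (add_mset x M) * Poly_Mapping.lookup p (monom_of (add_mset x M))"
    by (simp add: add lookup_pdiff fact_prod_add_mset monom_of_add_mset)
  finally show ?case .
qed

lemma Const_mult: "Const a * Const b = Const (a * b)"
  by (simp add: Const_def mult_single)

lemma Const_1: "Const 1 = 1"
  by (simp add: Const_def)

section \<open>Monomials of the trace power and closed walks\<close>

definition arcs :: "'a list \<Rightarrow> ('a \<times> 'a) multiset" where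
  "arcs W = mset (zip W (tl W))"

lemma arcs_snoc: "W \<noteq> [] \<Longrightarrow> arcs (W @ [x]) = add_mset (last W, x) (arcs W)"
proof (induction W)
  case (Cons a W)
  then show ?case by (cases W) (simp_all add: arcs_def)
qed (simp add: arcs_def)

definition walks :: "'a set \<Rightarrow> nat \<Rightarrow> 'a \<Rightarrow> 'a \<Rightarrow> 'a list set" where
  "walks V q i j = {W. length W = Suc q \<and> set W \<subseteq> V \<and> hd W = i \<and> last W = j}"

lemma finite_walks: "finite V \<Longrightarrow> finite (walks V q i j)"
  by (rule finite_subset [OF _ finite_lists_length_eq [of V "Suc q"]]) (auto simp: walks_def)

lemma mat_power_Indet:
  assumes "finite V" "i \<in> V" "j \<in> V"
  shows "mat_power V (\<lambda>i j. Indet (i, j)) q i j =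
    (\<Sum>W\<in>walks V q i j. Poly_Mapping.single (monom_of (arcs W)) 1)"
  using assms(3)
proof (induction q arbitrary: j)
  case 0
  have "walks V 0 i j = (if i = j then {[i]} else {})"
    using assms by (auto simp: walks_def length_Suc_conv)
  then show ?case by (simp add: arcs_def)
next
  case (Suc q)
  let ?m = "\<lambda>W. Poly_Mapping.single (monom_of (arcs W)) (1::real)"
  have "mat_power V (\<lambda>i j. Indet (i, j)) (Suc q) i j =
      (\<Sum>l\<in>V. \<Sum>W\<in>walks V q i l. ?m W * Indet (l, j))"
    by (simp add: Suc.IH sum_distrib_right)
  also have "\<dots> = (\<Sum>l\<in>V. \<Sum>W\<in>walks V q i l. ?m (W @ [j]))"
  proof (intro sum.cong refl)
    fix l W assume "l \<in> V" "W \<in> walks V q i l"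
    then have "W \<noteq> []" "last W = l" by (auto simp: walks_def)
    then show "?m W * Indet (l, j) = ?m (W @ [j])"
      by (simp add: arcs_snoc Indet_def mult_single monom_of_add_mset)
  qed
  also have "\<dots> = (\<Sum>(l, W)\<in>Sigma V (walks V q i). ?m (W @ [j]))"
    using assms(1) by (simp add: sum.Sigma finite_walks)
  also have "\<dots> = (\<Sum>W\<in>walks V (Suc q) i j. ?m W)"
  proof (rule sum.reindex_bij_witness [where
        i = "\<lambda>W. (last (butlast W), butlast W)" and j = "\<lambda>(l, W). W @ [j]"], goal_cases)
    case (3 W)
    then have "W \<noteq> []" "last W = j" by (auto simp: walks_def)
    then show ?case using append_butlast_last_id [of W] by auto
  next
    case (4 W)
    then have W: "W \<noteq> []" "length (butlast W) = Suc q" "set W \<subseteq> V" "hd W = i" "last W = j"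
      by (auto simp: walks_def)
    moreover from W have "W = butlast W @ [j]"
      using append_butlast_last_id [of W] by metis
    moreover from W have "butlast W \<noteq> []" by (metis list.size(3) nat.distinct(1))
    ultimately have W: "W \<noteq> []" "length (butlast W) = Suc q" "set W \<subseteq> V" "hd W = i" 
      "W = butlast W @ [j]" "butlast W \<noteq> []" by blast+
    from W have "hd (butlast W) = i" by (metis hd_append)
    moreover have "set (butlast W) \<subseteq> V" using W by (meson in_set_butlastD subset_eq)
    moreover have "last (butlast W) \<in> V"
      using W calculation(2) by (meson last_in_set subsetD)
    ultimately show ?case using W by (auto simp: walks_def)
  qed (use Suc.prems in \<open>auto simp: walks_def hd_append\<close>)
  finally show ?case .
qed

text \<open>The trace sums over the initial vertex, so the walks are rooted lists: distinct
  rotations of one cycle are counted separately.\<close>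

definition closed_walks :: "'a set \<Rightarrow> nat \<Rightarrow> 'a list set" where
  "closed_walks V q = {W. length W = Suc q \<and> set W \<subseteq> V \<and> hd W = last W}"

lemma finite_closed_walks: "finite V \<Longrightarrow> finite (closed_walks V q)"
  by (rule finite_subset [OF _ finite_lists_length_eq [of V "Suc q"]]) (auto simp: closed_walks_def)

lemma lookup_trace_power:
  assumes "finite V"
  shows "Poly_Mapping.lookup (trace_power V q) (monom_of M) =
    card {W \<in> closed_walks V q. arcs W = M}"
proof -
  have cw: "closed_walks V q = (\<Union>i\<in>V. walks V q i i)"
  proof
    show "closed_walks V q \<subseteq> (\<Union>i\<in>V. walks V q i i)"
    proof
      fix W assume W: "W \<in> closed_walks V q"
      then have "W \<noteq> []" "set W \<subseteq> V" by (auto simp: closed_walks_def)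
      then have "hd W \<in> V" by (meson hd_in_set subsetD)
      then show "W \<in> (\<Union>i\<in>V. walks V q i i)" using W by (auto simp: walks_def closed_walks_def)
    qed
  qed (auto simp: walks_def closed_walks_def)
  have "trace_power V q =
      (\<Sum>i\<in>V. \<Sum>W\<in>walks V q i i. Poly_Mapping.single (monom_of (arcs W)) 1)"
    unfolding trace_power_def using assms by (intro sum.cong) (simp_all add: mat_power_Indet)
  also have "\<dots> = (\<Sum>W\<in>closed_walks V q. Poly_Mapping.single (monom_of (arcs W)) 1)"
    unfolding cw by (rule sum.UNION_disjoint [symmetric])
      (use assms finite_walks [OF assms] in \<open>auto simp: walks_def\<close>)
  finally show ?thesis
    by (simp add: lookup_sum lookup_single when_def finite_closed_walks [OF assms]
        sum.If_cases [where P = "\<lambda>W. arcs W = M"] Int_def)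
qed

text \<open>The targets of one bundle: the remaining \<open>k - 1\<close> indices of a tensor entry
  whose first index is the source.\<close>

definition tails :: "'a set \<Rightarrow> nat \<Rightarrow> 'a list set" where
  "tails V k = {\<gamma>. set \<gamma> \<subseteq> V \<and> length \<gamma> = k - 1}"

text \<open>Ordered lists, because a power of a sum expands over ordered choices of its terms; this
  spares multinomial coefficients.\<close>

definition tail_lists :: "'a set \<Rightarrow> nat \<Rightarrow> nat \<Rightarrow> 'a list list set" where
  "tail_lists V k c = {\<Gamma>. set \<Gamma> \<subseteq> tails V k \<and> length \<Gamma> = c}"

lemma finite_tails: "finite V \<Longrightarrow> finite (tails V k)"
  by (simp add: tails_def finite_lists_length_eq)

lemma finite_tail_lists: "finite V \<Longrightarrow> finite (tail_lists V k c)"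
  by (simp add: tail_lists_def finite_lists_length_eq finite_tails)

definition row_weight :: "'a tensor \<Rightarrow> 'a \<Rightarrow> 'a list list \<Rightarrow> real" where
  "row_weight T i \<Gamma> = prod_list (map (\<lambda>\<gamma>. T (i # \<gamma>)) \<Gamma>)"

definition row_arcs :: "'a \<Rightarrow> 'a list list \<Rightarrow> ('a \<times> 'a) multiset" where
  "row_arcs i \<Gamma> = image_mset (Pair i) (mset (concat \<Gamma>))"

lemma tensor_diff_op_power:
  assumes "finite V"
  shows "(tensor_diff_op V k T i ^^ c) p =
    (\<Sum>\<Gamma>\<in>tail_lists V k c. Const (row_weight T i \<Gamma>) * pdiffs (row_arcs i \<Gamma>) p)"
proof (induction c)
  case 0
  have "tail_lists V k 0 = {[]}" by (auto simp: tail_lists_def)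
  then show ?case by (simp add: row_weight_def row_arcs_def Const_1)
next
  case (Suc c)
  have "(tensor_diff_op V k T i ^^ Suc c) p =
      (\<Sum>\<Gamma>\<in>tail_lists V k c. \<Sum>\<gamma>\<in>tails V k.
        Const (row_weight T i (\<gamma> # \<Gamma>)) * pdiffs (row_arcs i (\<gamma> # \<Gamma>)) p)"
    by (simp add: Suc.IH tensor_diff_op_sum tensor_diff_op_Const_times)
      (simp add: tensor_diff_op_def tails_def fold_pdiff sum_distrib_left row_weight_def
        row_arcs_def pdiffs_union mult.assoc [symmetric] Const_mult mult.commute)
  also have "\<dots> = (\<Sum>(\<Gamma>, \<gamma>)\<in>tail_lists V k c \<times> tails V k.
        Const (row_weight T i (\<gamma> # \<Gamma>)) * pdiffs (row_arcs i (\<gamma> # \<Gamma>)) p)"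
    by (simp add: sum.cartesian_product)
  also have "\<dots> = (\<Sum>\<Gamma>\<in>tail_lists V k (Suc c).
      Const (row_weight T i \<Gamma>) * pdiffs (row_arcs i \<Gamma>) p)"
    by (rule sum.reindex_bij_witness [where i = "\<lambda>\<Gamma>. (tl \<Gamma>, hd \<Gamma>)" and j = "\<lambda>(\<Gamma>, \<gamma>). \<gamma> # \<Gamma>"])
      (auto simp: tail_lists_def length_Suc_conv)
  finally show ?case .
qed

lemma fold_tensor_diff_op:
  assumes "finite V" "finite A"
  shows "Finite_Set.fold (\<lambda>i. tensor_diff_op V k T i ^^ c i) p A =
    (\<Sum>F\<in>PiE A (\<lambda>i. tail_lists V k (c i)).
       Const (\<Prod>i\<in>A. row_weight T i (F i)) * pdiffs (\<Sum>i\<in>A. row_arcs i (F i)) p)"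
  using assms(2)
proof (induction A rule: finite_induct)
  case empty
  then show ?case by (simp add: Const_1)
next
  case (insert a A)
  interpret comp_fun_commute "\<lambda>i. tensor_diff_op V k T i ^^ c i"
    by (rule comp_fun_commute_tensor_diff_op)
  let ?t = "\<lambda>A F. Const (\<Prod>i\<in>A. row_weight T i (F i)) * pdiffs (\<Sum>i\<in>A. row_arcs i (F i)) p"
  let ?P = "\<lambda>A. PiE A (\<lambda>i. tail_lists V k (c i))"
  have "Finite_Set.fold (\<lambda>i. tensor_diff_op V k T i ^^ c i) p (insert a A) =
      (tensor_diff_op V k T a ^^ c a) (\<Sum>F\<in>?P A. ?t A F)"
    using insert by simp
  also have "\<dots> = (\<Sum>\<Gamma>\<in>tail_lists V k (c a). \<Sum>F\<in>?P A. ?t (insert a A) (F(a := \<Gamma>)))"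
  proof -
    have 1: "(\<Prod>i\<in>A. row_weight T i (if i = a then \<Gamma> else F i)) = (\<Prod>i\<in>A. row_weight T i (F i))"
      "(\<Sum>i\<in>A. row_arcs i (if i = a then \<Gamma> else F i)) = (\<Sum>i\<in>A. row_arcs i (F i))" for \<Gamma> F
      using insert.hyps by (auto intro!: prod.cong sum.cong)
    show ?thesis
      using insert.hyps by (simp add: tensor_diff_op_power [OF assms(1)] pdiffs_sum 
          pdiffs_Const_times sum_distrib_left 1 pdiffs_union mult.assoc [symmetric] Const_mult)
  qed
  also have "\<dots> = (\<Sum>(\<Gamma>, F)\<in>tail_lists V k (c a) \<times> ?P A. ?t (insert a A) (F(a := \<Gamma>)))"
    by (simp add: sum.cartesian_product)
  also have "\<dots> = (\<Sum>F\<in>?P (insert a A). ?t (insert a A) F)"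
    unfolding PiE_insert_eq
    by (subst sum.reindex [OF inj_combinator [OF insert.hyps(2)]]) (auto intro!: sum.cong)
  finally show ?case .
qed

text \<open>An object of size \<open>s\<close> is a closed walk \<open>W\<close> together with a way of grouping its arcs into
  \<open>s\<close> bundles of \<open>k - 1\<close> arcs with a common tail: the bundle \<open>\<gamma>\<close> in \<open>F i\<close> consists of the arcs
  from \<open>i\<close> to the members of \<open>\<gamma>\<close>.\<close>

definition objs :: "'a set \<Rightarrow> nat \<Rightarrow> nat \<Rightarrow> ('a list \<times> ('a \<Rightarrow> 'a list list)) set" where
  "objs V k s = {(W, F). W \<in> closed_walks V (s * (k - 1)) \<and>
     F \<in> PiE V (\<lambda>_. {\<Gamma>. set \<Gamma> \<subseteq> tails V k}) \<and> (\<Sum>i\<in>V. length (F i)) = s \<and>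
     arcs W = (\<Sum>i\<in>V. row_arcs i (F i))}"

definition obj_weight :: "'a set \<Rightarrow> 'a tensor \<Rightarrow> ('a \<Rightarrow> 'a list list) \<Rightarrow> real" where
  "obj_weight V T F = (\<Prod>i\<in>V. row_weight T i (F i))"

text \<open>The numerator stems from the derivatives, the denominator from the factorials of the
  trace formula. The tensor does not enter, so comparing traces reduces to comparing weights, with
  positive coefficients.\<close>

definition obj_coeff :: "'a set \<Rightarrow> nat \<Rightarrow> ('a \<Rightarrow> 'a list list) \<Rightarrow> real" where
  "obj_coeff V k F =
     fact_prod (\<Sum>i\<in>V. row_arcs i (F i)) / (\<Prod>i\<in>V. fact (length (F i) * (k - 1)))"

lemma obj_coeff_pos: "obj_coeff V k F > 0"
  by (simp add: obj_coeff_def fact_prod_pos prod_pos)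

definition obj_sum :: "'a set \<Rightarrow> nat \<Rightarrow> 'a tensor \<Rightarrow> nat \<Rightarrow> real" where
  "obj_sum V k T s = (\<Sum>(W, F)\<in>objs V k s. obj_coeff V k F * obj_weight V T F)"

lemma finite_compositions:
  assumes "finite V"
  shows "finite {c \<in> V \<rightarrow>\<^sub>E UNIV. (\<Sum>i\<in>V. c i) = (s::nat)}"
proof (rule finite_subset)
  show "{c \<in> V \<rightarrow>\<^sub>E UNIV. (\<Sum>i\<in>V. c i) = s} \<subseteq> V \<rightarrow>\<^sub>E {..s}"
  proof
    fix c assume c: "c \<in> {c \<in> V \<rightarrow>\<^sub>E UNIV. (\<Sum>i\<in>V. c i) = s}"
    have "c i \<le> s" if "i \<in> V" for i
      using c member_le_sum [of i V c] that assms by simp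
    then show "c \<in> V \<rightarrow>\<^sub>E {..s}" using c by (simp add: PiE_iff)
  qed
  show "finite (V \<rightarrow>\<^sub>E {..s})" using assms by (intro finite_PiE) auto
qed

definition bundlings :: "'a set \<Rightarrow> nat \<Rightarrow> nat \<Rightarrow> ('a \<Rightarrow> 'a list list) set" where
  "bundlings V k s = {F \<in> PiE V (\<lambda>_. {\<Gamma>. set \<Gamma> \<subseteq> tails V k}). (\<Sum>i\<in>V. length (F i)) = s}"

lemma finite_bundlings:
  assumes "finite V"
  shows "finite (bundlings V k s)"
proof (rule finite_subset)
  show "bundlings V k s \<subseteq> V \<rightarrow>\<^sub>E {\<Gamma>. set \<Gamma> \<subseteq> tails V k \<and> length \<Gamma> \<le> s}"
  proof
    fix F assume F: "F \<in> bundlings V k s"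
    have "length (F i) \<le> s" if "i \<in> V" for i
      using F member_le_sum [of i V "\<lambda>i. length (F i)"] that assms by (simp add: bundlings_def)
    then show "F \<in> V \<rightarrow>\<^sub>E {\<Gamma>. set \<Gamma> \<subseteq> tails V k \<and> length \<Gamma> \<le> s}"
      using F by (simp add: PiE_iff bundlings_def)
  qed
  show "finite (V \<rightarrow>\<^sub>E {\<Gamma>. set \<Gamma> \<subseteq> tails V k \<and> length \<Gamma> \<le> s})"
    using assms by (intro finite_PiE finite_lists_length_le finite_tails)
qed

text \<open>Bundling first, walk second: the order in which the trace formula produces an object,
  the walks entering as the coefficient of a monomial in \<open>trace_power\<close>.\<close>

lemma objs_alt:
  "objs V k s = (SIGMA F:bundlings V k s.
     {W \<in> closed_walks V (s * (k - 1)). arcs W = (\<Sum>i\<in>V. row_arcs i (F i))}) \<inverse>"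
  by (auto simp: objs_def bundlings_def)

lemma finite_objs:
  assumes "finite V"
  shows "finite (objs V k s)"
  unfolding objs_alt
  using assms by (simp add: finite_bundlings finite_closed_walks)

text \<open>A composition \<open>c\<close> with one list of tails per vertex is a bundling. Its
  derivatives extract the coefficient of its arc monomial in \<open>trace_power\<close>, that is the
  number of closed walks with exactly these arcs, times a product of factorials.\<close>

theorem tensor_trace_eq_obj_sum:
  assumes "finite V" "s > 0"
  shows "tensor_trace V k T s = real (k - 1) ^ (card V - 1) * obj_sum V k T s"
proof -
  let ?C = "{c \<in> V \<rightarrow>\<^sub>E UNIV. (\<Sum>i\<in>V. c i) = s}"
  let ?P = "\<lambda>c. PiE V (\<lambda>i. tail_lists V k (c i))"
  let ?A = "\<lambda>F. \<Sum>i\<in>V. row_arcs i (F i)"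
  let ?N = "\<lambda>F. real (card {W \<in> closed_walks V (s * (k - 1)). arcs W = ?A F})"
  have "(\<Sum>c\<in>?C. (\<Prod>i\<in>V. 1 / fact (c i * (k - 1))) *
           const_coeff (Finite_Set.fold (\<lambda>i. tensor_diff_op V k T i ^^ c i)
               (trace_power V (s * (k - 1))) V)) =
      (\<Sum>c\<in>?C. \<Sum>F\<in>?P c. (\<Prod>i\<in>V. 1 / fact (c i * (k - 1))) *
          (obj_weight V T F * (fact_prod (?A F) * ?N F)))"
    by (simp add: fold_tensor_diff_op [OF assms(1) assms(1)] const_coeff_def lookup_sum
        lookup_Const_times sum_distrib_left obj_weight_def)
      (simp add: const_coeff_pdiffs [unfolded const_coeff_def] lookup_trace_power [OF assms(1)])
  also have "\<dots> = (\<Sum>c\<in>?C. \<Sum>F\<in>?P c. obj_coeff V k F * obj_weight V T F * ?N F)"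
  proof (intro sum.cong refl)
    fix c F assume F: "F \<in> ?P c"
    have "(\<Prod>i\<in>V. 1 / fact (c i * (k - 1))) = (1::real) / (\<Prod>i\<in>V. fact (length (F i) * (k - 1)))"
      unfolding prod_dividef using F
      by (auto simp: tail_lists_def PiE_iff intro!: prod.cong)
    then show "(\<Prod>i\<in>V. 1 / fact (c i * (k - 1))) * (obj_weight V T F * (fact_prod (?A F) * ?N F)) =
        obj_coeff V k F * obj_weight V T F * ?N F"
      by (simp add: obj_coeff_def)
  qed
  also have "\<dots> = (\<Sum>(c, F)\<in>Sigma ?C ?P. obj_coeff V k F * obj_weight V T F * ?N F)"
    using assms(1) by (intro sum.Sigma) (auto intro!: finite_compositions finite_PiE finite_tail_lists)
  \<comment> \<open>The composition is recovered from \<open>F\<close> as the lengths of its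
    rows.\<close>
  also have "\<dots> = (\<Sum>F\<in>bundlings V k s. obj_coeff V k F * obj_weight V T F * ?N F)"
    by (rule sum.reindex_bij_witness [where j = snd and i = "\<lambda>F. (restrict (\<lambda>i. length (F i)) V, F)"])
      (auto simp: bundlings_def tail_lists_def PiE_iff extensional_def fun_eq_iff
        subset_iff)
  also have "\<dots> = (\<Sum>F\<in>bundlings V k s.
      \<Sum>W\<in>{W \<in> closed_walks V (s * (k - 1)). arcs W = ?A F}. obj_coeff V k F * obj_weight V T F)"
    by (simp add: mult.commute)
  also have "\<dots> = (\<Sum>(F, W)\<in>(SIGMA F:bundlings V k s.
      {W \<in> closed_walks V (s * (k - 1)). arcs W = ?A F}). obj_coeff V k F * obj_weight V T F)"
    using assms(1) by (intro sum.Sigma) (auto simp: finite_bundlings finite_closed_walks)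
  also have "\<dots> = obj_sum V k T s"
    unfolding obj_sum_def objs_alt
    by (rule sum.reindex_bij_witness [where i = prod.swap and j = prod.swap]) auto
  finally show ?thesis
    using assms(2) by (simp add: tensor_trace_def)
qed


section \<open>Invariance under isomorphism\<close>

lemma image_mset_sum: "image_mset f (sum h A) = (\<Sum>a\<in>A. image_mset f (h a))"
  by (induction A rule: infinite_finite_induct) auto

lemma set_mset_sum: "finite A \<Longrightarrow> set_mset (sum h A) = (\<Union>a\<in>A. set_mset (h a))"
  by (induction A rule: finite_induct) auto

lemma count_image_mset_inj_on:
  assumes "inj_on f (insert x (set_mset M))"
  shows "count (image_mset f M) (f x) = count M x"
  using assms
proof (induction M)
  case (add y M)
  then have "inj_on f (insert x (set_mset M))" by (auto simp: inj_on_def)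
  then show ?case using add by (auto simp: inj_on_def)
qed simp

lemma fact_prod_image:
  assumes "inj_on f (set_mset M)"
  shows "fact_prod (image_mset f M) = fact_prod M"
  unfolding fact_prod_def set_image_mset
  by (subst prod.reindex [OF assms], rule prod.cong)
    (simp_all add: assms count_image_mset_inj_on insert_absorb)

text \<open>\<open>g\<close> is meant to invert \<open>f\<close> on the old vertex set and is passed
  explicitly, because the rows of a new vertex are found at its preimage.\<close>

definition map_rows ::
    "'b set \<Rightarrow> ('a \<Rightarrow> 'b) \<Rightarrow> ('b \<Rightarrow> 'a) \<Rightarrow> ('a \<Rightarrow> 'a list list) \<Rightarrow> 'b \<Rightarrow> 'b list list" where
  "map_rows V' f g F = (\<lambda>v\<in>V'. map (map f) (F (g v)))"

lemma arcs_map: "arcs (map f W) = image_mset (map_prod f f) (arcs W)"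
  by (simp add: arcs_def zip_map_map map_tl [symmetric] map_prod_def)

lemma row_arcs_map: "row_arcs (f v) (map (map f) \<Gamma>) = image_mset (map_prod f f) (row_arcs v \<Gamma>)"
  by (simp add: row_arcs_def map_concat [symmetric] multiset.map_comp comp_def)

lemma sum_row_arcs_map:
  assumes "bij_betw f V V'" "\<And>v. v \<in> V \<Longrightarrow> g (f v) = v"
  shows "(\<Sum>i\<in>V'. row_arcs i (map_rows V' f g F i)) =
    image_mset (map_prod f f) (\<Sum>i\<in>V. row_arcs i (F i))"
proof -
  have "(\<Sum>i\<in>V'. row_arcs i (map_rows V' f g F i)) =
      (\<Sum>v\<in>V. row_arcs (f v) (map_rows V' f g F (f v)))"
    by (rule sum.reindex_bij_betw [OF assms(1), symmetric])
  also have "\<dots> = (\<Sum>v\<in>V. image_mset (map_prod f f) (row_arcs v (F v)))"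
  proof (rule sum.cong [OF refl])
    fix v assume "v \<in> V"
    moreover from this have "f v \<in> V'" using assms(1) by (auto simp: bij_betw_def)
    ultimately show "row_arcs (f v) (map_rows V' f g F (f v)) =
        image_mset (map_prod f f) (row_arcs v (F v))"
      by (simp add: map_rows_def assms(2) row_arcs_map)
  qed
  finally show ?thesis by (simp add: image_mset_sum)
qed

lemma objs_map:
  assumes "bij_betw f V V'" "\<And>v. v \<in> V \<Longrightarrow> g (f v) = v" "(W, F) \<in> objs V k s"
  shows "(map f W, map_rows V' f g F) \<in> objs V' k s"
proof -
  have fV: "f ` V = V'" using assms(1) by (simp add: bij_betw_def)
  have F: "set (F i) \<subseteq> tails V k" if "i \<in> V" for i
    using assms(3) that by (auto simp: objs_def PiE_iff)
  have "map f W \<in> closed_walks V' (s * (k - 1))"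
  proof -
    have "W \<noteq> []" "hd W = last W" "set W \<subseteq> V" "length W = Suc (s * (k - 1))"
      using assms(3) by (auto simp: objs_def closed_walks_def)
    then show ?thesis using fV by (auto simp: closed_walks_def hd_map last_map)
  qed
  moreover have "map_rows V' f g F \<in> PiE V' (\<lambda>_. {\<Gamma>. set \<Gamma> \<subseteq> tails V' k})"
  proof -
    have "map f \<gamma> \<in> tails V' k" if "v \<in> V" "\<gamma> \<in> set (F v)" for v \<gamma>
      using F [OF that(1)] that(2) fV by (auto simp: tails_def)
    then have "set (map (map f) (F (g (f v)))) \<subseteq> tails V' k" if "v \<in> V" for v
      using that assms(2) by auto
    then show ?thesis unfolding map_rows_def using fV by (auto simp: PiE_iff)
  qed
  moreover have "(\<Sum>i\<in>V'. length (map_rows V' f g F i)) = s"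
  proof -
    have "(\<Sum>i\<in>V'. length (map_rows V' f g F i)) = (\<Sum>v\<in>V. length (map_rows V' f g F (f v)))"
      by (rule sum.reindex_bij_betw [OF assms(1), symmetric])
    also have "\<dots> = (\<Sum>v\<in>V. length (F v))"
      using fV assms(2) by (intro sum.cong) (auto simp: map_rows_def)
    finally show ?thesis using assms(3) by (simp add: objs_def)
  qed
  moreover have "arcs (map f W) = (\<Sum>i\<in>V'. row_arcs i (map_rows V' f g F i))"
    using assms(3) by (simp add: sum_row_arcs_map [OF assms(1,2)] arcs_map objs_def)
  ultimately show ?thesis by (simp add: objs_def)
qed

lemma obj_weight_map:
  assumes "bij_betw f V V'" "\<And>v. v \<in> V \<Longrightarrow> g (f v) = v"
  shows "obj_weight V' T (map_rows V' f g F) = obj_weight V (\<lambda>is. T (map f is)) F"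
proof -
  have "obj_weight V' T (map_rows V' f g F) =
      (\<Prod>v\<in>V. row_weight T (f v) (map_rows V' f g F (f v)))"
    unfolding obj_weight_def by (rule prod.reindex_bij_betw [OF assms(1), symmetric])
  also have "\<dots> = obj_weight V (\<lambda>is. T (map f is)) F"
    unfolding obj_weight_def using assms(1)
    by (intro prod.cong) (auto simp: map_rows_def assms(2) row_weight_def comp_def bij_betw_def)
  finally show ?thesis .
qed

lemma arcs_subset: "(x, y) \<in># arcs W \<Longrightarrow> x \<in> set W \<and> y \<in> set W"
  by (cases W) (auto simp: arcs_def dest: set_zip_leftD set_zip_rightD)

lemma obj_coeff_map:
  assumes "bij_betw f V V'" "\<And>v. v \<in> V \<Longrightarrow> g (f v) = v" "(W, F) \<in> objs V k s"
  shows "obj_coeff V' k (map_rows V' f g F) = obj_coeff V k F"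
proof -
  have "(\<Prod>i\<in>V'. fact (length (map_rows V' f g F i) * (k - 1)) :: real) =
      (\<Prod>v\<in>V. fact (length (map_rows V' f g F (f v)) * (k - 1)))"
    by (rule prod.reindex_bij_betw [OF assms(1), symmetric])
  also have "\<dots> = (\<Prod>v\<in>V. fact (length (F v) * (k - 1)))"
    using assms(1) by (intro prod.cong) (auto simp: map_rows_def assms(2) bij_betw_def)
  finally have 1: "(\<Prod>i\<in>V'. fact (length (map_rows V' f g F i) * (k - 1)) :: real) =
      (\<Prod>v\<in>V. fact (length (F v) * (k - 1)))" .
  have "set_mset (\<Sum>i\<in>V. row_arcs i (F i)) \<subseteq> V \<times> V"
  proof
    fix a assume a: "a \<in># (\<Sum>i\<in>V. row_arcs i (F i))"
    obtain x y where xy: "a = (x, y)" by (cases a)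
    have "(x, y) \<in># arcs W" "set W \<subseteq> V" using a assms(3) xy by (auto simp: objs_def closed_walks_def)
    then show "a \<in> V \<times> V" using arcs_subset xy by fastforce
  qed
  moreover have "inj_on (map_prod f f) (V \<times> V)"
    using assms(1) by (auto simp: bij_betw_def inj_on_def)
  ultimately have "inj_on (map_prod f f) (set_mset (\<Sum>i\<in>V. row_arcs i (F i)))"
    by (rule inj_on_subset [rotated])
  then show ?thesis
    using sum_row_arcs_map [OF assms(1,2), of F] unfolding obj_coeff_def 1
    by (simp add: fact_prod_image)
qed

text \<open>Valid for every tensor and every bijection: it serves for isomorphisms of hypergraphs
  and later for a permutation of the vertices that need not be one.\<close>

lemma obj_sum_map:
  assumes "bij_betw f V V'"
  shows "obj_sum V' k T s = obj_sum V k (\<lambda>is. T (map f is)) s"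
proof -
  define g where "g = the_inv_into V f"
  have gf: "g (f v) = v" if "v \<in> V" for v
    using assms that by (simp add: g_def bij_betw_def the_inv_into_f_f)
  have g: "bij_betw g V' V" unfolding g_def by (rule bij_betw_the_inv_into [OF assms])
  have fg: "f (g v) = v" if "v \<in> V'" for v
    using assms that by (simp add: g_def bij_betw_def f_the_inv_into_f)
  have id: "map_rows B h' h (map_rows A h h' F) = F" "map h' (map h W) = W"
    if h: "bij_betw h B A" "\<And>v. v \<in> B \<Longrightarrow> h' (h v) = v" "(W, F) \<in> objs B k s" for W and F
      and A :: "'x set" and B :: "'y set" and h h'
  proof -
    show "map h' (map h W) = W"
      using h(2,3) by (auto simp: objs_def closed_walks_def intro!: map_idI)
    show "map_rows B h' h (map_rows A h h' F) = F"
    proof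
      fix v show "map_rows B h' h (map_rows A h h' F) v = F v"
      proof (cases "v \<in> B")
        case True
        have "h v \<in> A" using True h(1) by (auto simp: bij_betw_def)
        have eq: "map (\<lambda>x. h' (h x)) \<gamma> = \<gamma>" if "\<gamma> \<in> set (F v)" for \<gamma>
          using h(2,3) True that
          by (intro map_idI) (auto simp: objs_def PiE_iff tails_def subset_iff)
        have "map (\<lambda>\<gamma>. map (\<lambda>x. h' (h x)) \<gamma>) (F v) = F v" by (rule map_idI) (rule eq)
        with \<open>h v \<in> A\<close> show ?thesis using True h(2) by (simp add: map_rows_def comp_def)
      next
        case False
        then show ?thesis using h(3) by (auto simp: map_rows_def objs_def PiE_iff extensional_def)
      qed
    qed
  qed
  show ?thesis
    unfolding obj_sum_def
  proof (rule sum.reindex_bij_witness [where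
        i = "\<lambda>(W, F). (map f W, map_rows V' f g F)" and
        j = "\<lambda>(W, F). (map g W, map_rows V g f F)"], goal_cases)
    case (1 o')
    then show ?case using id [OF g fg] by (cases o') auto
  next
    case (2 o')
    then show ?case using objs_map [OF g fg] by (cases o') auto
  next
    case (3 o')
    then show ?case using id [OF assms gf] by (cases o') auto
  next
    case (4 o')
    then show ?case using objs_map [OF assms gf] by (cases o') auto
  next
    case (5 o')
    obtain W F where o': "o' = (W, F)" by (cases o')
    with 5 have "(W, F) \<in> objs V' k s" by simp
    note 6 = objs_map [OF g fg this] id(1) [OF g fg this]
    show ?case
      using obj_weight_map [OF assms gf, of T "map_rows V g f F"]
        obj_coeff_map [OF assms gf 6(1)] by (simp add: o' 6(2))
  qed
qed

lemma obj_weight_cong: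
  assumes "(W, F) \<in> objs V k s" "\<And>i \<gamma>. i \<in> V \<Longrightarrow> \<gamma> \<in> set (F i) \<Longrightarrow> T (i # \<gamma>) = T' (i # \<gamma>)"
  shows "obj_weight V T F = obj_weight V T' F"
proof -
  have "row_weight T i (F i) = row_weight T' i (F i)" if "i \<in> V" for i
    unfolding row_weight_def using assms(2) [OF that]
    by (intro arg_cong [of _ _ prod_list] map_cong) auto
  then show ?thesis unfolding obj_weight_def by (intro prod.cong) auto
qed

lemma S_trace_isomorphic:
  assumes iso: "isomorphic G H" and "finite (verts G)" and uniform: "\<forall>e\<in>edges G. e \<subseteq> verts G" 
  shows "S_trace \<alpha> k G s = S_trace \<alpha> k H s"
proof -
  obtain f where f: "bij_betw f (verts G) (verts H)" "edges H = (`) f ` edges G"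
    using iso by (auto simp: isomorphic_def)
  have inj: "inj_on f (verts G)" and fV: "f ` verts G = verts H"
    using f(1) by (auto simp: bij_betw_def)
  have card: "card (verts G) = card (verts H)" using f(1) by (rule bij_betw_same_card)
  show ?thesis
  proof (cases "s = 0")
    case True
    then show ?thesis using card by (simp add: S_trace_def tensor_trace_def)
  next
    case False
    have edge: "f ` X \<in> edges H \<longleftrightarrow> X \<in> edges G" if "X \<subseteq> verts G" for X
      unfolding f(2) using that uniform inj by (auto simp: inj_on_image_eq_iff)
    have deg: "degree H (f v) = degree G v" if "v \<in> verts G" for v
    proof -
      have "{e \<in> edges H. f v \<in> e} = (`) f ` {e \<in> edges G. v \<in> e}"
      proof -
        have "f v \<in> f ` e \<longleftrightarrow> v \<in> e" if "e \<in> edges G" for e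
          using that uniform inj \<open>v \<in> verts G\<close> by (intro inj_on_image_mem_iff) auto
        then show ?thesis unfolding f(2) by auto
      qed
      moreover have "inj_on ((`) f) {e \<in> edges G. v \<in> e}"
        using uniform inj by (auto simp: inj_on_def inj_on_image_eq_iff)
      ultimately show ?thesis by (simp add: degree_def card_image)
    qed
    have T: "A_tensor \<alpha> k H (map f is) = A_tensor \<alpha> k G is" if "set is \<subseteq> verts G" "is \<noteq> []" for "is"
    proof -
      have "map f is = replicate k (hd (map f is)) \<longleftrightarrow> is = replicate k (hd is)"
      proof -
        have hd: "hd (map f is) = f (hd is)" "hd is \<in> verts G"
          using that by (auto simp: hd_map)
        have "map f is = map f (replicate k (hd is)) \<longleftrightarrow> is = replicate k (hd is)"
          using that hd by (intro inj_on_map_eq_map inj_on_subset [OF inj]) auto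
        then show ?thesis using hd by simp
      qed
      moreover have "hd is \<in> verts G" using that by auto
      ultimately show ?thesis
        using that edge [of "set is"] deg [of "hd is"]
        by (auto simp: A_tensor_def degree_tensor_def adj_tensor_def hd_map)
    qed
    have "obj_sum (verts H) k (A_tensor \<alpha> k H) s =
        obj_sum (verts G) k (\<lambda>is. A_tensor \<alpha> k H (map f is)) s"
      by (rule obj_sum_map [OF f(1)])
    also have "\<dots> = obj_sum (verts G) k (A_tensor \<alpha> k G) s"
      unfolding obj_sum_def
    proof (rule sum.cong [OF refl], clarify)
      fix W F assume o: "(W, F) \<in> objs (verts G) k s"
      have "A_tensor \<alpha> k H (map f (i # \<gamma>)) = A_tensor \<alpha> k G (i # \<gamma>)"
        if "i \<in> verts G" "\<gamma> \<in> set (F i)" for i \<gamma>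
        using o that by (intro T) (auto simp: objs_def PiE_iff tails_def)
      then show "obj_coeff (verts G) k F * obj_weight (verts G) (\<lambda>is. A_tensor \<alpha> k H (map f is)) F =
          obj_coeff (verts G) k F * obj_weight (verts G) (A_tensor \<alpha> k G) F"
        using obj_weight_cong [OF o, of "\<lambda>is. A_tensor \<alpha> k H (map f is)" "A_tensor \<alpha> k G"]
        by presburger
    qed
    finally have "obj_sum (verts H) k (A_tensor \<alpha> k H) s = obj_sum (verts G) k (A_tensor \<alpha> k G) s" .
    moreover have "finite (verts H)" using assms(2) by (simp flip: fV)
    ultimately show ?thesis
      using False card assms(2) by (simp add: S_trace_def tensor_trace_eq_obj_sum)
  qed
qed


section \<open>Walks and the edges they use\<close>

text \<open>Source and support of the bundles, without order and multiplicity. A nonzero entry of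
  the hypergraph tensors has a support that is a single vertex or an edge, and different pairs come
  from different bundles, so counting pairs bounds the size of an object from below.\<close>

definition ents :: "'a set \<Rightarrow> ('a \<Rightarrow> 'a list list) \<Rightarrow> ('a \<times> 'a set) set" where
  "ents V F = {(i, set (i # \<gamma>)) | i \<gamma>. i \<in> V \<and> \<gamma> \<in> set (F i)}"

lemma
  assumes "finite V" "(W, F) \<in> objs V k s"
  shows finite_ents: "finite (ents V F)" and card_ents: "card (ents V F) \<le> s"
proof -
  have *: "ents V F = (\<Union>i\<in>V. (\<lambda>\<gamma>. (i, set (i # \<gamma>))) ` set (F i))"
    by (auto simp: ents_def)
  show "finite (ents V F)" unfolding * using assms(1) by auto
  have "card (ents V F) \<le> (\<Sum>i\<in>V. card ((\<lambda>\<gamma>. (i, set (i # \<gamma>))) ` set (F i)))"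
    unfolding * by (rule card_UN_le [OF assms(1)])
  also have "\<dots> \<le> (\<Sum>i\<in>V. length (F i))"
    by (intro sum_mono order_trans [OF card_image_le] card_length) auto
  finally show "card (ents V F) \<le> s" using assms(2) by (simp add: objs_def)
qed

lemma obj_arc_iff:
  assumes "finite V" "(W, F) \<in> objs V k s"
  shows "(x, y) \<in># arcs W \<longleftrightarrow> x \<in> V \<and> (\<exists>\<gamma>\<in>set (F x). y \<in> set \<gamma>)"
proof -
  have "arcs W = (\<Sum>i\<in>V. row_arcs i (F i))" using assms(2) by (simp add: objs_def)
  then show ?thesis by (auto simp: set_mset_sum [OF assms(1)] row_arcs_def)
qed

lemma obj_walk:
  assumes "(W, F) \<in> objs V k s"
  shows "W \<noteq> []" "hd W = last W" "set W \<subseteq> V" "length W = Suc (s * (k - 1))"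
  using assms by (auto simp: objs_def closed_walks_def)

lemma obj_tail:
  assumes "(W, F) \<in> objs V k s" "i \<in> V" "\<gamma> \<in> set (F i)"
  shows "set \<gamma> \<subseteq> V" "length \<gamma> = k - 1"
  using assms by (auto simp: objs_def PiE_iff tails_def)

text \<open>As \<open>k \<ge> 2\<close>, a bundle has at least one arc, and the arcs of all bundles
  occur in the walk; so the walk passes through the source and the targets.\<close>

lemma ents_subset_walk:
  assumes "finite V" "(W, F) \<in> objs V k s" "k \<ge> 2" "(i, e) \<in> ents V F"
  shows "i \<in> e" "e \<subseteq> set W"
proof -
  obtain \<gamma> where \<gamma>: "i \<in> V" "\<gamma> \<in> set (F i)" "e = set (i # \<gamma>)"
    using assms(4) by (auto simp: ents_def)
  then show "i \<in> e" by simp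
  have arc: "(i, y) \<in># arcs W" if "y \<in> set \<gamma>" for y
    using obj_arc_iff [OF assms(1,2)] \<gamma> that by auto
  have "length \<gamma> \<noteq> 0" using obj_tail [OF assms(2)] \<gamma> assms(3) by simp
  then obtain y where "y \<in> set \<gamma>" by (cases \<gamma>) auto
  then show "e \<subseteq> set W" using arcs_subset [OF arc] \<gamma> by auto
qed

lemma arc_in_ents:
  assumes "finite V" "(W, F) \<in> objs V k s" "(x, y) \<in># arcs W"
  obtains e where "(x, e) \<in> ents V F" "y \<in> e"
proof -
  obtain \<gamma> where "x \<in> V" "\<gamma> \<in> set (F x)" "y \<in> set \<gamma>"
    using assms(3) obj_arc_iff [OF assms(1,2)] by blast
  then have "(x, set (x # \<gamma>)) \<in> ents V F" "y \<in> set (x # \<gamma>)" by (auto simp: ents_def)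
  then show ?thesis by (rule that)
qed

lemma arcs_Cons2: "arcs (x # y # W) = add_mset (x, y) (arcs (y # W))"
  by (simp add: arcs_def)

lemma arcs_mono_append: "(x, y) \<in># arcs B \<Longrightarrow> (x, y) \<in># arcs (A @ B)"
proof (induction A)
  case (Cons a A)
  then show ?case by (cases "A @ B") (auto simp: arcs_def)
qed simp

lemma walk_stays:
  assumes "\<And>x y. (x, y) \<in># arcs W \<Longrightarrow> x \<in> C \<Longrightarrow> y \<in> C" "W \<noteq> []" "hd W \<in> C"
  shows "set W \<subseteq> C"
  using assms
proof (induction W rule: induct_list012)
  case (3 x y W)
  then have "y \<in> C" by (auto simp: arcs_Cons2)
  then show ?case using 3 by (auto simp: arcs_Cons2)
qed auto

text \<open>From \<open>u\<close> on, a walk that never leaves \<open>C\<close> reaches its last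
  vertex inside \<open>C\<close>. This is also its first vertex, so the part before \<open>u\<close>
  would stay in \<open>C\<close> as well.\<close>

lemma closed_walk_crosses:
  assumes "hd W = last W" "u \<in> set W" "v \<in> set W" "u \<in> C" "v \<notin> C"
  obtains x y where "(x, y) \<in># arcs W" "x \<in> C" "y \<notin> C"
proof (rule ccontr)
  note cross = that
  assume "\<not> thesis"
  then have C: "y \<in> C" if "(x, y) \<in># arcs W" "x \<in> C" for x y using cross [OF that] by blast
  obtain A B where W: "W = A @ u # B" using assms(2) by (meson split_list)
  have "set (u # B) \<subseteq> C"
  proof (rule walk_stays)
    fix x y assume "(x, y) \<in># arcs (u # B)" "x \<in> C"
    then show "y \<in> C" using C W arcs_mono_append by metis
  qed (use assms(4) in auto)
  then have "hd W \<in> C" using assms(1) W by (metis append_Nil2 last_appendR last_in_set list.distinct(1) subsetD)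
  then have "set W \<subseteq> C" using C W by (intro walk_stays) auto
  then show False using assms(3,5) by auto
qed

text \<open>\<open>g\<close> plays the role of the projection of a tree onto the vertices of the
  edge \<open>e\<close>, constant along all other bundles. If the walk meets two fibres, it has to
  leave every fibre that it meets. An arc leaving a fibre belongs to a bundle with support
  \<open>e\<close>, whose source is the one vertex of \<open>e\<close> in that fibre. The first such
  bundle makes the walk visit all of \<open>e\<close>, hence all fibres over
  \<open>e\<close>.\<close>

lemma gate_all_used:
  assumes o: "finite V" "(W, F) \<in> objs V k s" "k \<ge> 2"
    and const: "\<And>x f y. (x, f) \<in> ents V F \<Longrightarrow> f \<noteq> e \<Longrightarrow> y \<in> f \<Longrightarrow> g y = g x"
    and id: "\<And>x. x \<in> e \<Longrightarrow> g x = x"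
    and uv: "u \<in> set W" "v \<in> set W" "g u \<noteq> g v"
    and i: "i \<in> e"
  shows "(i, e) \<in> ents V F"
proof -
  have step: "(g a, e) \<in> ents V F" if ab: "a \<in> set W" "b \<in> set W" "g a \<noteq> g b" for a b
  proof -
    obtain x y where xy: "(x, y) \<in># arcs W" "g x = g a" "g y \<noteq> g a"
      by (rule closed_walk_crosses [OF obj_walk(2) [OF o(2)] ab(1,2), of "{z. g z = g a}"])
        (use ab in auto)
    obtain f where f: "(x, f) \<in> ents V F" "y \<in> f" using arc_in_ents [OF o(1,2) xy(1)] .
    have "f = e" using const [OF f(1) _ f(2)] xy by auto
    then show ?thesis using f xy id ents_subset_walk(1) [OF o f(1)] by auto
  qed
  have "e \<subseteq> set W" using ents_subset_walk(2) [OF o step [OF uv]] .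
  then have "i \<in> set W" "g i = i" using i id by auto
  \<comment> \<open>\<open>g u\<close> and \<open>g v\<close> differ, so \<open>g i\<close> differs
    from one of them.\<close>
  then show ?thesis using step [of i u] step [of i v] uv by metis
qed

text \<open>Every visited vertex has an outgoing arc; for the final one this holds because the walk
  is closed and has at least one arc.\<close>

lemma walk_vertex_used:
  assumes "finite V" "(W, F) \<in> objs V k s" "k \<ge> 2" "s > 0" "x \<in> set W"
  shows "F x \<noteq> []"
proof -
  note W = obj_walk [OF assms(2)]
  obtain A B where AB: "W = A @ x # B" using assms(5) by (meson split_list)
  have "length W \<ge> 2" using W(4) assms(3,4) by (cases s; cases "k - 1") auto
  have "\<exists>y. (x, y) \<in># arcs W"
  proof (cases B)
    case (Cons y B')
    then have "(x, y) \<in># arcs (x # B)" by (simp add: arcs_Cons2)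
    then show ?thesis using AB arcs_mono_append by metis
  next
    case Nil
    then have "hd W = x" using W(2) AB by simp
    then obtain y B' where "W = x # y # B'"
      using \<open>length W \<ge> 2\<close> by (cases W; cases "tl W") auto
    then show ?thesis by (auto simp: arcs_Cons2)
  qed
  then show ?thesis using obj_arc_iff [OF assms(1,2)] by auto
qed

lemma A_tensor_support:
  assumes "A_tensor \<alpha> k H is \<noteq> 0" "is = i # \<gamma>" "k \<ge> 1"
  shows "set is = {i} \<or> set is \<in> edges H"
proof (cases "set is \<in> edges H")
  case False
  then have "is = replicate k i"
    using assms by (auto simp: A_tensor_def adj_tensor_def degree_tensor_def split: if_splits)
  then show ?thesis using assms(3) by (cases k) auto
qed simp

lemma obj_weight_nonzeroD:
  assumes "finite V" "obj_weight V T F \<noteq> 0" "i \<in> V" "\<gamma> \<in> set (F i)"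
  shows "T (i # \<gamma>) \<noteq> 0"
proof -
  have "row_weight T i (F i) \<noteq> 0" using assms by (auto simp: obj_weight_def)
  then show ?thesis using assms(4) by (force simp: row_weight_def prod_list_zero_iff)
qed

lemma ents_A_tensor:
  assumes "finite V" "obj_weight V (A_tensor \<alpha> k H) F \<noteq> 0" "k \<ge> 1" "(i, e) \<in> ents V F"
  shows "e = {i} \<or> e \<in> edges H"
  using assms A_tensor_support obj_weight_nonzeroD [OF assms(1,2)] by (fastforce simp: ents_def)

lemma A_tensor_loop:
  assumes "hypergraph_on k H" "k \<ge> 2"
  shows "A_tensor \<alpha> k H (replicate k v) = \<alpha> * degree H v"
proof -
  have "{v} \<notin> edges H" using assms by (auto simp: hypergraph_on_def)
  moreover have "hd (replicate k v) = v" "set (replicate k v) = {v}" using assms(2) by auto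
  ultimately show ?thesis by (simp add: A_tensor_def degree_tensor_def adj_tensor_def)
qed

section \<open>Objects whose walk stays at a single vertex\<close>

definition loop_rows :: "'a set \<Rightarrow> nat \<Rightarrow> nat \<Rightarrow> 'a \<Rightarrow> 'a \<Rightarrow> 'a list list" where
  "loop_rows V k s v = (\<lambda>i\<in>V. if i = v then replicate s (replicate (k - 1) v) else [])"

lemma concat_replicate_replicate: "concat (replicate a (replicate b x)) = replicate (a * b) x"
  by (induction a) (simp_all add: replicate_add)

lemma row_arcs_loop_rows:
  assumes "i \<in> V"
  shows "row_arcs i (loop_rows V k s v i) = (if i = v then replicate_mset (s * (k - 1)) (v, v) else {#})"
  using assms by (simp add: row_arcs_def loop_rows_def concat_replicate_replicate)

lemma arcs_replicate: "arcs (replicate (Suc n) v) = replicate_mset n (v, v)"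
  by (induction n) (auto simp: arcs_def)

lemma sum_row_arcs_loop_rows:
  assumes "finite V" "v \<in> V"
  shows "(\<Sum>i\<in>V. row_arcs i (loop_rows V k s v i)) = replicate_mset (s * (k - 1)) (v, v)"
  using assms by (simp add: row_arcs_loop_rows sum.delta cong: sum.cong)

lemma loop_obj:
  assumes "finite V" "v \<in> V"
  shows "(replicate (Suc (s * (k - 1))) v, loop_rows V k s v) \<in> objs V k s"
proof -
  have "(\<Sum>i\<in>V. length (loop_rows V k s v i)) = (\<Sum>i\<in>V. if i = v then s else 0)"
    by (intro sum.cong) (auto simp: loop_rows_def)
  then have "(\<Sum>i\<in>V. length (loop_rows V k s v i)) = s" using assms by simp
  moreover have "loop_rows V k s v \<in> PiE V (\<lambda>_. {\<Gamma>. set \<Gamma> \<subseteq> tails V k})"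
    using assms by (auto simp: loop_rows_def tails_def)
  moreover have "replicate (Suc (s * (k - 1))) v \<in> closed_walks V (s * (k - 1))"
    using assms by (auto simp: closed_walks_def last_replicate simp del: replicate_Suc)
  ultimately show ?thesis
    unfolding objs_def by (simp add: sum_row_arcs_loop_rows [OF assms] arcs_replicate del: replicate_Suc)
qed

lemma loop_objD:
  assumes "finite V" "k \<ge> 2" "(W, F) \<in> objs V k s" "set W = {v}"
  shows "W = replicate (Suc (s * (k - 1))) v" "F = loop_rows V k s v" "v \<in> V"
proof -
  note W = obj_walk [OF assms(3)]
  show "W = replicate (Suc (s * (k - 1))) v"
    using W(4) assms(4) by (intro replicate_eqI) auto
  show "v \<in> V" using W(3) assms(4) by auto
  have tail: "i = v \<and> \<gamma> = replicate (k - 1) v" if "i \<in> V" "\<gamma> \<in> set (F i)" for i \<gamma>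
  proof -
    have "(i, set (i # \<gamma>)) \<in> ents V F" using that by (auto simp: ents_def)
    then have "set (i # \<gamma>) \<subseteq> {v}" using ents_subset_walk [OF assms(1,3,2)] assms(4) by metis
    then show ?thesis using obj_tail [OF assms(3) that] by (auto intro!: replicate_eqI)
  qed
  then have Fi: "F i = []" if "i \<in> V" "i \<noteq> v" for i 
    using that tail hd_in_set by metis
  have "(\<Sum>i\<in>V. length (F i)) = (\<Sum>i\<in>V. if i = v then length (F v) else 0)"
    by (intro sum.cong) (auto simp: Fi)
  then have "length (F v) = s" using assms(1,3) \<open>v \<in> V\<close> by (simp add: objs_def)
  then have "F v = replicate s (replicate (k - 1) v)"
    by (rule replicate_eqI) (use tail [OF \<open>v \<in> V\<close>] in blast)
  moreover have "F i = undefined" if "i \<notin> V" for i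
    using that assms(3) by (auto simp: objs_def PiE_iff extensional_def)
  ultimately show "F = loop_rows V k s v" using Fi by (auto simp: loop_rows_def fun_eq_iff)
qed

text \<open>A loop object has coefficient 1: the factorial of the multiplicity
  \<open>s * (k - 1)\<close> of its arc cancels against the denominator. For the hypergraph tensors
  this gives the power sums of the degrees, scaled by \<alpha>.\<close>

lemma sum_loop_objs:
  assumes "finite V" "k \<ge> 2"
  shows "(\<Sum>(W, F)\<in>{(W, F) \<in> objs V k s. \<exists>v. set W = {v}}. obj_coeff V k F * obj_weight V T F) =
    (\<Sum>v\<in>V. T (replicate k v) ^ s)"
proof (rule sum.reindex_bij_witness [where
      i = "\<lambda>v. (replicate (Suc (s * (k - 1))) v, loop_rows V k s v)" and j = "\<lambda>(W, F). hd W"], goal_cases)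
  case (1 a)
  then obtain W F v where a: "a = (W, F)" "(W, F) \<in> objs V k s" "set W = {v}" by auto
  from loop_objD [OF assms a(2,3)] show ?case by (simp add: a)
next
  case (2 a)
  then obtain W F v where a: "a = (W, F)" "(W, F) \<in> objs V k s" "set W = {v}" by auto
  from loop_objD [OF assms a(2,3)] show ?case by (simp add: a)
next
  case (4 v)
  then show ?case using loop_obj [OF assms(1) 4] by (auto simp del: replicate_Suc simp: set_replicate_Suc)
next
  case (5 a)
  then obtain W F v where a: "a = (W, F)" "(W, F) \<in> objs V k s" "set W = {v}" by auto
  note D = loop_objD [OF assms a(2,3)]
  have "(\<Prod>i\<in>V. fact (length (F i) * (k - 1)) :: real) = (\<Prod>i\<in>V. if i = v then fact (s * (k - 1)) else 1)"
    by (intro prod.cong) (auto simp: D loop_rows_def)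
  also have "\<dots> = fact (s * (k - 1))" using assms(1) D(3) by simp
  finally have "obj_coeff V k F = 1"
    unfolding obj_coeff_def D(2) sum_row_arcs_loop_rows [OF assms(1) D(3)]
    by (auto simp: fact_prod_def set_mset_replicate_mset_subset)
  moreover have "obj_weight V T F = (\<Prod>i\<in>V. if i = v then T (replicate k v) ^ s else 1)"
    unfolding obj_weight_def
  proof (intro prod.cong refl)
    fix i assume "i \<in> V"
    moreover have "v # replicate (k - 1) v = replicate k v" using assms(2) by (cases k) auto
    ultimately show "row_weight T i (F i) = (if i = v then T (replicate k v) ^ s else 1)"
      by (simp add: D loop_rows_def row_weight_def prod_list_replicate)
  qed
  ultimately show ?case using assms(1) D(3) by (simp add: a(1) D(1))
qed simp


section \<open>The first two traces\<close>

lemma obj_sum_split: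
  assumes "finite V" "k \<ge> 2"
  shows "obj_sum V k T s = (\<Sum>v\<in>V. T (replicate k v) ^ s) +
    (\<Sum>(W, F)\<in>{(W, F) \<in> objs V k s. \<nexists>v. set W = {v}}. obj_coeff V k F * obj_weight V T F)"
proof -
  let ?A = "{(W, F) \<in> objs V k s. \<exists>v. set W = {v}}" and ?B = "{(W, F) \<in> objs V k s. \<nexists>v. set W = {v}}"
  let ?w = "\<lambda>(W, F). obj_coeff V k F * obj_weight V T F"
  have "objs V k s = ?A \<union> ?B" by auto
  then have "sum ?w (objs V k s) = sum ?w (?A \<union> ?B)" by (rule arg_cong)
  also have "\<dots> = sum ?w ?A + sum ?w ?B"
    by (rule sum.union_disjoint) (auto intro!: finite_subset [OF _ finite_objs [OF assms(1)]])
  finally show ?thesis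
    unfolding obj_sum_def sum_loop_objs [OF assms] .
qed

text \<open>The walk has to leave \<open>x\<close>; the bundle used for this is not a loop, so a
  nonzero weight forces its support to be an edge.\<close>

lemma nonloop_obj:
  assumes "finite V" "k \<ge> 2" "(W, F) \<in> objs V k s" "s > 0" "\<nexists>v. set W = {v}"
    and "obj_weight V (A_tensor \<alpha> k H) F \<noteq> 0" "x \<in> set W"
  obtains \<gamma> where "\<gamma> \<in> set (F x)" "set (x # \<gamma>) \<in> edges H" "set (x # \<gamma>) \<subseteq> set W"
proof -
  note W = obj_walk [OF assms(3)]
  obtain y where y: "y \<in> set W" "y \<noteq> x" using assms(5,7) by blast
  obtain x' z where arc: "(x', z) \<in># arcs W" "x' \<in> {x}" "z \<notin> {x}"
    by (rule closed_walk_crosses [OF W(2) assms(7) y(1), of "{x}"]) (use y in auto)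
  then obtain \<gamma> where \<gamma>: "x \<in> V" "\<gamma> \<in> set (F x)" "z \<in> set \<gamma>"
    using obj_arc_iff [OF assms(1,3)] by auto
  then have e: "(x, set (x # \<gamma>)) \<in> ents V F" by (auto simp: ents_def)
  have "set (x # \<gamma>) \<noteq> {x}" using \<gamma>(3) arc(3) by auto
  then have "set (x # \<gamma>) \<in> edges H"
    using ents_A_tensor [OF assms(1,6) _ e] assms(2) by auto
  then show ?thesis using that \<gamma>(2) ents_subset_walk(2) [OF assms(1,3,2) e] by blast
qed

text \<open>The walk contains an edge, and every visited vertex is the source of a bundle. Hence
  with fewer than \<open>k\<close> bundles only loops contribute, which determines the first trace,
  and for \<open>k > 2\<close> also the second.\<close>

lemma nonloop_obj_size:
  assumes "finite V" "k \<ge> 2" "(W, F) \<in> objs V k s" "s > 0" "\<nexists>v. set W = {v}"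
    and "obj_weight V (A_tensor \<alpha> k H) F \<noteq> 0" "hypergraph_on k H"
  shows "k \<le> card (set W)" "card (set W) \<le> s"
proof -
  note W = obj_walk [OF assms(3)]
  have "hd W \<in> set W" using W by auto
  from nonloop_obj [OF assms(1-6) this] obtain \<gamma>
    where "set (hd W # \<gamma>) \<in> edges H" "set (hd W # \<gamma>) \<subseteq> set W" by blast
  then show "k \<le> card (set W)"
    using assms(7) card_mono [of "set W" "set (hd W # \<gamma>)"] by (auto simp: hypergraph_on_def)
  have "length (F x) \<ge> 1" if "x \<in> set W" for x
    using walk_vertex_used [OF assms(1,3,2,4) that] by (cases "F x") auto
  then have "card (set W) \<le> (\<Sum>x\<in>set W. length (F x))"
    using sum_mono [of "set W" "\<lambda>_. 1" "\<lambda>x. length (F x)"] by simp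
  also have "\<dots> \<le> (\<Sum>x\<in>V. length (F x))"
    using W(3) assms(1) by (intro sum_mono2) auto
  finally show "card (set W) \<le> s" using assms(3) by (simp add: objs_def)
qed

lemma S_trace_1:
  assumes "hypergraph_on k H" "k \<ge> 2"
  shows "S_trace \<alpha> k H 1 = real (k - 1) ^ (card (verts H) - 1) * (\<Sum>v\<in>verts H. \<alpha> * degree H v)"
proof -
  let ?V = "verts H"
  have fin: "finite ?V" using assms(1) by (simp add: hypergraph_on_def)
  have "obj_weight ?V (A_tensor \<alpha> k H) F = 0"
    if "(W, F) \<in> objs ?V k 1" "\<nexists>v. set W = {v}" for W F
    using nonloop_obj_size [OF fin assms(2) that(1) _ that(2) _ assms(1), of \<alpha>] assms(2) by fastforce
  then have "(\<Sum>(W, F)\<in>{(W, F) \<in> objs ?V k 1. \<nexists>v. set W = {v}}.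
      obj_coeff ?V k F * obj_weight ?V (A_tensor \<alpha> k H) F) = 0"
    by (intro sum.neutral) auto
  then show ?thesis
    unfolding S_trace_def
    by (subst tensor_trace_eq_obj_sum) (simp_all add: fin obj_sum_split assms A_tensor_loop)
qed

text \<open>For \<open>k = 2\<close> two bundles suffice for a nonconstant walk: an edge traversed
  back and forth. This is its bundling.\<close>

definition pair_rows :: "'a set \<Rightarrow> 'a \<Rightarrow> 'a \<Rightarrow> 'a \<Rightarrow> 'a list list" where
  "pair_rows V x y = (\<lambda>i\<in>V. if i = x then [[y]] else if i = y then [[x]] else [])"

lemma pair_objD:
  assumes "hypergraph_on 2 H" "(W, F) \<in> objs (verts H) 2 2" "\<nexists>v. set W = {v}"
    and "obj_weight (verts H) (A_tensor \<alpha> 2 H) F \<noteq> 0"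
  obtains x y where "x \<noteq> y" "{x, y} \<in> edges H" "W = [x, y, x]" "F = pair_rows (verts H) x y"
proof -
  let ?V = "verts H"
  have fin: "finite ?V" using assms(1) by (simp add: hypergraph_on_def)
  note W = obj_walk [OF assms(2)]
  obtain x y where Wxy: "W = [x, y, x]"
    using W(2,4) by (auto simp: length_Suc_conv numeral_eq_Suc)
  then have xy: "x \<noteq> y" using assms(3) by auto
  have V: "x \<in> ?V" "y \<in> ?V" using W(3) Wxy by auto
  have len: "length (F x) \<ge> 1" "length (F y) \<ge> 1"
    using walk_vertex_used [OF fin assms(2)] Wxy by (cases "F x"; cases "F y"; auto)+
  have "(\<Sum>i\<in>?V. length (F i)) = length (F x) + length (F y) + (\<Sum>i\<in>?V - {x} - {y}. length (F i))"
    using fin V xy by (simp add: sum.remove [of _ x] sum.remove [of "?V - {x}" y])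
  moreover have "(\<Sum>i\<in>?V. length (F i)) = 2" using assms(2) by (simp add: objs_def)
  ultimately have len': "length (F x) = 1" "length (F y) = 1" "(\<Sum>i\<in>?V - {x} - {y}. length (F i)) = 0"
    using len by auto
  have 1: "F a = [[b]] \<and> {a, b} \<in> edges H"
    if ab: "length (F a) = 1" "a \<in> set W" "set W = {a, b}" "a \<noteq> b" for a b
  proof -
    obtain \<gamma> where \<gamma>: "\<gamma> \<in> set (F a)" "set (a # \<gamma>) \<in> edges H" "set (a # \<gamma>) \<subseteq> set W"
      using nonloop_obj [OF fin _ assms(2) _ assms(3,4) ab(2)] by auto
    have "a \<in> ?V" using ab(2) W(3) by auto
    then have "length \<gamma> = 1" using obj_tail(2) [OF assms(2) _ \<gamma>(1)] by simp
    then obtain z where z: "\<gamma> = [z]" by (auto simp: length_Suc_conv)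
    have "{a, z} \<in> edges H" "card {a, z} = 2" using \<gamma>(2) z assms(1) by (auto simp: hypergraph_on_def)
    moreover from this have "z = b" using \<gamma>(3) z ab(3) by auto
    ultimately show ?thesis using \<gamma>(1) z ab(1) by (auto simp: length_Suc_conv)
  qed
  have Fx: "F x = [[y]]" and E: "{x, y} \<in> edges H" and Fy: "F y = [[x]]"
    using 1 [of x y] 1 [of y x] len' Wxy xy by auto
  have "F i = undefined" if "i \<notin> ?V" for i
    using that assms(2) by (auto simp: objs_def PiE_iff extensional_def)
  moreover have "F i = []" if "i \<in> ?V" "i \<noteq> x" "i \<noteq> y" for i
    using that len'(3) fin by simp
  ultimately have "F = pair_rows ?V x y"
    using Fx Fy by (auto simp: pair_rows_def fun_eq_iff)
  then show ?thesis using that xy E Wxy by blast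
qed

lemma pair_obj:
  assumes "finite V" "x \<noteq> y" "x \<in> V" "y \<in> V"
  shows "([x, y, x], pair_rows V x y) \<in> objs V 2 2"
    and "obj_coeff V 2 (pair_rows V x y) = 1"
    and "obj_weight V T (pair_rows V x y) = T [x, y] * T [y, x]"
proof -
  let ?F = "pair_rows V x y"
  have F: "?F x = [[y]]" "?F y = [[x]]" and F0: "?F i = []" if "i \<in> V - {x} - {y}" for i
    using assms that by (auto simp: pair_rows_def)
  have [simp]: "?F x = [[y]]" "?F y = [[x]]" using assms by (auto simp: pair_rows_def)
  have sum: "(\<Sum>i\<in>V. f i) = f x + f y + (\<Sum>i\<in>V - {x} - {y}. f i)" for f :: "_ \<Rightarrow> 'b::comm_monoid_add"
    using assms by (simp add: sum.remove [of _ x] sum.remove [of "V - {x}" y] add.assoc)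
  have prod: "(\<Prod>i\<in>V. f i) = f x * f y * (\<Prod>i\<in>V - {x} - {y}. f i)" for f :: "_ \<Rightarrow> real"
    using assms by (simp add: prod.remove [of _ x] prod.remove [of "V - {x}" y])
  have arcs: "(\<Sum>i\<in>V. row_arcs i (?F i)) = {#(x, y), (y, x)#}"
    by (simp add: sum F0 row_arcs_def)
  show "([x, y, x], ?F) \<in> objs V 2 2"
    unfolding objs_def using assms
    by (auto simp: arcs) (auto simp: closed_walks_def sum F0 arcs_def pair_rows_def tails_def split: if_splits)
  show "obj_coeff V 2 ?F = 1"
    unfolding obj_coeff_def arcs using assms(2) by (simp add: prod F0 fact_prod_def)
  show "obj_weight V T ?F = T [x, y] * T [y, x]"
    unfolding obj_weight_def by (simp add: prod F0 row_weight_def)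
qed

lemma card_ordered_edges:
  assumes "finite E" "\<forall>e\<in>E. card e = 2"
  shows "card {(x, y). x \<noteq> y \<and> {x, y} \<in> E} = 2 * card E"
proof -
  have 2: "card {(x, y). x \<noteq> y \<and> {x, y} = e} = 2 \<and> finite {(x, y). x \<noteq> y \<and> {x, y} = e}" if "e \<in> E" for e
  proof -
    have "card e = 2" using assms(2) that by blast
    then obtain a b where ab: "e = {a, b}" "a \<noteq> b" by (auto simp: card_2_iff)
    have "{(x, y). x \<noteq> y \<and> {x, y} = e} = {(a, b), (b, a)}"
      unfolding ab(1) doubleton_eq_iff using ab(2) by blast
    then show ?thesis using ab(2) by simp
  qed
  have "{(x, y). x \<noteq> y \<and> {x, y} \<in> E} = (\<Union>e\<in>E. {(x, y). x \<noteq> y \<and> {x, y} = e})" by auto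
  also have "card \<dots> = (\<Sum>e\<in>E. card {(x, y). x \<noteq> y \<and> {x, y} = e})"
    using 2 assms(1) by (intro card_UN_disjoint) auto
  finally show ?thesis using 2 by simp
qed

lemma finite_edges: "hypergraph_on k H \<Longrightarrow> finite (edges H)"
  by (rule finite_subset [of _ "Pow (verts H)"]) (auto simp: hypergraph_on_def)

text \<open>The contribution of the edges depends on \<open>k\<close>, \<alpha> and the number of
  edges alone, so within the class and for \<alpha> > 0 the second trace orders by the sum of
  squared degrees.\<close>

lemma S_trace_2:
  assumes "hypergraph_on k H" "k \<ge> 2"
  shows "S_trace \<alpha> k H 2 = real (k - 1) ^ (card (verts H) - 1) *
    ((\<Sum>v\<in>verts H. (\<alpha> * degree H v)\<^sup>2) + (if k = 2 then 2 * (1 - \<alpha>)\<^sup>2 * card (edges H) else 0))"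
proof -
  let ?V = "verts H" and ?T = "A_tensor \<alpha> k H"
  let ?B = "{(W, F) \<in> objs ?V k 2. \<nexists>v. set W = {v}}"
  have fin: "finite ?V" using assms(1) by (simp add: hypergraph_on_def)
  have "(\<Sum>(W, F)\<in>?B. obj_coeff ?V k F * obj_weight ?V ?T F) =
    (if k = 2 then 2 * (1 - \<alpha>)\<^sup>2 * card (edges H) else 0)"
  proof (cases "k = 2")
    case False
    have "obj_weight ?V ?T F = 0" if "(W, F) \<in> objs ?V k 2" "\<nexists>v. set W = {v}" for W F
      using nonloop_obj_size [OF fin assms(2) that(1) _ that(2) _ assms(1), of \<alpha>] assms(2) False
      by fastforce
    then show ?thesis using False by (auto intro!: sum.neutral)
  next
    case True
    let ?f = "\<lambda>(x, y). ([x, y, x], pair_rows ?V x y)"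
    let ?P = "{(x, y). x \<noteq> y \<and> {x, y} \<in> edges H}"
    have V: "x \<in> ?V" "y \<in> ?V" if "{x, y} \<in> edges H" for x y
      using assms(1) that by (auto simp: hypergraph_on_def)
    have "(\<Sum>(W, F)\<in>?B. obj_coeff ?V k F * obj_weight ?V ?T F) =
        (\<Sum>(W, F)\<in>?f ` ?P. obj_coeff ?V k F * obj_weight ?V ?T F)"
    proof (rule sum.mono_neutral_right)
      show "finite ?B" by (rule finite_subset [OF _ finite_objs [OF fin, of k 2]]) auto
      show "?f ` ?P \<subseteq> ?B" using pair_obj(1) [OF fin] V True by auto
      show "\<forall>o'\<in>?B - ?f ` ?P. (case o' of (W, F) \<Rightarrow> obj_coeff ?V k F * obj_weight ?V ?T F) = 0"
      proof clarify
        fix W F assume o: "(W, F) \<in> objs ?V k 2" "\<nexists>v. set W = {v}" "(W, F) \<notin> ?f ` ?P"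
        have "obj_weight ?V ?T F = 0"
        proof (rule ccontr)
          assume "obj_weight ?V ?T F \<noteq> 0"
          then obtain x y where "x \<noteq> y" "{x, y} \<in> edges H" "W = [x, y, x]" "F = pair_rows ?V x y"
            using pair_objD [of H W F \<alpha>] o(1,2) assms(1) True by metis
          then show False using o(3) by auto
        qed
        then show "obj_coeff ?V k F * obj_weight ?V ?T F = 0" by simp
      qed
    qed
    also have "\<dots> = (\<Sum>p\<in>?P. (1 - \<alpha>)\<^sup>2)"
    proof (subst sum.reindex)
      show "inj_on ?f ?P" by (auto simp: inj_on_def)
      show "sum ((\<lambda>(W, F). obj_coeff ?V k F * obj_weight ?V ?T F) \<circ> ?f) ?P = (\<Sum>p\<in>?P. (1 - \<alpha>)\<^sup>2)"
      proof (rule sum.cong [OF refl])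
        fix p assume p: "p \<in> ?P"
        obtain x y where xy: "p = (x, y)" by (cases p)
        have E: "x \<noteq> y" "{x, y} \<in> edges H" using p xy by auto
        have "?T [x, y] = 1 - \<alpha>" "?T [y, x] = 1 - \<alpha>"
          using E by (auto simp: A_tensor_def adj_tensor_def degree_tensor_def True numeral_2_eq_2 insert_commute)
        then show "((\<lambda>(W, F). obj_coeff ?V k F * obj_weight ?V ?T F) \<circ> ?f) p = (1 - \<alpha>)\<^sup>2"
          using pair_obj(2,3) [OF fin E(1) V [OF E(2)]] xy True by (simp add: power2_eq_square)
      qed
    qed
    also have "\<dots> = 2 * (1 - \<alpha>)\<^sup>2 * card (edges H)"
      using card_ordered_edges [OF finite_edges [OF assms(1)]] assms(1) True
      by (simp add: hypergraph_on_def)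
    finally show ?thesis using True by simp
  qed
  then show ?thesis
    unfolding S_trace_def
    by (subst tensor_trace_eq_obj_sum) (simp_all add: fin obj_sum_split assms A_tensor_loop)
qed


section \<open>Hypertrees and their degrees\<close>

lemma path_ends:
  assumes "is_path H vs es"
  shows "vs \<noteq> []" "hd vs = vs ! 0" "last vs = vs ! length es"
proof -
  show "vs \<noteq> []" using assms by (auto simp: is_path_def)
  then show "hd vs = vs ! 0" "last vs = vs ! length es"
    using assms by (simp_all add: hd_conv_nth last_conv_nth is_path_def)
qed

lemma is_path_append:
  assumes "is_path H vs es" "last vs \<in> e" "w \<in> e" "e \<in> edges H" "w \<in> verts H"
    "e \<notin> set es" "w \<notin> set vs"
  shows "is_path H (vs @ [w]) (es @ [e])"
proof -
  have "vs \<noteq> []" "length vs = Suc (length es)" using assms(1) by (auto simp: is_path_def)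
  then have "last vs = vs ! length es" by (simp add: last_conv_nth)
  then show ?thesis using assms by (auto simp: is_path_def nth_append less_Suc_eq)
qed

lemma is_path_take:
  assumes "is_path H vs es" "i \<le> length es"
  shows "is_path H (take (Suc i) vs) (take i es)" "last (take (Suc i) vs) = vs ! i"
proof -
  show "is_path H (take (Suc i) vs) (take i es)"
    using assms by (auto simp: is_path_def dest: in_set_takeD)
  show "last (take (Suc i) vs) = vs ! i"
    using assms by (simp add: is_path_def take_Suc_conv_app_nth)
qed

text \<open>Walks without the distinctness required by \<open>is_path\<close>, which compose and
  reverse freely. They are turned into paths of at most the same length by
  \<open>reach_imp_joins\<close>.\<close>

inductive reach :: "'a hypergraph \<Rightarrow> nat \<Rightarrow> 'a \<Rightarrow> 'a \<Rightarrow> bool" for H where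
  reach_refl: "u \<in> verts H \<Longrightarrow> reach H 0 u u"
| reach_step: "reach H q u v \<Longrightarrow> e \<in> edges H \<Longrightarrow> v \<in> e \<Longrightarrow> w \<in> e \<Longrightarrow> w \<in> verts H \<Longrightarrow> reach H (Suc q) u w"

lemma reach_verts: "reach H q u v \<Longrightarrow> u \<in> verts H \<and> v \<in> verts H"
  by (induction rule: reach.induct) auto

lemma reach_edge: "e \<in> edges H \<Longrightarrow> u \<in> e \<Longrightarrow> v \<in> e \<Longrightarrow> u \<in> verts H \<Longrightarrow> v \<in> verts H \<Longrightarrow> reach H 1 u v"
  using reach_step [OF reach_refl] by simp

lemma reach_trans: "reach H r v w \<Longrightarrow> reach H q u v \<Longrightarrow> reach H (q + r) u w"
  by (induction rule: reach.induct) (auto intro: reach_step)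

lemma reach_sym: "reach H q u v \<Longrightarrow> reach H q v u"
proof (induction rule: reach.induct)
  case (reach_step q u v e w)
  have "reach H 1 w v"
    using reach_step.hyps reach_verts [OF reach_step.hyps(1)] by (intro reach_edge) auto
  from reach_trans [OF reach_step.IH this] show ?case by simp
qed (auto intro: reach.intros)

text \<open>A step to a vertex or through an edge that already occurs is handled by cutting the path
  back to that occurrence, so the bound on the length survives.\<close>

lemma reach_imp_joins: "reach H q u v \<Longrightarrow> \<exists>r\<le>q. joins H u v r"
proof (induction rule: reach.induct)
  case (reach_refl u)
  then have "is_path H [u] []" by (simp add: is_path_def)
  then show ?case unfolding joins_def by (intro exI [of _ 0]) force
next
  case (reach_step q u v e w)
  then obtain vs es where p: "is_path H vs es" "hd vs = u" "last vs = v" "length es \<le> q"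
    by (auto simp: joins_def)
  have ne: "vs \<noteq> []" and len: "length vs = Suc (length es)" using p(1) by (auto simp: is_path_def)
  have hd: "hd (take (Suc i) vs) = u" for i using ne p(2) by (cases vs) auto
  show ?case
  proof (cases "w \<in> set vs")
    case True
    then obtain i where i: "i \<le> length es" "w = vs ! i" using len by (auto simp: in_set_conv_nth less_Suc_eq_le)
    then show ?thesis
      using is_path_take [OF p(1) i(1)] hd p(4) unfolding joins_def
      by (intro exI [of _ i]) (auto intro!: exI [of _ "take (Suc i) vs"] exI [of _ "take i es"])
  next
    case False
    show ?thesis
    proof (cases "e \<in> set es")
      case True
      \<comment> \<open>\<open>vs ! i\<close> lies in \<open>e\<close>, so the path can turn off
        there and go to \<open>w\<close> directly.\<close>
      then obtain i where i: "i < length es" "e = es ! i" by (auto simp: in_set_conv_nth)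
      have "is_path H (take (Suc i) vs @ [w]) (take i es @ [e])"
      proof (rule is_path_append)
        show "is_path H (take (Suc i) vs) (take i es)" "last (take (Suc i) vs) \<in> e"
          using is_path_take [OF p(1), of i] i p(1) by (auto simp: is_path_def)
        show "e \<notin> set (take i es)"
          using i p(1) by (auto simp: is_path_def in_set_conv_nth nth_eq_iff_index_eq)
      qed (use reach_step.hyps False in \<open>auto dest: in_set_takeD\<close>)
      moreover have "hd (take (Suc i) vs @ [w]) = u" using hd [of i] ne by (simp add: hd_append)
      ultimately show ?thesis using i p(4) unfolding joins_def
        by (intro exI [of _ "Suc i"]) (auto intro!: exI [of _ "take (Suc i) vs @ [w]"] exI [of _ "take i es @ [e]"])
    next
      case e: False
      have "is_path H (vs @ [w]) (es @ [e])"
        using reach_step.hyps False e p by (intro is_path_append) auto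
      moreover have "hd (vs @ [w]) = u" using ne p(2) by (simp add: hd_append)
      ultimately show ?thesis using p(4) unfolding joins_def
        by (intro exI [of _ "Suc (length es)"]) (auto intro!: exI [of _ "vs @ [w]"] exI [of _ "es @ [e]"])
    qed
  qed
qed

lemma reach_mono:
  assumes "reach G q u v" "verts G \<subseteq> verts H" "edges G \<subseteq> edges H"
  shows "reach H q u v"
  using assms(1) by induction (use assms(2,3) in \<open>auto intro: reach.intros\<close>)

text \<open>A path inside \<open>S\<close> from \<open>x\<close> to \<open>y\<close>, closed by
  \<open>e\<close>, would be a Berge cycle; its length is at least two because a path between
  different vertices has an edge.\<close>

lemma hypertree_edge_Int_connected:
  assumes "hypertree k H" "S \<subseteq> edges H" "e \<in> edges H" "e \<notin> S"
    and "reach \<lparr>verts = \<Union>S, edges = S\<rparr> q x y" "x \<in> e" "y \<in> e"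
  shows "x = y"
proof (rule ccontr)
  assume "x \<noteq> y"
  obtain vs es where p: "is_path \<lparr>verts = \<Union>S, edges = S\<rparr> vs es" "hd vs = x" "last vs = y"
    using reach_imp_joins [OF assms(5)] by (auto simp: joins_def)
  have ne: "vs \<noteq> []" using p(1) by (auto simp: is_path_def)
  have ends: "vs ! 0 = x" "vs ! length es = y"
    using p ne by (auto simp: hd_conv_nth last_conv_nth is_path_def)
  have "es \<noteq> []" using ends \<open>x \<noteq> y\<close> by auto
  have "\<Union>S \<subseteq> verts H" using assms(1,2) by (auto simp: hypertree_def hypergraph_on_def)
  moreover have "vs ! i \<in> (es @ [e]) ! i \<and> vs ! (Suc i mod length (es @ [e])) \<in> (es @ [e]) ! i"
    if "i < length (es @ [e])" for i
  proof (cases "i = length es")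
    case True
    then show ?thesis using ends assms(6,7) by simp
  next
    case False
    then have "i < length es" using that by simp
    then show ?thesis using p(1) by (simp add: is_path_def nth_append)
  qed
  ultimately have "is_cycle H vs (es @ [e])"
    unfolding is_cycle_def using p(1) assms(2-4) \<open>es \<noteq> []\<close>
    by (auto simp: is_path_def Suc_le_eq)
  then show False using assms(1) by (auto simp: hypertree_def)
qed

lemma hypertree_path:
  assumes "hypertree k H" "u \<in> verts H" "v \<in> verts H"
  obtains vs es where "is_path H vs es" "hd vs = u" "last vs = v"
  using assms unfolding hypertree_def connected_hypergraph_def joins_def by blast

text \<open>Edges are added one at a time so that the chosen family stays connected. By acyclicity a
  new edge meets the old vertices in exactly one vertex and brings \<open>k - 1\<close> new ones;
  with all edges chosen this gives the number of vertices.\<close>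

lemma hypertree_grow:
  assumes H: "hypertree k H" "k \<ge> 2" and n: "1 \<le> n" "n \<le> card (edges H)"
  shows "\<exists>S\<subseteq>edges H. card S = n \<and> card (\<Union>S) = n * (k - 1) + 1 \<and>
    (\<forall>u\<in>\<Union>S. \<forall>v\<in>\<Union>S. \<exists>q. reach \<lparr>verts = \<Union>S, edges = S\<rparr> q u v)"
  using n
proof (induction n rule: nat_induct_at_least)
  case base
  then obtain e where e: "e \<in> edges H" by (metis card.empty ex_in_conv not_one_le_zero)
  then have "card e = k" using H(1) by (auto simp: hypertree_def hypergraph_on_def)
  moreover have "reach \<lparr>verts = \<Union>{e}, edges = {e}\<rparr> 1 u v" if "u \<in> e" "v \<in> e" for u v
    using that by (intro reach_edge) auto
  ultimately show ?case using e H(2) by (intro exI [of _ "{e}"]) auto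
next
  case (Suc n)
  from Suc.IH [OF Suc_leD [OF Suc.prems]]
  obtain S where S: "S \<subseteq> edges H" "card S = n" "card (\<Union>S) = n * (k - 1) + 1"
    and conn: "\<forall>u\<in>\<Union>S. \<forall>v\<in>\<Union>S. \<exists>q. reach \<lparr>verts = \<Union>S, edges = S\<rparr> q u v"
    by metis
  have hyp: "hypergraph_on k H" using H(1) by (simp add: hypertree_def)
  have SV: "\<Union>S \<subseteq> verts H" "finite (\<Union>S)" and finE: "finite (edges H)"
  proof -
    show "finite (edges H)" by (rule finite_edges [OF hyp])
    show "\<Union>S \<subseteq> verts H" using S(1) hyp by (auto simp: hypergraph_on_def)
    then show "finite (\<Union>S)" using hyp by (simp add: hypergraph_on_def finite_subset)
  qed
  have "\<Union>S \<noteq> {}" using S(3) by (metis card.empty add_is_0 one_neq_zero)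
  then obtain u where u: "u \<in> \<Union>S" by (meson ex_in_conv)
  \<comment> \<open>Otherwise a path from \<open>u\<close> to a vertex of an unchosen edge would
    never leave the chosen vertices.\<close>
  have "\<exists>e\<in>edges H - S. e \<inter> \<Union>S \<noteq> {}"
  proof (rule ccontr)
    assume none: "\<not> ?thesis"
    have "S \<noteq> edges H" using S(2) Suc.prems by auto
    then obtain e0 where e0: "e0 \<in> edges H" "e0 \<notin> S" using S(1) by blast
    then have "card e0 = k" "e0 \<subseteq> verts H" using hyp by (auto simp: hypergraph_on_def)
    then obtain v where v: "v \<in> e0" using H(2) by fastforce
    then have "v \<in> verts H" "u \<in> verts H" using u SV \<open>e0 \<subseteq> verts H\<close> by auto
    then obtain vs es where p: "is_path H vs es" "hd vs = u" "last vs = v"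
      using hypertree_path [OF H(1)] by metis
    have "vs ! i \<in> \<Union>S" if "i \<le> length es" for i
      using that
    proof (induction i)
      case 0
      then show ?case using u p(2) path_ends(2) [OF p(1)] by simp
    next
      case (Suc i)
      then have "vs ! i \<in> \<Union>S" "vs ! i \<in> es ! i" "es ! i \<in> edges H" "vs ! Suc i \<in> es ! i"
        using p(1) by (auto simp: is_path_def)
      then show ?case using none by blast
    qed
    moreover have "v = vs ! length es"
      using p(3) path_ends(3) [OF p(1)] by simp
    ultimately show False using none v e0 by blast
  qed
  then obtain e x where e: "e \<in> edges H" "e \<notin> S" "x \<in> e" "x \<in> \<Union>S" by blast
  have "y = x" if "y \<in> e" "y \<in> \<Union>S" for y
    using hypertree_edge_Int_connected [OF H(1) S(1) e(1,2)] conn that e by blast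
  then have Int: "e \<inter> \<Union>S = {x}" using e by blast
  have ce: "card e = k" "finite e" using e(1) hyp H(2) by (auto simp: hypergraph_on_def card_ge_0_finite)
  let ?S = "insert e S" and ?K = "\<lparr>verts = \<Union>(insert e S), edges = insert e S\<rparr>"
  have "card ?S = Suc n" using e(2) S(1,2) finE by (simp add: finite_subset)
  moreover have "card (\<Union>?S) = Suc n * (k - 1) + 1"
    using card_Un_Int [of e "\<Union>S"] ce SV(2) S(3) Int H(2) by simp
  moreover have "\<exists>q. reach ?K q a b" if ab: "a \<in> \<Union>?S" "b \<in> \<Union>?S" for a b
  proof -
    have to_x: "\<exists>q. reach ?K q a x" if "a \<in> \<Union>?S" for a
    proof (cases "a \<in> \<Union>S")
      case True
      then obtain q where "reach \<lparr>verts = \<Union>S, edges = S\<rparr> q a x" using conn e(4) by blast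
      then have "reach ?K q a x" by (rule reach_mono) auto
      then show ?thesis ..
    next
      case False
      then have "reach ?K 1 a x" using that e(3) by (intro reach_edge [of e]) auto
      then show ?thesis ..
    qed
    obtain q r where "reach ?K q a x" "reach ?K r b x"
      using to_x [OF ab(1)] to_x [OF ab(2)] by blast
    from reach_trans [OF reach_sym [OF this(2)] this(1)] show ?thesis by blast
  qed
  ultimately show ?case using S(1) e(1) by (intro exI [of _ ?S]) auto
qed

lemma hypertree_vertex_in_edge:
  assumes "hypertree k H" "k \<ge> 2" "edges H \<noteq> {}" "v \<in> verts H"
  shows "\<exists>e\<in>edges H. v \<in> e"
proof -
  obtain e where e: "e \<in> edges H" using assms(3) by blast
  then have "card e \<ge> 2" "e \<subseteq> verts H" using assms(1,2) by (auto simp: hypertree_def hypergraph_on_def)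
  then have "\<not> e \<subseteq> {v}" using card_mono [of "{v}" e] by auto
  then obtain u where u: "u \<in> e" "u \<noteq> v" by blast
  then obtain vs es where p: "is_path H vs es" "hd vs = v" "last vs = u"
    using hypertree_path [OF assms(1,4)] \<open>e \<subseteq> verts H\<close> by blast
  then have "es \<noteq> []" using u(2) by (cases vs) (auto simp: is_path_def)
  then have "vs ! 0 \<in> es ! 0" "es ! 0 \<in> edges H" using p(1) by (auto simp: is_path_def)
  moreover have "vs ! 0 = v" using p(2) path_ends(2) [OF p(1)] by simp
  ultimately show ?thesis by auto
qed

lemma card_verts_hypertree:
  assumes "hypertree k H" "k \<ge> 2" "edges H \<noteq> {}"
  shows "card (verts H) = card (edges H) * (k - 1) + 1"
proof -
  have hyp: "hypergraph_on k H" using assms(1) by (simp add: hypertree_def)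
  note fin = finite_edges [OF hyp]
  then have "card (edges H) \<ge> 1" using assms(3) by (simp add: Suc_le_eq card_gt_0_iff)
  from hypertree_grow [OF assms(1,2) this] obtain S
    where S: "S \<subseteq> edges H" "card S = card (edges H)" "card (\<Union>S) = card (edges H) * (k - 1) + 1" by auto
  have "S = edges H" using S fin by (simp add: card_subset_eq)
  moreover have "\<Union>(edges H) = verts H"
    using hypertree_vertex_in_edge [OF assms] hyp by (auto simp: hypergraph_on_def)
  ultimately show ?thesis using S(3) by simp
qed

lemma sum_degree:
  assumes "hypergraph_on k H"
  shows "(\<Sum>v\<in>verts H. degree H v) = k * card (edges H)"
proof -
  have finE: "finite (edges H)" and finV: "finite (verts H)"
    using finite_edges [OF assms] assms by (auto simp: hypergraph_on_def)
  have "(\<Sum>v\<in>verts H. degree H v) = (\<Sum>v\<in>verts H. \<Sum>e\<in>edges H. if v \<in> e then 1 else 0)"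
    unfolding degree_def using finE by (intro sum.cong) (auto simp: sum.If_cases Int_def)
  also have "\<dots> = (\<Sum>e\<in>edges H. \<Sum>v\<in>verts H. if v \<in> e then 1 else 0)" by (rule sum.swap)
  also have "\<dots> = (\<Sum>e\<in>edges H. k)"
  proof (rule sum.cong [OF refl])
    fix e assume "e \<in> edges H"
    then have "card e = k" "verts H \<inter> e = e" using assms by (auto simp: hypergraph_on_def)
    then show "(\<Sum>v\<in>verts H. if v \<in> e then 1 else 0) = k" using finV by (simp add: sum.If_cases)
  qed
  finally show ?thesis by simp
qed

section \<open>Maximal sums of squared degrees\<close>

definition inner_verts :: "'a list \<Rightarrow> 'a set" where
  "inner_verts vs = (!) vs ` {1..<length vs - 1}"

lemma card_inner_verts: "distinct vs \<Longrightarrow> card (inner_verts vs) = length vs - 2"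
  unfolding inner_verts_def
  by (subst card_image) (auto simp: inj_on_def nth_eq_iff_index_eq)

lemma degree_inner_vert:
  assumes "hypergraph_on k H" "is_path H vs es" "v \<in> inner_verts vs"
  shows "degree H v \<ge> 2" "v \<in> verts H"
proof -
  obtain a where a: "1 \<le> a" "a < length es" "v = vs ! a"
    using assms(2,3) by (auto simp: inner_verts_def is_path_def)
  then obtain b where b: "a = Suc b" by (cases a) auto
  have e: "es ! b \<in> edges H" "es ! a \<in> edges H" "es ! b \<noteq> es ! a" "v \<in> es ! b" "v \<in> es ! a"
    using a b assms(2) by (auto simp: is_path_def nth_eq_iff_index_eq)
  then have "card {es ! b, es ! a} \<le> degree H v"
    unfolding degree_def using finite_edges [OF assms(1)] by (intro card_mono) auto
  then show "degree H v \<ge> 2" using e(3) by simp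
  show "v \<in> verts H" using a assms(2) by (auto simp: is_path_def)
qed

text \<open>With \<open>y v\<close> the excess of the degree of \<open>v\<close> over its forced minimum (\<open>2\<close> on the inner vertices
  of a path, \<open>1\<close> elsewhere), \<open>y\<close> sums to \<open>p = m - d\<close>, so that the sum of the squared degrees is
  maximal if \<open>y\<close> is concentrated on one inner vertex.\<close>

definition excess :: "'a hypergraph \<Rightarrow> 'a list \<Rightarrow> 'a \<Rightarrow> real" where
  "excess H vs v = real (degree H v) - 1 - indicat_real (inner_verts vs) v"

text \<open>In the formula for the squares, the subtracted sum collects two penalties, nonnegative
  because no excess is greater than the total \<open>r\<close>. The first,
  \<open>y * (r - y)\<close>, vanishes only for excess 0 or \<open>r\<close>; the second only if
  vertices off the inner part of the path have no excess.\<close>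

lemma
  assumes H: "hypertree k H" "k \<ge> 2" and p: "is_path H vs es" "length es \<ge> 1"
  defines "r \<equiv> real (card (edges H)) - length es"
  shows excess_nonneg: "v \<in> verts H \<Longrightarrow> excess H vs v \<ge> 0"
    and sum_excess: "(\<Sum>v\<in>verts H. excess H vs v) = r"
    and sum_degree_squares: "(\<Sum>v\<in>verts H. (real (degree H v))\<^sup>2) =
      card (verts H) + 3 * (real (length es) - 1) + r\<^sup>2 + 4 * r -
      (\<Sum>v\<in>verts H. excess H vs v * (r - excess H vs v) +
        2 * (1 - indicat_real (inner_verts vs) v) * excess H vs v)"
proof -
  have hyp: "hypergraph_on k H" and finV: "finite (verts H)"
    using H(1) by (auto simp: hypertree_def hypergraph_on_def)
  have len: "length vs = Suc (length es)" "distinct vs" using p by (auto simp: is_path_def)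
  have "edges H \<noteq> {}" using p by (cases es) (auto simp: is_path_def)
  note n = card_verts_hypertree [OF H this] and inE = hypertree_vertex_in_edge [OF H this]
  show nonneg: "excess H vs v \<ge> 0" if "v \<in> verts H" for v
  proof (cases "v \<in> inner_verts vs")
    case True
    then show ?thesis using degree_inner_vert [OF hyp p(1) True] by (simp add: excess_def)
  next
    case False
    have "{e \<in> edges H. v \<in> e} \<noteq> {}" using inE [OF that] by blast
    then have "degree H v \<ge> 1"
      unfolding degree_def using finite_edges [OF hyp] by (simp add: Suc_le_eq card_gt_0_iff)
    then show ?thesis using False by (simp add: excess_def)
  qed
  have inner: "inner_verts vs \<subseteq> verts H" using degree_inner_vert [OF hyp p(1)] by blast
  have ind: "(\<Sum>v\<in>verts H. indicat_real (inner_verts vs) v) = real (length es) - 1"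
  proof -
    have "(\<Sum>v\<in>verts H. indicat_real (inner_verts vs) v) = real (card (inner_verts vs))"
      using inner finV by (simp add: indicator_def sum.If_cases Int_absorb1)
    then show ?thesis using card_inner_verts [OF len(2)] len(1) p(2) by (simp add: of_nat_diff)
  qed
  have "(\<Sum>v\<in>verts H. real (degree H v)) = real k * card (edges H)"
    using sum_degree [OF hyp] by (metis of_nat_mult of_nat_sum)
  then have "(\<Sum>v\<in>verts H. excess H vs v) =
      real k * card (edges H) - card (verts H) - (real (length es) - 1)"
    by (simp add: excess_def sum_subtractf ind)
  also have "\<dots> = r" using H(2) by (simp add: n r_def of_nat_diff algebra_simps)
  finally show sum: "(\<Sum>v\<in>verts H. excess H vs v) = r" .
  \<comment> \<open>With excess \<open>y\<close> the square is \<open>(2 + y)^2\<close> on inner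
    vertices and \<open>(1 + y)^2\<close> elsewhere. The multiple \<open>(r + 4) * y\<close> is
    split off, since the sum of \<open>y\<close> is known.\<close>
  have sq: "(real (degree H v))\<^sup>2 = 1 + 3 * indicat_real (inner_verts vs) v + (r + 4) * excess H vs v -
      (excess H vs v * (r - excess H vs v) + 2 * (1 - indicat_real (inner_verts vs) v) * excess H vs v)" for v
  proof -
    have "real (degree H v) = 1 + indicat_real (inner_verts vs) v + excess H vs v" by (simp add: excess_def)
    then show ?thesis by (auto simp: power2_eq_square algebra_simps indicator_def)
  qed
  have "(\<Sum>v\<in>verts H. (real (degree H v))\<^sup>2) =
      card (verts H) + 3 * (\<Sum>v\<in>verts H. indicat_real (inner_verts vs) v) + (r + 4) * (\<Sum>v\<in>verts H. excess H vs v) -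
      (\<Sum>v\<in>verts H. excess H vs v * (r - excess H vs v) +
        2 * (1 - indicat_real (inner_verts vs) v) * excess H vs v)"
    unfolding sq by (simp add: sum.distrib sum_subtractf sum_distrib_left)
  then show "(\<Sum>v\<in>verts H. (real (degree H v))\<^sup>2) =
      card (verts H) + 3 * (real (length es) - 1) + r\<^sup>2 + 4 * r -
      (\<Sum>v\<in>verts H. excess H vs v * (r - excess H vs v) +
        2 * (1 - indicat_real (inner_verts vs) v) * excess H vs v)"
    unfolding ind sum by (simp add: power2_eq_square algebra_simps)
qed

text \<open>Each vertex contributes 1, each of the \<open>d - 1\<close> inner ones 3 more, and
  gathering the whole excess \<open>r = m - d\<close> at one inner vertex turns its 4 into
  \<open>(r + 2)^2\<close>.\<close>

definition max_square_sum :: "nat \<Rightarrow> nat \<Rightarrow> nat \<Rightarrow> real" where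
  "max_square_sum k m d = real (m * (k - 1) + 1) + 3 * (real d - 1) + (real m - d)\<^sup>2 + 4 * (real m - d)"

definition broom_degrees :: "'a hypergraph \<Rightarrow> 'a list \<Rightarrow> nat \<Rightarrow> nat \<Rightarrow> bool" where
  "broom_degrees H vs p j \<longleftrightarrow> (\<forall>v\<in>verts H. degree H v =
     (if v = vs ! j then p + 2 else if v \<in> inner_verts vs then 2 else 1))"

lemma degree_squares_extremal:
  assumes H: "hypertree k H" "k \<ge> 2" "card (edges H) = m"
    and p: "is_path H vs es" "length es = d" "d \<ge> 2"
  shows "(\<Sum>v\<in>verts H. (real (degree H v))\<^sup>2) \<le> max_square_sum k m d"
    and "(\<Sum>v\<in>verts H. (real (degree H v))\<^sup>2) = max_square_sum k m d \<longleftrightarrow>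
      (\<exists>j\<in>{1..<d}. broom_degrees H vs (m - d) j)"
proof -
  have len: "length es \<ge> 1" using p by simp
  have hyp: "hypergraph_on k H" and fin: "finite (verts H)"
    using H(1) by (auto simp: hypertree_def hypergraph_on_def)
  let ?r = "real (card (edges H)) - length es" and ?y = "excess H vs"
  let ?i = "indicat_real (inner_verts vs)"
  let ?g = "\<lambda>v. ?y v * (?r - ?y v) + 2 * (1 - ?i v) * ?y v"
  note nonneg = excess_nonneg [OF H(1,2) p(1) len]
    and sum = sum_excess [OF H(1,2) p(1) len]
    and squares = sum_degree_squares [OF H(1,2) p(1) len]
  have dm: "d \<le> m"
    using p(1,2) H(3) finite_edges [OF hyp] card_mono [of "edges H" "set es"]
    by (auto simp: is_path_def distinct_card)
  have r: "?r = real (m - d)" using dm H(3) p(2) by (simp add: of_nat_diff)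
  have le_r: "?y v \<le> ?r" if "v \<in> verts H" for v
    using member_le_sum [of v "verts H" ?y] nonneg fin that sum by auto
  have i01: "?i v \<le> 1" for v by (simp add: indicator_def)
  have g: "?y v * (?r - ?y v) \<ge> 0" "2 * (1 - ?i v) * ?y v \<ge> 0" if "v \<in> verts H" for v
    using nonneg [OF that] le_r [OF that] i01 [of v] by auto
  have "edges H \<noteq> {}" using H(3) dm p(3) by auto
  then have eq: "(\<Sum>v\<in>verts H. (real (degree H v))\<^sup>2) = max_square_sum k m d - (\<Sum>v\<in>verts H. ?g v)"
    unfolding squares using card_verts_hypertree [OF H(1,2)]
    by (simp add: max_square_sum_def H(3) p(2))
  have g0: "(\<Sum>v\<in>verts H. ?g v) \<ge> 0" using g by (intro sum_nonneg add_nonneg_nonneg) auto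
  then show "(\<Sum>v\<in>verts H. (real (degree H v))\<^sup>2) \<le> max_square_sum k m d" using eq by simp
  have "(\<Sum>v\<in>verts H. (real (degree H v))\<^sup>2) = max_square_sum k m d \<longleftrightarrow> (\<forall>v\<in>verts H. ?g v = 0)"
    unfolding eq using g fin by (subst sum_nonneg_eq_0_iff [symmetric]) auto
  also have "\<dots> \<longleftrightarrow> (\<forall>v\<in>verts H. (?y v = 0 \<or> ?y v = ?r) \<and> (v \<notin> inner_verts vs \<longrightarrow> ?y v = 0))"
    using g by (intro ball_cong refl) (fastforce simp: add_nonneg_eq_0_iff indicator_def)
  also have "\<dots> \<longleftrightarrow> (\<exists>j\<in>{1..<d}. broom_degrees H vs (m - d) j)"
  proof
    assume y: "\<forall>v\<in>verts H. (?y v = 0 \<or> ?y v = ?r) \<and> (v \<notin> inner_verts vs \<longrightarrow> ?y v = 0)"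
    have deg: "real (degree H v) = ?y v + 1 + ?i v" for v by (simp add: excess_def)
    show "\<exists>j\<in>{1..<d}. broom_degrees H vs (m - d) j"
    proof (cases "?r = 0")
      \<comment> \<open>Without excess every inner vertex qualifies as \<open>vs ! j\<close>;
        \<open>vs ! 1\<close> is one since \<open>d \<ge> 2\<close>.\<close>
      case True
      have "degree H v = (if v \<in> inner_verts vs then 2 else 1)" if "v \<in> verts H" for v
      proof -
        have "?y v = 0" using y that True by auto
        with deg [of v] show ?thesis by (auto simp: indicator_def)
      qed
      moreover have "vs ! 1 \<in> inner_verts vs" using p by (auto simp: inner_verts_def is_path_def)
      moreover have "m - d = 0" using True r by simp
      ultimately show ?thesis
        using p(3) by (intro bexI [of _ 1]) (auto simp: broom_degrees_def)
    next
      case False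
      then obtain v where v: "v \<in> verts H" "?y v \<noteq> 0"
        using sum by (metis (no_types, lifting) sum.neutral)
      then have vI: "v \<in> inner_verts vs" "?y v = ?r" using y by auto
      then obtain j where j: "j \<in> {1..<d}" "v = vs ! j"
        using p by (auto simp: inner_verts_def is_path_def)
      have "?y w = 0" if "w \<in> verts H" "w \<noteq> v" for w
      proof -
        have "(\<Sum>w\<in>verts H. ?y w) = ?y v + (\<Sum>w\<in>verts H - {v}. ?y w)"
          using fin v(1) by (simp add: sum.remove)
        then have "(\<Sum>w\<in>verts H - {v}. ?y w) = 0" using sum vI(2) by simp
        then show ?thesis using nonneg fin that by (subst (asm) sum_nonneg_eq_0_iff) auto
      qed
      then have "real (degree H w) = (if w = v then ?r else 0) + 1 + ?i w" if "w \<in> verts H" for w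
        using deg vI(2) that by auto
      then have "real (degree H w) = real (if w = v then m - d + 2 else if w \<in> inner_verts vs then 2 else 1)"
        if "w \<in> verts H" for w
        using vI(1) r that by (auto simp: indicator_def)
      then have "broom_degrees H vs (m - d) j"
        unfolding broom_degrees_def of_nat_eq_iff by (simp add: j(2))
      then show ?thesis using j(1) by blast
    qed
  next
    assume "\<exists>j\<in>{1..<d}. broom_degrees H vs (m - d) j"
    then obtain j where j: "j \<in> {1..<d}" "broom_degrees H vs (m - d) j" by blast
    moreover have "vs ! j \<in> inner_verts vs" using j(1) p by (auto simp: inner_verts_def is_path_def)
    ultimately show "\<forall>v\<in>verts H. (?y v = 0 \<or> ?y v = ?r) \<and> (v \<notin> inner_verts vs \<longrightarrow> ?y v = 0)"
      unfolding r by (auto simp: broom_degrees_def excess_def indicator_def)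
  qed
  finally show "(\<Sum>v\<in>verts H. (real (degree H v))\<^sup>2) = max_square_sum k m d \<longleftrightarrow>
      (\<exists>j\<in>{1..<d}. broom_degrees H vs (m - d) j)" .
qed


section \<open>Brooms\<close>

text \<open>The model of \<open>S_{c, d - c, 1, \<dots>, 1}\<close>: an axis of \<open>d\<close> edges with joints \<open>Axis 0, \<dots>, Axis d\<close> and
  inserted vertices \<open>Link a i\<close>, and \<open>p\<close> pendant edges at the joint \<open>Axis c\<close>. The vertex set does not
  depend on \<open>c\<close>.\<close>

datatype broom_vertex = Axis nat | Link nat nat | Leaf nat nat

definition axis_edge :: "nat \<Rightarrow> nat \<Rightarrow> broom_vertex set" where
  "axis_edge k a = {Axis a, Axis (Suc a)} \<union> Link a ` {..<k - 2}"

definition leaf_edge :: "nat \<Rightarrow> nat \<Rightarrow> nat \<Rightarrow> broom_vertex set" where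
  "leaf_edge k c b = insert (Axis c) (Leaf b ` {..<k - 1})"

definition broom_verts :: "nat \<Rightarrow> nat \<Rightarrow> nat \<Rightarrow> broom_vertex set" where
  "broom_verts k d p = Axis ` {..d} \<union> (\<Union>a<d. Link a ` {..<k - 2}) \<union> (\<Union>b<p. Leaf b ` {..<k - 1})"

definition broom :: "nat \<Rightarrow> nat \<Rightarrow> nat \<Rightarrow> nat \<Rightarrow> broom_vertex hypergraph" where
  "broom k d p c = \<lparr>verts = broom_verts k d p,
     edges = axis_edge k ` {..<d} \<union> leaf_edge k c ` {..<p}\<rparr>"

text \<open>The bare path keeps the leaf vertices as isolated ones, so that it has the same vertex
  set and therefore the same objects as the brooms.\<close>

definition spine :: "nat \<Rightarrow> nat \<Rightarrow> nat \<Rightarrow> broom_vertex hypergraph" where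
  "spine k d p = \<lparr>verts = broom_verts k d p, edges = axis_edge k ` {..<d}\<rparr>"

lemma verts_broom [simp]: "verts (broom k d p c) = broom_verts k d p"
  and edges_broom: "edges (broom k d p c) = axis_edge k ` {..<d} \<union> leaf_edge k c ` {..<p}"
  and verts_spine [simp]: "verts (spine k d p) = broom_verts k d p"
  and edges_spine: "edges (spine k d p) = axis_edge k ` {..<d}"
  by (simp_all add: broom_def spine_def)

lemma mem_axis_edge [simp]:
  "Axis b \<in> axis_edge k a \<longleftrightarrow> b = a \<or> b = Suc a"
  "Link b i \<in> axis_edge k a \<longleftrightarrow> b = a \<and> i < k - 2"
  "Leaf b i \<notin> axis_edge k a"
  by (auto simp: axis_edge_def)

lemma mem_leaf_edge [simp]:
  "Axis b \<in> leaf_edge k c a \<longleftrightarrow> b = c"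
  "Link b i \<notin> leaf_edge k c a"
  "Leaf b i \<in> leaf_edge k c a \<longleftrightarrow> b = a \<and> i < k - 1"
  by (auto simp: leaf_edge_def)

lemma mem_broom_verts [simp]:
  "Axis a \<in> broom_verts k d p \<longleftrightarrow> a \<le> d"
  "Link a i \<in> broom_verts k d p \<longleftrightarrow> a < d \<and> i < k - 2"
  "Leaf b i \<in> broom_verts k d p \<longleftrightarrow> b < p \<and> i < k - 1"
  by (auto simp: broom_verts_def)

lemma finite_broom_verts [simp]: "finite (broom_verts k d p)"
  by (simp add: broom_verts_def)

lemma axis_edge_eq_iff [simp]: "axis_edge k a = axis_edge k b \<longleftrightarrow> a = b"
proof
  assume "axis_edge k a = axis_edge k b"
  then have "x \<in> axis_edge k a \<longleftrightarrow> x \<in> axis_edge k b" for x by simp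
  from this [of "Axis a"] this [of "Axis (Suc a)"] show "a = b" by auto
qed simp

lemma leaf_edge_eq_iff: "k \<ge> 2 \<Longrightarrow> leaf_edge k c a = leaf_edge k c b \<longleftrightarrow> a = b"
proof
  assume "k \<ge> 2" "leaf_edge k c a = leaf_edge k c b"
  then have "Leaf a 0 \<in> leaf_edge k c b" by (simp flip: \<open>leaf_edge k c a = leaf_edge k c b\<close>)
  then show "a = b" by simp
qed simp

lemma axis_edge_neq_leaf_edge [simp]: "axis_edge k a \<noteq> leaf_edge k c b"
proof
  assume "axis_edge k a = leaf_edge k c b"
  then have "x \<in> axis_edge k a \<longleftrightarrow> x \<in> leaf_edge k c b" for x by simp
  from this [of "Axis a"] this [of "Axis (Suc a)"] show False by auto
qed

lemma card_axis_edge: "k \<ge> 2 \<Longrightarrow> card (axis_edge k a) = k"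
proof -
  assume "k \<ge> 2"
  have "card (Link a ` {..<k - 2}) = k - 2" by (simp add: card_image inj_on_def)
  moreover have "card (axis_edge k a) = card {Axis a, Axis (Suc a)} + card (Link a ` {..<k - 2})"
    unfolding axis_edge_def by (rule card_Un_disjoint) auto
  ultimately show ?thesis using \<open>k \<ge> 2\<close> by simp
qed

lemma card_leaf_edge: "k \<ge> 2 \<Longrightarrow> card (leaf_edge k c b) = k"
proof -
  assume "k \<ge> 2"
  have "card (Leaf b ` {..<k - 1}) = k - 1" by (simp add: card_image inj_on_def)
  moreover have "Axis c \<notin> Leaf b ` {..<k - 1}" by auto
  ultimately show ?thesis using \<open>k \<ge> 2\<close> by (simp add: leaf_edge_def)
qed

lemma axis_edge_subset: "a < d \<Longrightarrow> axis_edge k a \<subseteq> broom_verts k d p"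
  by (auto simp: axis_edge_def)

lemma leaf_edge_subset: "b < p \<Longrightarrow> c \<le> d \<Longrightarrow> leaf_edge k c b \<subseteq> broom_verts k d p"
  by (auto simp: leaf_edge_def)

lemma broom_verts_nonempty [simp]: "broom_verts k d p \<noteq> {}"
  using mem_broom_verts(1) [of 0] by blast

lemma hypergraph_on_broom: "k \<ge> 2 \<Longrightarrow> c \<le> d \<Longrightarrow> hypergraph_on k (broom k d p c)"
  unfolding hypergraph_on_def edges_broom
  by (auto simp: card_axis_edge card_leaf_edge
      dest: subsetD [OF axis_edge_subset] subsetD [OF leaf_edge_subset])

lemma hypergraph_on_spine: "k \<ge> 2 \<Longrightarrow> hypergraph_on k (spine k d p)"
  unfolding hypergraph_on_def edges_spine
  by (auto simp: card_axis_edge dest: subsetD [OF axis_edge_subset])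

lemma card_edges_broom: "k \<ge> 2 \<Longrightarrow> card (edges (broom k d p c)) = d + p"
proof -
  assume "k \<ge> 2"
  then have "card (axis_edge k ` {..<d}) = d" "card (leaf_edge k c ` {..<p}) = p"
    by (simp_all add: card_image inj_on_def leaf_edge_eq_iff)
  then show ?thesis unfolding edges_broom by (subst card_Un_disjoint) auto
qed

text \<open>Coordinate along the axis. A link takes the value of the left end of its edge and a leaf
  that of the branching joint, so that within an edge the coordinate varies by at most one; this
  yields lower bounds for distances.\<close>

fun pos :: "nat \<Rightarrow> broom_vertex \<Rightarrow> nat" where
  "pos c (Axis a) = a"
| "pos c (Link a i) = a"
| "pos c (Leaf b i) = c"

lemma pos_leaf_edge: "v \<in> leaf_edge k c b \<Longrightarrow> pos c v = c"
  by (auto simp: leaf_edge_def)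

lemma pos_axis_edge: "v \<in> axis_edge k a \<Longrightarrow> a \<le> pos c v \<and> pos c v \<le> Suc a"
  by (auto simp: axis_edge_def)

lemma broom_edge_pos:
  "e \<in> edges (broom k d p c) \<Longrightarrow> u \<in> e \<Longrightarrow> v \<in> e \<Longrightarrow> pos c v \<le> Suc (pos c u)"
  unfolding edges_broom by (elim UnE imageE) (auto dest!: pos_leaf_edge pos_axis_edge [where c = c])

lemma reach_axis:
  assumes "b \<le> d" "a \<le> b"
  shows "reach (broom k d p c) (b - a) (Axis a) (Axis b)"
  using assms
proof (induction b)
  case (Suc b)
  show ?case
  proof (cases "a = Suc b")
    case False
    then have "reach (broom k d p c) (Suc (b - a)) (Axis a) (Axis (Suc b))"
      using Suc by (intro reach_step [OF Suc.IH, of "axis_edge k b"]) (auto simp: edges_broom)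
    then show ?thesis using Suc.prems False by (simp add: Suc_diff_le)
  qed (use Suc.prems in \<open>auto intro: reach_refl\<close>)
qed (auto intro: reach_refl)

lemma reach_broom:
  assumes "k \<ge> 2" "1 \<le> c" "c < d" "u \<in> broom_verts k d p" "v \<in> broom_verts k d p"
  shows "\<exists>q\<le>d. reach (broom k d p c) q u v"
proof -
  \<comment> \<open>\<open>hub z v\<close> is the joint by which a route from \<open>v\<close>
    towards position \<open>z\<close> enters the axis, \<open>out v\<close> the number of steps
    needed to get there.\<close>
  define hub where "hub z v = (case v of Axis a \<Rightarrow> a | Link a i \<Rightarrow> if a < z then Suc a else a | Leaf b i \<Rightarrow> c)"
    for z v
  define out where "out v = (case v of Axis a \<Rightarrow> (0::nat) | _ \<Rightarrow> 1)" for v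
  have hub: "reach (broom k d p c) (out v) v (Axis (hub z v))" if "v \<in> broom_verts k d p" for v z
  proof (cases v)
    case (Axis a)
    then show ?thesis using that by (auto simp: hub_def out_def intro: reach_refl)
  next
    case (Link a i)
    then have "reach (broom k d p c) 1 v (Axis (hub z v))"
      using that by (intro reach_edge [of "axis_edge k a"]) (auto simp: hub_def edges_broom)
    then show ?thesis using Link by (simp add: out_def)
  next
    case (Leaf b i)
    then have "reach (broom k d p c) 1 v (Axis (hub z v))"
      using that assms by (intro reach_edge [of "leaf_edge k c b"]) (auto simp: hub_def edges_broom)
    then show ?thesis using Leaf by (simp add: out_def)
  qed
  let ?x = "hub (pos c v) u" and ?y = "hub (pos c u) v"
  have xd: "hub z v \<le> d" if "v \<in> broom_verts k d p" for v z
    using that assms by (cases v) (auto simp: hub_def)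
  \<comment> \<open>Subtraction is truncated: one of the two summands is 0, the other is the
    distance of the joints.\<close>
  have "reach (broom k d p c) ((?y - ?x) + (?x - ?y)) (Axis ?x) (Axis ?y)"
  proof (cases "?x \<le> ?y")
    case True
    then show ?thesis using reach_axis [OF xd [OF assms(5)]] by simp
  next
    case False
    then show ?thesis using reach_sym [OF reach_axis [OF xd [OF assms(4)]]] by simp
  qed
  from reach_trans [OF reach_trans [OF reach_sym [OF hub [OF assms(5)]] this] hub [OF assms(4)]]
  have "reach (broom k d p c) (out u + ((?y - ?x) + (?x - ?y) + out v)) u v" by (simp add: add.assoc)
  \<comment> \<open>\<open>1 \<le> c\<close> and \<open>c < d\<close> bound the routes from a leaf
    to the two ends of the axis; for two leaves they give \<open>2 \<le> d\<close>.\<close>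
  moreover have "out u + ((?y - ?x) + (?x - ?y) + out v) \<le> d"
    using assms(2-5) by (cases u; cases v) (auto simp: hub_def out_def)
  ultimately show ?thesis by blast
qed

lemma broom_edges_share:
  "e \<in> edges (broom k d p c) \<Longrightarrow> e' \<in> edges (broom k d p c) \<Longrightarrow> e \<noteq> e' \<Longrightarrow> v \<in> e \<Longrightarrow> v \<in> e' \<Longrightarrow>
    \<exists>a. v = Axis a"
  by (cases v) (auto simp: edges_broom)

text \<open>Two edges share only joints, so all vertices of a cycle are joints and all its edges are
  axis edges. At a vertex of the cycle with the largest coordinate both neighbouring edges would be
  the axis edge to its left.\<close>

lemma broom_acyclic: "\<not> is_cycle (broom k d p c) vs es"
proof
  let ?B = "broom k d p c"
  assume cyc: "is_cycle ?B vs es"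
  let ?L = "length es"
  have L: "?L \<ge> 2" "length vs = ?L" "distinct vs" "distinct es" "set es \<subseteq> edges ?B"
    and mem: "\<And>i. i < ?L \<Longrightarrow> vs ! i \<in> es ! i" "\<And>i. i < ?L \<Longrightarrow> vs ! (Suc i mod ?L) \<in> es ! i"
    using cyc by (auto simp: is_cycle_def)
  have pred: "\<exists>j<?L. Suc j mod ?L = i \<and> j \<noteq> i" if "i < ?L" for i
  proof (cases i)
    case 0
    show ?thesis
    proof (intro exI conjI)
      have "Suc (?L - 1) = ?L" using L(1) by linarith
      then show "Suc (?L - 1) mod ?L = i" using 0 by (simp only: mod_self)
    qed (use L(1) 0 in auto)
  next
    case (Suc j)
    then show ?thesis using that by (intro exI [of _ j]) auto
  qed
  have axis: "\<exists>a. vs ! i = Axis a" if i: "i < ?L" for i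
  proof -
    obtain j where j: "j < ?L" "Suc j mod ?L = i" "j \<noteq> i" using pred [OF i] by blast
    then have "es ! j \<noteq> es ! i" using i L(4) by (simp add: nth_eq_iff_index_eq)
    moreover have "es ! j \<in> edges ?B" "es ! i \<in> edges ?B" using i j L(5) by auto
    ultimately show ?thesis using broom_edges_share mem(1) [OF i] mem(2) [OF j(1)] j(2) by metis
  qed
  have succ: "Suc i mod ?L < ?L" "Suc i mod ?L \<noteq> i" if "i < ?L" for i
    using that L(1) by (auto simp: mod_Suc)
  have edge: "\<exists>a. es ! i = axis_edge k a \<and> {vs ! i, vs ! (Suc i mod ?L)} = {Axis a, Axis (Suc a)}"
    if i: "i < ?L" for i
  proof -
    obtain a b where ab: "vs ! i = Axis a" "vs ! (Suc i mod ?L) = Axis b"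
      using axis i succ(1) [OF i] by metis
    have "vs ! i \<noteq> vs ! (Suc i mod ?L)"
      using i L(2,3) succ [OF i] by (auto simp: nth_eq_iff_index_eq)
    then have "a \<noteq> b" using ab by auto
    moreover have "es ! i \<in> edges ?B" "Axis a \<in> es ! i" "Axis b \<in> es ! i"
      using i L(5) mem [OF i] ab by auto
    ultimately show ?thesis unfolding ab edges_broom by auto
  qed
  obtain i where i: "i < ?L" "\<And>j. j < ?L \<Longrightarrow> pos c (vs ! j) \<le> pos c (vs ! i)"
  proof -
    have "finite ((\<lambda>j. pos c (vs ! j)) ` {..<?L})" "(\<lambda>j. pos c (vs ! j)) ` {..<?L} \<noteq> {}"
      using L(1) by (auto simp: lessThan_empty_iff)
    from Max_in [OF this] Max_ge [OF this(1)] show ?thesis using that by fastforce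
  qed
  obtain j where j: "j < ?L" "Suc j mod ?L = i" "j \<noteq> i" using pred [OF i(1)] by blast
  obtain a where a: "es ! i = axis_edge k a" "{vs ! i, vs ! (Suc i mod ?L)} = {Axis a, Axis (Suc a)}"
    using edge [OF i(1)] by blast
  obtain b where b: "es ! j = axis_edge k b" "{vs ! j, vs ! i} = {Axis b, Axis (Suc b)}"
    using edge [OF j(1)] j(2) by auto
  have "vs ! i = Axis (Suc a)"
    using a(2) i(2) [OF succ(1) [OF i(1)]] by (auto simp: doubleton_eq_iff)
  moreover have "vs ! i = Axis (Suc b)"
    using b(2) i(2) [OF j(1)] by (auto simp: doubleton_eq_iff)
  ultimately have "es ! i = es ! j" using a b by simp
  then show False using L(4) i(1) j by (simp add: nth_eq_iff_index_eq)
qed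

lemma hypertree_broom:
  assumes "k \<ge> 2" "1 \<le> c" "c < d"
  shows "hypertree k (broom k d p c)"
  unfolding hypertree_def connected_hypergraph_def
  using hypergraph_on_broom [of k c d p] broom_acyclic reach_broom [OF assms] reach_imp_joins assms
  by (metis less_imp_le verts_broom)

lemma broom_path:
  "is_path (broom k d p c) (map Axis [0..<Suc d]) (map (axis_edge k) [0..<d])"
  unfolding is_path_def
  by (auto simp: distinct_map inj_on_def edges_broom simp del: upt_Suc)

lemma broom_path_ends: "hd (map Axis [0..<Suc d]) = Axis 0" "last (map Axis [0..<Suc d]) = Axis d"
  by (simp_all add: hd_map del: upt_Suc) (simp add: last_map)

lemma hdist_broom_le:
  assumes "k \<ge> 2" "1 \<le> c" "c < d" "u \<in> broom_verts k d p" "v \<in> broom_verts k d p"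
  shows "hdist (broom k d p c) u v \<le> d"
proof -
  obtain q where "q \<le> d" "reach (broom k d p c) q u v" using reach_broom [OF assms] by blast
  moreover from reach_imp_joins [OF this(2)]
  obtain r where "r \<le> q" "joins (broom k d p c) u v r" by blast
  ultimately show ?thesis
    unfolding hdist_def using Least_le [of "joins (broom k d p c) u v" r] by simp
qed

lemma hdist_broom_ends: "hdist (broom k d p c) (Axis 0) (Axis d) = d"
  unfolding hdist_def
proof (rule Least_equality)
  show "joins (broom k d p c) (Axis 0) (Axis d) d"
    unfolding joins_def using broom_path [of k d p c] broom_path_ends [of d]
    by (intro exI [of _ "map Axis [0..<Suc d]"] exI [of _ "map (axis_edge k) [0..<d]"]) simp
next
  fix q assume "joins (broom k d p c) (Axis 0) (Axis d) q"
  then obtain vs es where p: "is_path (broom k d p c) vs es" "hd vs = Axis 0" "last vs = Axis d" "length es = q"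
    by (auto simp: joins_def)
  have "i \<le> q \<Longrightarrow> pos c (vs ! i) \<le> i" for i
  proof (induction i)
    case 0
    then show ?case using p(2) path_ends(2) [OF p(1)] by simp
  next
    case (Suc i)
    then have "pos c (vs ! Suc i) \<le> Suc (pos c (vs ! i))"
      using p(1,4) by (intro broom_edge_pos [of "es ! i"]) (auto simp: is_path_def)
    then show ?case using Suc by simp
  qed
  from this [of q] show "d \<le> q" using p(3,4) path_ends(3) [OF p(1)] by simp
qed

lemma broom_in_hypertrees:
  assumes "k \<ge> 2" "1 \<le> c" "c < d"
  shows "broom k d p c \<in> hypertrees k (d + p) d"
proof -
  let ?D = "{hdist (broom k d p c) u v | u v. u \<in> broom_verts k d p \<and> v \<in> broom_verts k d p}"
  have sub: "?D \<subseteq> {..d}" using hdist_broom_le [OF assms] by auto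
  have "diameter (broom k d p c) = d"
    unfolding diameter_def verts_broom
  proof (rule Max_eqI)
    show "finite ?D" using sub by (rule finite_subset) simp
    show "d \<in> ?D" using hdist_broom_ends [of k d p c]
      by (intro CollectI exI [of _ "Axis 0"] exI [of _ "Axis d"]) auto
  qed (use sub in auto)
  then show ?thesis
    using hypertree_broom [OF assms] card_edges_broom assms(1) by (simp add: hypertrees_def)
qed

section \<open>Degrees in brooms\<close>

definition axis_degree :: "nat \<Rightarrow> nat \<Rightarrow> nat" where
  "axis_degree d a = card {b. b < d \<and> (b = a \<or> Suc b = a)}"

lemma axis_degree_inner: "1 \<le> a \<Longrightarrow> a < d \<Longrightarrow> axis_degree d a = 2"
proof -
  assume "1 \<le> a" "a < d"
  then have "{b. b < d \<and> (b = a \<or> Suc b = a)} = {a - 1, a}" by auto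
  then show ?thesis using \<open>1 \<le> a\<close> by (simp add: axis_degree_def)
qed

lemma axis_degree_0: "0 < d \<Longrightarrow> axis_degree d 0 = 1"
proof -
  assume "0 < d"
  then have "{b. b < d \<and> (b = 0 \<or> Suc b = 0)} = {0}" by auto
  then show ?thesis by (simp add: axis_degree_def)
qed

lemma axis_degree_last: "0 < d \<Longrightarrow> axis_degree d d = 1"
proof -
  assume "0 < d"
  then have "{b. b < d \<and> (b = d \<or> Suc b = d)} = {d - 1}" by auto
  then show ?thesis by (simp add: axis_degree_def)
qed

lemma degree_spine:
  "degree (spine k d p) (Axis a) = axis_degree d a"
  "a < d \<Longrightarrow> i < k - 2 \<Longrightarrow> degree (spine k d p) (Link a i) = 1"
  "degree (spine k d p) (Leaf b i) = 0"
proof -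
  have "{e \<in> edges (spine k d p). Axis a \<in> e} = axis_edge k ` {b. b < d \<and> (b = a \<or> Suc b = a)}"
    by (auto simp: edges_spine)
  then show "degree (spine k d p) (Axis a) = axis_degree d a"
    by (simp add: degree_def axis_degree_def card_image inj_on_def)
  have "{e \<in> edges (spine k d p). Link a i \<in> e} = {axis_edge k a}" if "a < d" "i < k - 2"
    using that by (auto simp: edges_spine)
  then show "a < d \<Longrightarrow> i < k - 2 \<Longrightarrow> degree (spine k d p) (Link a i) = 1"
    by (simp add: degree_def)
  have "{e \<in> edges (spine k d p). Leaf b i \<in> e} = {}" by (auto simp: edges_spine)
  then show "degree (spine k d p) (Leaf b i) = 0" by (simp only: degree_def card.empty)
qed

lemma degree_broom:
  assumes "k \<ge> 2"
  shows "degree (broom k d p c) v = degree (spine k d p) v +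
    (if v = Axis c then p else case v of Leaf b i \<Rightarrow> if b < p \<and> i < k - 1 then 1 else 0 | _ \<Rightarrow> 0)"
proof -
  have "{e \<in> edges (broom k d p c). v \<in> e} =
      {e \<in> edges (spine k d p). v \<in> e} \<union> {e \<in> leaf_edge k c ` {..<p}. v \<in> e}"
    by (auto simp: edges_broom edges_spine)
  moreover have "card ({e \<in> edges (spine k d p). v \<in> e} \<union> {e \<in> leaf_edge k c ` {..<p}. v \<in> e}) =
      card {e \<in> edges (spine k d p). v \<in> e} + card {e \<in> leaf_edge k c ` {..<p}. v \<in> e}"
    by (rule card_Un_disjoint) (auto simp: edges_spine)
  moreover have "card {e \<in> leaf_edge k c ` {..<p}. v \<in> e} =
    (if v = Axis c then p else case v of Leaf b i \<Rightarrow> if b < p \<and> i < k - 1 then 1 else 0 | _ \<Rightarrow> 0)"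
  proof (cases v)
    case (Axis a)
    have "{e \<in> leaf_edge k c ` {..<p}. v \<in> e} = (if a = c then leaf_edge k c ` {..<p} else {})"
      using Axis by auto
    then show ?thesis using Axis assms by (auto simp: card_image inj_on_def leaf_edge_eq_iff)
  next
    case (Link a i)
    then have "{e \<in> leaf_edge k c ` {..<p}. v \<in> e} = {}" by auto
    then show ?thesis using Link by (simp only: card.empty) simp
  next
    case (Leaf b i)
    then have "{e \<in> leaf_edge k c ` {..<p}. v \<in> e} = (if b < p \<and> i < k - 1 then {leaf_edge k c b} else {})"
      by auto
    then show ?thesis using Leaf by (simp only:) simp
  qed
  ultimately show ?thesis by (simp add: degree_def)
qed

lemma broom_degrees_broom:
  assumes "k \<ge> 2" "1 \<le> c" "c < d"
  shows "broom_degrees (broom k d p c) (map Axis [0..<Suc d]) p c"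
  unfolding broom_degrees_def
proof
  let ?vs = "map Axis [0..<Suc d]"
  have nth: "?vs ! a = Axis a" if "a \<le> d" for a using that by (simp del: upt_Suc)
  have inner: "inner_verts ?vs = Axis ` {1..<d}"
    unfolding inner_verts_def using nth by (intro image_cong) (auto simp del: upt_Suc)
  fix v assume v: "v \<in> verts (broom k d p c)"
  show "degree (broom k d p c) v = (if v = ?vs ! c then p + 2 else if v \<in> inner_verts ?vs then 2 else 1)"
  proof (cases v)
    case (Axis a)
    then have "a \<le> d" using v by simp
    then consider "1 \<le> a" "a < d" | "a = 0" | "a = d" by linarith
    then show ?thesis
      using assms unfolding Axis degree_broom [OF assms(1)] degree_spine inner nth [OF less_imp_le [OF assms(3)]]
      by cases (auto simp: axis_degree_inner axis_degree_0 axis_degree_last)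
  next
    case (Link a i)
    then show ?thesis using v assms nth [of c]
      by (auto simp: degree_broom degree_spine inner simp del: upt_Suc)
  next
    case (Leaf b i)
    then show ?thesis using v assms nth [of c]
      by (auto simp: degree_broom degree_spine inner simp del: upt_Suc)
  qed
qed

lemma degree_squares_broom:
  assumes "k \<ge> 2" "1 \<le> c" "c < d"
  shows "(\<Sum>v\<in>broom_verts k d p. (real (degree (broom k d p c) v))\<^sup>2) = max_square_sum k (d + p) d"
proof -
  have "length (map (axis_edge k) [0..<d]) = d" by simp
  from degree_squares_extremal(2) [OF hypertree_broom [OF assms] assms(1) card_edges_broom [OF assms(1)]
      broom_path this]
  show ?thesis using broom_degrees_broom [OF assms, of p] assms by (auto simp del: upt_Suc)
qed


section \<open>Comparing the traces of two brooms\<close>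

lemma row_weight_mono:
  assumes "\<And>is. 0 \<le> T is" "\<And>is. T is \<le> T' is"
  shows "0 \<le> row_weight T i \<Gamma>" "row_weight T i \<Gamma> \<le> row_weight T' i \<Gamma>"
proof -
  show nonneg: "0 \<le> row_weight T i \<Gamma>" for \<Gamma>
    by (induction \<Gamma>) (simp_all add: row_weight_def assms(1))
  show "row_weight T i \<Gamma> \<le> row_weight T' i \<Gamma>"
    by (induction \<Gamma>)
      (use nonneg in \<open>auto simp: row_weight_def intro!: mult_mono assms order_trans [OF assms]\<close>)
qed

lemma obj_weight_mono:
  assumes "\<And>is. 0 \<le> T is" "\<And>is. T is \<le> T' is"
  shows "0 \<le> obj_weight V T F" "obj_weight V T F \<le> obj_weight V T' F"
  unfolding obj_weight_def using row_weight_mono [of T T'] assms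
  by (auto intro!: prod_nonneg prod_mono)

lemma obj_weight_mult: "obj_weight V (\<lambda>is. f is * T is) F = obj_weight V f F * obj_weight V T F"
proof -
  have "row_weight (\<lambda>is. f is * T is) i \<Gamma> = row_weight f i \<Gamma> * row_weight T i \<Gamma>" for i \<Gamma>
    by (induction \<Gamma>) (simp_all add: row_weight_def)
  then show ?thesis by (simp add: obj_weight_def prod.distrib)
qed

lemma obj_weight_1: "obj_weight V (\<lambda>_. 1) F = 1"
proof -
  have "row_weight (\<lambda>_. 1) i \<Gamma> = 1" for i and \<Gamma> :: "'a list list"
    by (induction \<Gamma>) (simp_all add: row_weight_def)
  then show ?thesis by (simp add: obj_weight_def)
qed

lemma A_tensor_spine_le_broom:
  assumes "k \<ge> 2" "0 \<le> \<alpha>" "\<alpha> \<le> 1"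
  shows "0 \<le> A_tensor \<alpha> k (spine k d p) is"
    "A_tensor \<alpha> k (spine k d p) is \<le> A_tensor \<alpha> k (broom k d p c) is"
proof -
  have "0 \<le> degree_tensor k (spine k d p) is" "0 \<le> adj_tensor k (spine k d p) is"
    by (auto simp: degree_tensor_def adj_tensor_def)
  then show "0 \<le> A_tensor \<alpha> k (spine k d p) is" using assms by (simp add: A_tensor_def)
  have "degree_tensor k (spine k d p) is \<le> degree_tensor k (broom k d p c) is"
    by (simp add: degree_tensor_def degree_broom [OF assms(1)])
  moreover have "adj_tensor k (spine k d p) is \<le> adj_tensor k (broom k d p c) is"
    by (auto simp: adj_tensor_def edges_spine edges_broom)
  ultimately show "A_tensor \<alpha> k (spine k d p) is \<le> A_tensor \<alpha> k (broom k d p c) is"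
    using assms by (simp add: A_tensor_def add_mono mult_left_mono)
qed

lemma singleton_not_edge:
  assumes "k \<ge> 2"
  shows "{v} \<noteq> axis_edge k a" "{v} \<noteq> leaf_edge k c b"
proof -
  have "card {v} \<noteq> k" using assms by simp
  then show "{v} \<noteq> axis_edge k a" "{v} \<noteq> leaf_edge k c b"
    using card_axis_edge [OF assms] card_leaf_edge [OF assms] by metis+
qed

text \<open>Only entries that see the pendant edges change: those of leaf edges and the loops at the
  branching joint or at leaves. For the counting it matters that the source is a joint or a leaf,
  which lies clearly on one side of every axis edge, and that the bundle is not among those
  supported on axis edges.\<close>

lemma broom_spine_differ:
  assumes k: "k \<ge> 2" and "A_tensor \<alpha> k (broom k d p c) (i # \<gamma>) \<noteq> A_tensor \<alpha> k (spine k d p) (i # \<gamma>)"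
  shows "pos c i = c" "\<And>a l. i \<noteq> Link a l" "\<And>a. set (i # \<gamma>) \<noteq> axis_edge k a"
proof -
  let ?B = "broom k d p c" and ?S = "spine k d p"
  let ?axis = "set (i # \<gamma>) \<in> axis_edge k ` {..<d}"
  have const: "set (i # \<gamma>) = {i}" if "i # \<gamma> = replicate k i"
    using that k by (metis list.distinct(1) replicate_0 set_replicate)
  have *: "pos c i = c \<and> (\<forall>a l. i \<noteq> Link a l) \<and> (\<forall>a. set (i # \<gamma>) \<noteq> axis_edge k a)"
  proof (cases "set (i # \<gamma>) \<in> leaf_edge k c ` {..<p}")
    case True
    then obtain b where "set (i # \<gamma>) = leaf_edge k c b" by blast
    moreover from this have "i \<in> leaf_edge k c b" by (metis list.set_intros(1))
    then have "pos c i = c" "\<forall>a l. i \<noteq> Link a l" by (cases i; auto)+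
    ultimately show ?thesis using axis_edge_neq_leaf_edge by metis
  next
    case False
    then have "adj_tensor k ?B (i # \<gamma>) = adj_tensor k ?S (i # \<gamma>)"
      by (simp add: adj_tensor_def edges_broom edges_spine)
    then have "degree_tensor k ?B (i # \<gamma>) \<noteq> degree_tensor k ?S (i # \<gamma>)"
      using assms(2) by (auto simp: A_tensor_def)
    then have rep: "i # \<gamma> = replicate k i" and "degree ?B i \<noteq> degree ?S i"
      unfolding degree_tensor_def list.sel(1) by metis+
    then have "pos c i = c \<and> (\<forall>a l. i \<noteq> Link a l)"
      unfolding degree_broom [OF k] by (auto split: broom_vertex.splits if_splits)
    then show ?thesis unfolding const [OF rep] using singleton_not_edge(1) [OF k] by blast
  qed
  show "pos c i = c" "\<And>a l. i \<noteq> Link a l" "\<And>a. set (i # \<gamma>) \<noteq> axis_edge k a" using * by blast+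
qed

text \<open>Projection onto the vertices of the axis edge \<open>a\<close>: deleting this edge
  separates the broom at its two joints, each side is sent to its joint, and the links of the edge
  stay fixed.\<close>

definition gate :: "nat \<Rightarrow> nat \<Rightarrow> broom_vertex \<Rightarrow> broom_vertex" where
  "gate c a v = (if \<exists>i. v = Link a i then v else if pos c v \<le> a then Axis a else Axis (Suc a))"

lemma gate_axis_edge: "v \<in> axis_edge k a \<Longrightarrow> gate c a v = v"
  by (auto simp: axis_edge_def gate_def)

lemma gate_const:
  assumes "e \<in> edges (broom k d p c)" "e \<noteq> axis_edge k a" "x \<in> e" "y \<in> e"
  shows "gate c a y = gate c a x"
proof (cases "e \<in> leaf_edge k c ` {..<p}")
  case True
  then show ?thesis using assms(3,4) by (auto simp: gate_def leaf_edge_def)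
next
  case False
  then obtain b where "e = axis_edge k b" "b \<noteq> a" using assms(1,2) by (auto simp: edges_broom)
  then show ?thesis using assms(3,4) by (auto simp: gate_def axis_edge_def)
qed

lemma axis_edge_used:
  assumes k: "k \<ge> 2" and o: "(W, F) \<in> objs (broom_verts k d p) k s"
    and w: "obj_weight (broom_verts k d p) (A_tensor \<alpha> k (broom k d p c)) F \<noteq> 0"
    and uv: "u \<in> set W" "v \<in> set W" "gate c a u \<noteq> gate c a v" and i: "i \<in> axis_edge k a"
  shows "(i, axis_edge k a) \<in> ents (broom_verts k d p) F"
proof (rule gate_all_used [OF finite_broom_verts o k, where g = "gate c a"])
  fix x f y
  assume f: "(x, f) \<in> ents (broom_verts k d p) F" "f \<noteq> axis_edge k a" "y \<in> f"
  have "x \<in> f" by (rule ents_subset_walk(1) [OF finite_broom_verts o k f(1)])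
  have "f = {x} \<or> f \<in> edges (broom k d p c)"
    using ents_A_tensor [OF finite_broom_verts w _ f(1)] k by simp
  then show "gate c a y = gate c a x"
    using gate_const [OF _ f(2) \<open>x \<in> f\<close> f(3)] f(3) by auto
qed (use uv i gate_axis_edge in auto)

text \<open>Every fully used axis edge accounts for \<open>k\<close> pairs of source and support,
  different edges for different pairs; \<open>X\<close> adds bundles with other supports.\<close>

lemma card_axis_ents:
  assumes k: "k \<ge> 2" and o: "(W, F) \<in> objs (broom_verts k d p) k s" and A: "finite A"
    and used: "\<And>a i. a \<in> A \<Longrightarrow> i \<in> axis_edge k a \<Longrightarrow> (i, axis_edge k a) \<in> ents (broom_verts k d p) F"
    and X: "X \<subseteq> ents (broom_verts k d p) F" "\<And>i f a. (i, f) \<in> X \<Longrightarrow> f \<noteq> axis_edge k a"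
  shows "k * card A + card X \<le> s"
proof -
  let ?E = "ents (broom_verts k d p) F"
  let ?Y = "\<Union>a\<in>A. (\<lambda>i. (i, axis_edge k a)) ` axis_edge k a"
  have fin: "finite (axis_edge k a)" for a using card_axis_edge [OF k, of a] k by (simp add: card_ge_0_finite)
  have "card ?Y = (\<Sum>a\<in>A. card ((\<lambda>i. (i, axis_edge k a)) ` axis_edge k a))"
    using A fin by (intro card_UN_disjoint) auto
  also have "\<dots> = (\<Sum>a\<in>A. k)"
    using card_axis_edge [OF k] by (intro sum.cong) (simp_all add: card_image inj_on_def)
  finally have "card ?Y = k * card A" by simp
  moreover have "finite ?Y" using A fin by auto
  moreover have "finite X" using X(1) finite_ents [OF finite_broom_verts o] by (rule finite_subset)
  moreover have "?Y \<inter> X = {}" using X(2) by auto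
  ultimately have "k * card A + card X = card (?Y \<union> X)" by (simp add: card_Un_disjoint)
  also have "\<dots> \<le> card ?E"
    using used X(1) finite_ents [OF finite_broom_verts o] by (intro card_mono) auto
  also have "\<dots> \<le> s" by (rule card_ents [OF finite_broom_verts o])
  finally show ?thesis .
qed

text \<open>A link belongs to the ball if both joints of its edge do. Leaves always belong, as they
  hang at the centre and move along with it.\<close>

fun in_ball :: "nat \<Rightarrow> nat \<Rightarrow> broom_vertex \<Rightarrow> bool" where
  "in_ball c r (Axis a) \<longleftrightarrow> c \<le> a + r \<and> a \<le> c + r"
| "in_ball c r (Link a i) \<longleftrightarrow> c \<le> a + r \<and> a < c + r"
| "in_ball c r (Leaf b i) \<longleftrightarrow> True"

text \<open>The differing bundle puts a vertex at coordinate \<open>c\<close> into the walk. Between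
  it and a vertex outside the ball lie \<open>r + 1\<close> axis edges, each used from all its
  \<open>k\<close> vertices, and the differing bundle itself is one more.\<close>

lemma outside_ball_size:
  assumes k: "k \<ge> 2" and o: "(W, F) \<in> objs (broom_verts k d p) k s"
    and w: "obj_weight (broom_verts k d p) (A_tensor \<alpha> k (broom k d p c)) F \<noteq> 0"
    and i: "i \<in> broom_verts k d p" "\<gamma> \<in> set (F i)"
    and differ: "A_tensor \<alpha> k (broom k d p c) (i # \<gamma>) \<noteq> A_tensor \<alpha> k (spine k d p) (i # \<gamma>)"
    and v: "v \<in> set W" "\<not> in_ball c r v"
  shows "k * Suc r + 1 \<le> s"
proof -
  note D = broom_spine_differ [OF k differ]
  have e: "(i, set (i # \<gamma>)) \<in> ents (broom_verts k d p) F" using i by (auto simp: ents_def)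
  have iW: "i \<in> set W" using ents_subset_walk(2) [OF finite_broom_verts o k e] by simp
  \<comment> \<open>The \<open>r + 1\<close> axis edges next to \<open>c\<close> on the side of
    \<open>v\<close>. If \<open>v\<close> is a link, it may sit inside the last of them, where
    \<open>gate\<close> fixes it.\<close>
  obtain A where A: "finite A" "card A = Suc r" "\<And>a. a \<in> A \<Longrightarrow> gate c a i \<noteq> gate c a v"
  proof (cases "c + r \<le> pos c v \<and> (\<forall>b l. v \<noteq> Leaf b l)")
    case True
    have "gate c a i \<noteq> gate c a v" if "a \<in> {c..c + r}" for a
      using True that D(1,2) v(2) by (cases v) (auto simp: gate_def)
    then show ?thesis by (intro that [of "{c..c + r}"]) auto
  next
    case False
    then have "pos c v + r < c" using v(2) by (cases v) auto
    moreover have "gate c a i \<noteq> gate c a v" if "a \<in> {c - Suc r..<c}" for a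
      using False that D(1,2) v(2) by (cases v) (auto simp: gate_def)
    ultimately show ?thesis by (intro that [of "{c - Suc r..<c}"]) auto
  qed
  have "k * card A + card {(i, set (i # \<gamma>))} \<le> s"
  proof (rule card_axis_ents [OF k o A(1)])
    show "(x, axis_edge k a) \<in> ents (broom_verts k d p) F" if "a \<in> A" "x \<in> axis_edge k a" for a x
      by (rule axis_edge_used [OF k o w iW v(1) A(3) [OF that(1)] that(2)])
  qed (use e D(3) in auto)
  then show ?thesis using A(2) by simp
qed

lemma no_differ_weight_eq:
  assumes "(W, F) \<in> objs V k s" "\<And>is. 0 \<le> T is" "\<And>is. T is \<le> T' is"
    and "obj_weight V T' F \<noteq> 0 \<Longrightarrow> \<forall>i\<in>V. \<forall>\<gamma>\<in>set (F i). T' (i # \<gamma>) = T (i # \<gamma>)"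
  shows "obj_weight V T' F = obj_weight V T F"
proof (cases "obj_weight V T' F = 0")
  case True
  then show ?thesis using obj_weight_mono [of T T' V F, OF assms(2,3)] by simp
next
  case False
  then show ?thesis using assms(4) by (intro obj_weight_cong [OF assms(1)]) auto
qed

text \<open>\<open>k * (r + 1) + 1\<close> exceeds \<open>k * r + 2\<close> because
  \<open>k \<ge> 2\<close>, so an object of this size that leaves the ball contains no differing
  bundle, unless its weight is 0 for both tensors.\<close>

lemma outside_ball_weight:
  assumes k: "k \<ge> 2" and \<alpha>: "0 \<le> \<alpha>" "\<alpha> \<le> 1" and o: "(W, F) \<in> objs (broom_verts k d p) k s"
    and s: "s \<le> k * r + 2" and v: "v \<in> set W" "\<not> in_ball c r v"
  shows "obj_weight (broom_verts k d p) (A_tensor \<alpha> k (broom k d p c)) F =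
    obj_weight (broom_verts k d p) (A_tensor \<alpha> k (spine k d p)) F"
proof (rule no_differ_weight_eq [OF o])
  assume "obj_weight (broom_verts k d p) (A_tensor \<alpha> k (broom k d p c)) F \<noteq> 0"
  from outside_ball_size [OF k o this _ _ _ v] s k
  show "\<forall>i\<in>broom_verts k d p. \<forall>\<gamma>\<in>set (F i).
      A_tensor \<alpha> k (broom k d p c) (i # \<gamma>) = A_tensor \<alpha> k (spine k d p) (i # \<gamma>)"
    by fastforce
qed (use A_tensor_spine_le_broom [OF k \<alpha>] in auto)

section \<open>Shifting the ball around the branching joint\<close>

fun shift :: "nat \<Rightarrow> broom_vertex \<Rightarrow> broom_vertex" where
  "shift \<delta> (Axis a) = Axis (a + \<delta>)"
| "shift \<delta> (Link a i) = Link (a + \<delta>) i"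
| "shift \<delta> (Leaf b i) = Leaf b i"

lemma inj_shift: "inj (shift \<delta>)"
proof (rule injI)
  fix x y assume "shift \<delta> x = shift \<delta> y"
  then show "x = y" by (cases x; cases y) auto
qed

lemma shift_axis_edge: "shift \<delta> ` axis_edge k a = axis_edge k (a + \<delta>)"
  by (simp add: axis_edge_def image_Un image_image)

lemma shift_leaf_edge: "shift \<delta> ` leaf_edge k c b = leaf_edge k (c + \<delta>) b"
  by (simp add: leaf_edge_def image_image)

lemma extend_inj:
  assumes "finite V" "B \<subseteq> V" "inj_on f B" "f ` B \<subseteq> V"
  obtains g where "bij_betw g V V" "\<And>x. x \<in> B \<Longrightarrow> g x = f x"
proof -
  have "card (V - B) = card (V - f ` B)"
    using assms by (simp add: card_Diff_subset finite_subset card_image)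
  then obtain h where h: "bij_betw h (V - B) (V - f ` B)"
    using assms(1) finite_same_card_bij by blast
  let ?g = "\<lambda>x. if x \<in> B then f x else h x"
  have "bij_betw ?g B (f ` B)" using assms(3) by (simp add: bij_betw_def inj_on_def image_def)
  moreover have "bij_betw ?g (V - B) (V - f ` B)"
    using h by (rule bij_betw_cong [THEN iffD1, rotated]) auto
  ultimately have "bij_betw ?g (B \<union> (V - B)) (f ` B \<union> (V - f ` B))"
    by (rule bij_betw_combine) auto
  then have "bij_betw ?g V V" using assms(2,4) by (simp add: Un_absorb1)
  then show ?thesis by (rule that) simp
qed

text \<open>\<open>j < t\<close> and \<open>t + t \<le> d\<close> keep the ball of radius
  \<open>j\<close> around joint \<open>t\<close> in the interior of the axis, whereas the one around
  joint \<open>j\<close> reaches the end \<open>Axis 0\<close> but not the end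
  \<open>Axis d\<close>.\<close>

locale broom_shift =
  fixes k d p j t :: nat and \<alpha> :: real
  assumes k: "k \<ge> 2" and j: "1 \<le> j" "j < t" and t: "t + t \<le> d" and \<alpha>: "0 < \<alpha>" "\<alpha> < 1"
begin

abbreviation "V \<equiv> broom_verts k d p"
abbreviation "T c \<equiv> A_tensor \<alpha> k (broom k d p c)"
abbreviation "T0 \<equiv> A_tensor \<alpha> k (spine k d p)"
abbreviation "ball \<equiv> {v \<in> V. in_ball j j v}"
abbreviation "\<phi> \<equiv> shift (t - j)"

text \<open>Under the shift the end \<open>Axis 0\<close> of degree 1 becomes a joint of degree 2,
  which doubles its loop weight in the broom and in the bare path alike. All other entries inside
  the ball keep their weights.\<close>

definition boost :: "broom_vertex list \<Rightarrow> real" where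
  "boost is = (if is = replicate k (Axis 0) then 2 else 1)"

lemma \<alpha>': "0 \<le> \<alpha>" "\<alpha> \<le> 1"
  using \<alpha> by auto

lemma \<phi>_ball: "\<phi> ` ball = {v \<in> V. in_ball t j v}"
proof (intro equalityI subsetI)
  fix v assume "v \<in> \<phi> ` ball"
  then obtain u where "u \<in> V" "in_ball j j u" "v = \<phi> u" by blast
  then show "v \<in> {v \<in> V. in_ball t j v}" using j t by (cases u) auto
next
  fix v assume v: "v \<in> {v \<in> V. in_ball t j v}"
  show "v \<in> \<phi> ` ball"
  proof (cases v)
    case (Axis a)
    then show ?thesis using v j t by (intro image_eqI [of _ _ "Axis (a - (t - j))"]) auto
  next
    case (Link a i)
    then show ?thesis using v j t by (intro image_eqI [of _ _ "Link (a - (t - j)) i"]) auto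
  next
    case (Leaf b i)
    then show ?thesis using v by (intro image_eqI [of _ _ "Leaf b i"]) auto
  qed
qed

lemma \<phi>_axis_edge:
  assumes "X \<subseteq> ball"
  shows "\<phi> ` X \<in> axis_edge k ` {..<d} \<longleftrightarrow> X \<in> axis_edge k ` {..<d}"
proof
  assume "\<phi> ` X \<in> axis_edge k ` {..<d}"
  then obtain a where a: "a < d" "\<phi> ` X = axis_edge k a" by blast
  have "Axis a \<in> \<phi> ` X" unfolding a(2) by simp
  then obtain u where u: "u \<in> X" "\<phi> u = Axis a" by (metis imageE)
  then obtain b where b: "a = b + (t - j)" by (cases u) auto
  then have "\<phi> ` X = \<phi> ` axis_edge k b" using a(2) by (simp add: shift_axis_edge)
  then have "X = axis_edge k b" by (simp add: inj_image_eq_iff [OF inj_shift])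
  then show "X \<in> axis_edge k ` {..<d}" using a(1) b by auto
next
  assume "X \<in> axis_edge k ` {..<d}"
  then obtain a where a: "X = axis_edge k a" by blast
  have "Axis (Suc a) \<in> axis_edge k a" by simp
  then have "Axis (Suc a) \<in> ball" using assms a by blast
  then have "a + (t - j) < d" using j t by auto
  then show "\<phi> ` X \<in> axis_edge k ` {..<d}" unfolding a shift_axis_edge by blast
qed

lemma \<phi>_leaf_edge: "\<phi> ` X \<in> leaf_edge k t ` {..<p} \<longleftrightarrow> X \<in> leaf_edge k j ` {..<p}"
proof -
  have eq: "\<phi> ` X = leaf_edge k t b \<longleftrightarrow> X = leaf_edge k j b" for b
  proof -
    have "leaf_edge k t b = \<phi> ` leaf_edge k j b" using j by (simp add: shift_leaf_edge)
    then show ?thesis by (simp only: inj_image_eq_iff [OF inj_shift])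
  qed
  show ?thesis by (simp only: image_iff eq)
qed

lemma degree_\<phi>:
  assumes "v \<in> ball"
  shows "degree (spine k d p) (\<phi> v) = (if v = Axis 0 then 2 else 1) * degree (spine k d p) v"
    and "degree (broom k d p t) (\<phi> v) = (if v = Axis 0 then 2 else 1) * degree (broom k d p j) v"
proof -
  show 1: "degree (spine k d p) (\<phi> v) = (if v = Axis 0 then 2 else 1) * degree (spine k d p) v"
    using assms j t
    by (cases v) (auto simp: degree_spine axis_degree_inner axis_degree_0)
  show "degree (broom k d p t) (\<phi> v) = (if v = Axis 0 then 2 else 1) * degree (broom k d p j) v"
    unfolding degree_broom [OF k] 1 using j by (cases v) auto
qed

lemma A_tensor_\<phi>:
  assumes "set is \<subseteq> ball" "length is = k"
  shows "T t (map \<phi> is) = boost is * T j is" "T0 (map \<phi> is) = boost is * T0 is"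
proof -
  have hyp: "hypergraph_on k (broom k d p t)" "hypergraph_on k (broom k d p j)" "hypergraph_on k (spine k d p)"
    using k j t hypergraph_on_broom hypergraph_on_spine by auto
  have "T t (map \<phi> is) = boost is * T j is \<and> T0 (map \<phi> is) = boost is * T0 is"
  proof (cases "is = replicate k (hd is)")
    case True
    define v where "v = hd is"
    have rep: "is = replicate k v" using True v_def by simp
    then have "v \<in> ball" using assms k by auto
    moreover have "boost is = (if v = Axis 0 then 2 else 1)" using rep k by (auto simp: boost_def dest: arg_cong [where f = hd])
    ultimately show ?thesis
      unfolding rep map_replicate A_tensor_loop [OF hyp(1) k] A_tensor_loop [OF hyp(2) k]
        A_tensor_loop [OF hyp(3) k] degree_\<phi> [OF \<open>v \<in> ball\<close>] by simp
  next
    case False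
    have "is \<noteq> []" using assms(2) k by auto
    have "map \<phi> is \<noteq> replicate k (hd (map \<phi> is))"
    proof
      assume "map \<phi> is = replicate k (hd (map \<phi> is))"
      then have "map \<phi> is = map \<phi> (replicate k (hd is))" using \<open>is \<noteq> []\<close> by (simp add: hd_map)
      then show False using False inj_shift by (metis inj_map_eq_map)
    qed
    moreover have "boost is = 1" using False k by (auto simp: boost_def)
    moreover have "set (map \<phi> is) = \<phi> ` set is" by simp
    ultimately show ?thesis
      using False \<phi>_axis_edge [OF assms(1)] \<phi>_leaf_edge
      by (simp only: A_tensor_def degree_tensor_def adj_tensor_def edges_broom edges_spine Un_iff) simp
  qed
  then show "T t (map \<phi> is) = boost is * T j is" "T0 (map \<phi> is) = boost is * T0 is" by auto
qed

text \<open>Some permutation of the vertices that extends the shift. Outside the ball its values are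
  arbitrary; being injective, it keeps them out of the shifted ball
  (\<open>\<pi>_ball\<close>).\<close>

definition \<pi> :: "broom_vertex \<Rightarrow> broom_vertex" where
  "\<pi> = (SOME g. bij_betw g V V \<and> (\<forall>x\<in>ball. g x = \<phi> x))"

lemma \<pi>: "bij_betw \<pi> V V" "x \<in> ball \<Longrightarrow> \<pi> x = \<phi> x"
proof -
  obtain g where "bij_betw g V V" "\<And>x. x \<in> ball \<Longrightarrow> g x = \<phi> x"
    by (rule extend_inj [of V ball \<phi>]) (use \<phi>_ball inj_on_subset [OF inj_shift] in auto)
  then have "\<exists>g. bij_betw g V V \<and> (\<forall>x\<in>ball. g x = \<phi> x)" by blast
  from someI_ex [OF this] show "bij_betw \<pi> V V" "x \<in> ball \<Longrightarrow> \<pi> x = \<phi> x" unfolding \<pi>_def by auto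
qed

lemma \<pi>_ball: "v \<in> V \<Longrightarrow> in_ball t j (\<pi> v) \<Longrightarrow> in_ball j j v"
proof -
  assume v: "v \<in> V" "in_ball t j (\<pi> v)"
  then have "\<pi> v \<in> \<phi> ` ball" using \<phi>_ball \<pi>(1) by (auto simp: bij_betw_def)
  then obtain u where "u \<in> ball" "\<pi> v = \<pi> u" using \<pi>(2) by auto
  then show ?thesis using v(1) \<pi>(1) by (auto simp: bij_betw_def dest: inj_onD)
qed

text \<open>What the pendant edges add to the weight of an object.\<close>

definition gain :: "(broom_vertex \<Rightarrow> broom_vertex list list) \<Rightarrow> real" where
  "gain F = obj_weight V (T j) F - obj_weight V T0 F"

text \<open>The gain for branching at \<open>t\<close>, pulled back along \<pi> so that both gains
  are indexed by the same objects.\<close>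

definition gain' :: "(broom_vertex \<Rightarrow> broom_vertex list list) \<Rightarrow> real" where
  "gain' F = obj_weight V (\<lambda>is. T t (map \<pi> is)) F - obj_weight V (\<lambda>is. T0 (map \<pi> is)) F"

lemma gain_nonneg: "0 \<le> gain F"
  using obj_weight_mono [of T0 "T j" V F] A_tensor_spine_le_broom [OF k \<alpha>'] by (simp add: gain_def)

lemma gain'_inside:
  assumes o: "(W, F) \<in> objs V k s" and W: "\<forall>v\<in>set W. in_ball j j v"
  shows "gain' F = obj_weight V boost F * gain F"
proof -
  have len: "set (i # \<gamma>) \<subseteq> ball \<and> length (i # \<gamma>) = k" if "i \<in> V" "\<gamma> \<in> set (F i)" for i \<gamma>
  proof -
    have "(i, set (i # \<gamma>)) \<in> ents V F" using that by (auto simp: ents_def)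
    then have "set (i # \<gamma>) \<subseteq> set W" using ents_subset_walk(2) [OF finite_broom_verts o k] by blast
    then show ?thesis using W obj_walk(3) [OF o] obj_tail [OF o that] k by auto
  qed
  have map_\<pi>: "map \<pi> is = map \<phi> is" if "set is \<subseteq> ball" for "is" using that \<pi>(2) by auto
  have eq: "T t (map \<pi> (i # \<gamma>)) = boost (i # \<gamma>) * T j (i # \<gamma>)"
    "T0 (map \<pi> (i # \<gamma>)) = boost (i # \<gamma>) * T0 (i # \<gamma>)" if "i \<in> V" "\<gamma> \<in> set (F i)" for i \<gamma>
  proof -
    have "set (i # \<gamma>) \<subseteq> ball" "length (i # \<gamma>) = k" using len [OF that] by blast+
    from A_tensor_\<phi> [OF this] map_\<pi> [OF this(1)]
    show "T t (map \<pi> (i # \<gamma>)) = boost (i # \<gamma>) * T j (i # \<gamma>)"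
      "T0 (map \<pi> (i # \<gamma>)) = boost (i # \<gamma>) * T0 (i # \<gamma>)" by (simp_all only:)
  qed
  have "obj_weight V (\<lambda>is. T t (map \<pi> is)) F = obj_weight V (\<lambda>is. boost is * T j is) F"
    by (rule obj_weight_cong [OF o]) (rule eq(1))
  moreover have "obj_weight V (\<lambda>is. T0 (map \<pi> is)) F = obj_weight V (\<lambda>is. boost is * T0 is) F"
    by (rule obj_weight_cong [OF o]) (rule eq(2))
  ultimately show ?thesis
    by (simp add: gain_def gain'_def obj_weight_mult right_diff_distrib)
qed

text \<open>For branching at \<open>t\<close> the bound is applied to the image of the object under
  \<pi>, whose walk leaves the ball around joint \<open>t\<close> by
  \<open>\<pi>_ball\<close>.\<close>

lemma gain_outside:
  assumes o: "(W, F) \<in> objs V k s" and s: "s \<le> k * j + 2" and W: "\<not> (\<forall>v\<in>set W. in_ball j j v)"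
  shows "gain F = 0" "gain' F = 0"
proof -
  obtain v where v: "v \<in> set W" "\<not> in_ball j j v" using W by blast
  show "gain F = 0" unfolding gain_def using outside_ball_weight [OF k \<alpha>' o s v] by simp
  define g where "g = the_inv_into V \<pi>"
  have gf: "g (\<pi> x) = x" if "x \<in> V" for x
    using \<pi>(1) that by (simp add: g_def bij_betw_def the_inv_into_f_f)
  note o' = objs_map [OF \<pi>(1) gf o] and w' = obj_weight_map [OF \<pi>(1) gf]
  have "v \<in> V" using obj_walk(3) [OF o] v(1) by blast
  then have v': "\<pi> v \<in> set (map \<pi> W)" "\<not> in_ball t j (\<pi> v)" using v \<pi>_ball by auto
  show "gain' F = 0"
    using outside_ball_weight [OF k \<alpha>' o' s v'] by (simp add: gain'_def w')
qed

lemma boost_ge_1: "1 \<le> boost is"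
  by (simp add: boost_def)

lemma boost_weight_ge_1: "1 \<le> obj_weight V boost F"
proof -
  have "obj_weight V (\<lambda>_. 1) F \<le> obj_weight V boost F"
    by (rule obj_weight_mono) (simp_all add: boost_ge_1)
  then show ?thesis by (simp add: obj_weight_1)
qed

text \<open>A nonzero gain provides a bundle at coordinate \<open>j\<close> that sees the pendant
  edges, a boost other than 1 the loop bundle at \<open>Axis 0\<close>. The walk connects them, so
  it uses all \<open>j\<close> edges of the short leg from all their vertices. Both bundles count in
  addition, and they differ as \<open>j \<ge> 1\<close>.\<close>

lemma boost_weight_size:
  assumes o: "(W, F) \<in> objs V k s" and "gain F \<noteq> 0" "obj_weight V boost F \<noteq> 1"
  shows "k * j + 2 \<le> s"
proof -
  let ?E = "ents V F"
  have T0: "0 \<le> T0 is" "T0 is \<le> T j is" for "is" using A_tensor_spine_le_broom [OF k \<alpha>'] by auto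
  have w: "obj_weight V (T j) F \<noteq> 0"
    using assms(2) obj_weight_mono [of T0 "T j" V F, OF T0] by (auto simp: gain_def)
  obtain i \<gamma> where i: "i \<in> V" "\<gamma> \<in> set (F i)" "T j (i # \<gamma>) \<noteq> T0 (i # \<gamma>)"
    using assms(2) obj_weight_cong [OF o, of "T j" T0] by (auto simp: gain_def)
  obtain i' \<gamma>' where i': "i' \<in> V" "\<gamma>' \<in> set (F i')" "boost (i' # \<gamma>') \<noteq> 1"
    using assms(3) obj_weight_cong [OF o, of boost "\<lambda>_. 1"]
    by (auto simp: obj_weight_1)
  have "i' # \<gamma>' = replicate k (Axis 0)" using i'(3) by (simp add: boost_def split: if_splits)
  then have 0: "set (i' # \<gamma>') = {Axis 0}" "i' = Axis 0"
    using k by (metis list.distinct(1) replicate_0 set_replicate, cases k) auto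
  note D = broom_spine_differ [OF k i(3)]
  have e: "(i, set (i # \<gamma>)) \<in> ?E" and e0: "(Axis 0, {Axis 0}) \<in> ?E"
    using i i' 0 unfolding ents_def by blast+
  have iW: "i \<in> set W" and W0: "Axis 0 \<in> set W"
    using ents_subset_walk(2) [OF finite_broom_verts o k e]
      ents_subset_walk(2) [OF finite_broom_verts o k e0] by simp_all
  have "k * card {..<j} + card {(i, set (i # \<gamma>)), (Axis 0, {Axis 0})} \<le> s"
  proof (rule card_axis_ents [OF k o])
    fix a x assume a: "a \<in> {..<j}" and x: "x \<in> axis_edge k a"
    have "gate j a i \<noteq> gate j a (Axis 0)" using D(1,2) a by (auto simp: gate_def)
    from axis_edge_used [OF k o w iW W0 this x] show "(x, axis_edge k a) \<in> ?E" .
  qed (use e e0 D(3) singleton_not_edge(1) [OF k] in auto)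
  moreover have "i \<noteq> Axis 0" using D(1) j by auto
  ultimately show ?thesis by simp
qed

lemma gain_le:
  assumes o: "(W, F) \<in> objs V k s" and s: "s \<le> k * j + 2"
  shows "gain F \<le> gain' F" "s < k * j + 2 \<Longrightarrow> gain F = gain' F"
proof -
  have "gain F \<le> gain' F \<and> (s < k * j + 2 \<longrightarrow> gain F = gain' F)"
  proof (cases "\<forall>v\<in>set W. in_ball j j v")
    case True
    then show ?thesis
      using gain'_inside [OF o True] boost_weight_size [OF o] gain_nonneg [of F] boost_weight_ge_1 [of F]
        mult_right_mono [of 1 "obj_weight V boost F" "gain F"]
      by (cases "gain F = 0"; cases "obj_weight V boost F = 1") auto
  next
    case False
    then show ?thesis using gain_outside [OF o s] by simp
  qed
  then show "gain F \<le> gain' F" "s < k * j + 2 \<Longrightarrow> gain F = gain' F" by auto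
qed

text \<open>Relabelling by \<pi> leaves \<open>obj_sum\<close> of the bare path unchanged, so it
  cancels and only differences of gains remain.\<close>

lemma obj_sum_diff:
  "obj_sum V k (T t) s - obj_sum V k (T j) s =
    (\<Sum>(W, F)\<in>objs V k s. obj_coeff V k F * (gain' F - gain F))"
proof -
  have "obj_sum V k (T t) s - obj_sum V k (T j) s =
      (obj_sum V k (\<lambda>is. T t (map \<pi> is)) s - obj_sum V k (\<lambda>is. T0 (map \<pi> is)) s) -
      (obj_sum V k (T j) s - obj_sum V k T0 s)"
    unfolding obj_sum_map [OF \<pi>(1), symmetric] by simp
  then show ?thesis
    unfolding obj_sum_def gain_def gain'_def
    by (simp add: case_prod_unfold sum_subtractf right_diff_distrib)
qed

lemma obj_sum_eq:
  assumes "s < k * j + 2"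
  shows "obj_sum V k (T t) s = obj_sum V k (T j) s"
proof -
  have "(\<Sum>(W, F)\<in>objs V k s. obj_coeff V k F * (gain' F - gain F)) = 0"
    using gain_le(2) assms by (intro sum.neutral) fastforce
  then show ?thesis using obj_sum_diff [of s] by simp
qed

lemma obj_sum_less:
  assumes "(W, F) \<in> objs V k (k * j + 2)" "gain F < gain' F"
  shows "obj_sum V k (T j) (k * j + 2) < obj_sum V k (T t) (k * j + 2)"
proof -
  have "0 < (\<Sum>(W, F)\<in>objs V k (k * j + 2). obj_coeff V k F * (gain' F - gain F))"
  proof (rule sum_pos2 [OF finite_objs assms(1)])
    fix a assume a: "a \<in> objs V k (k * j + 2)"
    obtain W F where WF: "a = (W, F)" by (cases a)
    then have "gain F \<le> gain' F" using gain_le(1) a by blast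
    then show "0 \<le> (case a of (W, F) \<Rightarrow> obj_coeff V k F * (gain' F - gain F))"
      using less_imp_le [OF obj_coeff_pos [of V k F]] by (simp add: WF)
  qed (use assms(2) obj_coeff_pos [of V k F] in auto)
  then show ?thesis using obj_sum_diff [of "k * j + 2"] by simp
qed

end


section \<open>A bundled closed walk detecting the short leg\<close>

definition eulerian :: "('a \<times> 'a) multiset \<Rightarrow> 'a set \<Rightarrow> bool" where
  "eulerian M S \<longleftrightarrow> (\<exists>W. W \<noteq> [] \<and> hd W = last W \<and> arcs W = M \<and> set W = S)"

lemma arcs_join: "arcs (A @ x # B) = arcs (A @ [x]) + arcs (x # B)"
proof (induction A)
  case Nil
  then show ?case by (simp add: arcs_def)
next
  case (Cons a A)
  moreover have "arcs [x] = {#}" by (simp add: arcs_def)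
  ultimately show ?case by (cases A) (simp_all add: arcs_Cons2)
qed

text \<open>Rotation: a closed walk can be started at any vertex that it visits.\<close>

lemma eulerian_from:
  assumes "eulerian M S" "x \<in> S"
  obtains C where "arcs (C @ [x]) = M" "set (C @ [x]) = S" "hd (C @ [x]) = x"
proof -
  obtain W where W: "hd W = last W" "arcs W = M" "set W = S" using assms(1) by (auto simp: eulerian_def)
  obtain A B where AB: "W = A @ x # B" using assms(2) W(3) by (meson split_list)
  show ?thesis
  proof (cases A)
    case Nil
    then have "x # B = butlast (x # B) @ [x]" using W(1) AB append_butlast_last_id [of "x # B"] by simp
    moreover have "W = x # B" using Nil AB by simp
    ultimately show ?thesis using that [of "butlast (x # B)"] W by (metis list.sel(1))
  next
    case (Cons h A')
    define C where "C = butlast (x # B)"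
    have C: "x # B = C @ [h]"
      using W(1) AB Cons append_butlast_last_id [of "x # B"] by (simp add: C_def)
    show ?thesis
    proof (rule that [of "C @ h # A'"])
      have "arcs ((C @ h # A') @ [x]) = arcs (C @ [h]) + arcs ((h # A') @ [x])"
        using arcs_join [of C h "A' @ [x]"] by simp
      then show "arcs ((C @ h # A') @ [x]) = M"
        using W(2) arcs_join [of A x B] unfolding AB by (simp add: Cons flip: C)
      have "set W = insert h (set A') \<union> set (x # B)" unfolding AB Cons by auto
      moreover have "set (x # B) = insert h (set C)" unfolding C by simp
      moreover have "x \<in> set (x # B)" by simp
      ultimately have "S = insert h (set A') \<union> insert h (set C)" "x \<in> insert h (set C)"
        using W(3) by (simp_all only:)
      then show "set ((C @ h # A') @ [x]) = S" by auto
      show "hd ((C @ h # A') @ [x]) = x" using C by (cases C) auto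
    qed
  qed
qed

lemma eulerian_union:
  assumes "eulerian M S" "eulerian N R" "x \<in> S" "x \<in> R"
  shows "eulerian (M + N) (S \<union> R)"
proof -
  obtain C where C: "arcs (C @ [x]) = M" "set (C @ [x]) = S" "hd (C @ [x]) = x"
    using eulerian_from [OF assms(1,3)] .
  obtain D where D: "arcs (D @ [x]) = N" "set (D @ [x]) = R" "hd (D @ [x]) = x"
    using eulerian_from [OF assms(2,4)] .
  obtain E where E: "D @ [x] = x # E" using D(3) by (cases D) auto
  have "last (x # E) = x" using E by (metis last_snoc)
  moreover have "hd (C @ x # E) = x" using C(3) by (cases C) auto
  moreover have "arcs (C @ x # E) = M + N" using arcs_join [of C x E] C(1) D(1) E by simp
  moreover have "set (C @ x # E) = S \<union> R" using C(2) D(2) E by auto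
  ultimately show ?thesis
    unfolding eulerian_def by (intro exI [of _ "C @ x # E"]) auto
qed

lemma eulerian_loops: "eulerian (replicate_mset q (x, x)) {x}"
  unfolding eulerian_def
  by (intro exI [of _ "replicate (Suc q) x"])
    (auto simp: arcs_replicate last_replicate set_replicate_Suc simp del: replicate_Suc)

lemma eulerian_star:
  assumes "finite A"
  shows "eulerian (\<Sum>x\<in>A. {#(x, v), (v, x)#}) (insert v A)"
  using assms
proof (induction A rule: finite_induct)
  case empty
  then show ?case using eulerian_loops [of 0 v] by simp
next
  case (insert x A)
  have "eulerian {#(x, v), (v, x)#} {v, x}"
    unfolding eulerian_def by (intro exI [of _ "[v, x, v]"]) (auto simp: arcs_def)
  from eulerian_union [OF this insert.IH, of v] insert.hyps show ?case by (simp add: insert_commute)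
qed

text \<open>The complete digraph on \<open>e\<close>: the arcs that arise if every vertex of
  \<open>e\<close> is the source of exactly one bundle whose targets are the other vertices of
  \<open>e\<close>.\<close>

definition complete_arcs :: "'a set \<Rightarrow> ('a \<times> 'a) multiset" where
  "complete_arcs e = (\<Sum>i\<in>e. image_mset (Pair i) (mset_set (e - {i})))"

lemma image_mset_set_sum: "finite A \<Longrightarrow> image_mset f (mset_set A) = (\<Sum>x\<in>A. {#f x#})"
  by (induction A rule: finite_induct) auto

text \<open>A new vertex adds a 2-cycle with each old one. These form a star, which is joined to the
  old walk at any old vertex.\<close>

lemma eulerian_complete:
  assumes "finite e" "e \<noteq> {}"
  shows "eulerian (complete_arcs e) e"
  using assms
proof (induction e rule: finite_ne_induct)
  case (singleton x)
  then show ?case using eulerian_loops [of 0 x] by (simp add: complete_arcs_def)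
next
  case (insert v e)
  have "image_mset (Pair i) (mset_set (insert v e - {i})) =
      {#(i, v)#} + image_mset (Pair i) (mset_set (e - {i}))" if "i \<in> e" for i
  proof -
    have "insert v e - {i} = insert v (e - {i})" using insert.hyps that by auto
    then show ?thesis using insert.hyps by simp
  qed
  then have "complete_arcs (insert v e) = (\<Sum>x\<in>e. {#(v, x)#}) +
      (\<Sum>i\<in>e. {#(i, v)#} + image_mset (Pair i) (mset_set (e - {i})))"
    using insert.hyps by (simp add: complete_arcs_def image_mset_set_sum)
  also have "\<dots> = complete_arcs e + (\<Sum>x\<in>e. {#(x, v)#} + {#(v, x)#})"
    by (simp only: complete_arcs_def sum.distrib add_ac)
  finally have eq: "complete_arcs (insert v e) = complete_arcs e + (\<Sum>x\<in>e. {#(x, v), (v, x)#})"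
    by (simp add: add_mset_commute)
  obtain x where "x \<in> e" using insert.hyps by blast
  then show ?case
    using eulerian_union [OF insert.IH eulerian_star [OF insert.hyps(1), of v], of x]
    by (simp add: eq Un_absorb1 subset_insertI)
qed

lemma row_weight_strict_mono:
  assumes "\<And>\<gamma>. \<gamma> \<in> set \<Gamma> \<Longrightarrow> 0 < T (i # \<gamma>)" "\<And>is. T is \<le> T' is"
  shows "0 < row_weight T i \<Gamma>" "row_weight T i \<Gamma> \<le> row_weight T' i \<Gamma>"
    and "\<exists>\<gamma>\<in>set \<Gamma>. T (i # \<gamma>) < T' (i # \<gamma>) \<Longrightarrow> row_weight T i \<Gamma> < row_weight T' i \<Gamma>"
proof -
  have "0 < row_weight T i \<Gamma> \<and> row_weight T i \<Gamma> \<le> row_weight T' i \<Gamma> \<and>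
    ((\<exists>\<gamma>\<in>set \<Gamma>. T (i # \<gamma>) < T' (i # \<gamma>)) \<longrightarrow> row_weight T i \<Gamma> < row_weight T' i \<Gamma>)"
    using assms(1)
  proof (induction \<Gamma>)
    case Nil
    then show ?case by (simp add: row_weight_def)
  next
    case (Cons \<gamma> \<Gamma>)
    have Cons_eq: "row_weight T i (\<gamma> # \<Gamma>) = T (i # \<gamma>) * row_weight T i \<Gamma>" for T :: "'a tensor"
      by (simp add: row_weight_def)
    have pos: "0 < T (i # \<gamma>)" and le: "T (i # \<gamma>) \<le> T' (i # \<gamma>)" using Cons.prems assms(2) by auto
    have IH: "0 < row_weight T i \<Gamma>" "row_weight T i \<Gamma> \<le> row_weight T' i \<Gamma>"
      "(\<exists>\<gamma>\<in>set \<Gamma>. T (i # \<gamma>) < T' (i # \<gamma>)) \<longrightarrow> row_weight T i \<Gamma> < row_weight T' i \<Gamma>"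
      using Cons by auto
    have "T (i # \<gamma>) * row_weight T i \<Gamma> < T' (i # \<gamma>) * row_weight T' i \<Gamma>"
      if "\<exists>\<gamma>\<in>set (\<gamma> # \<Gamma>). T (i # \<gamma>) < T' (i # \<gamma>)"
    proof (cases "T (i # \<gamma>) < T' (i # \<gamma>)")
      case True
      then show ?thesis using pos IH(1,2) by (intro mult_less_le_imp_less) auto
    next
      case False
      then have "row_weight T i \<Gamma> < row_weight T' i \<Gamma>" using that IH(3) by auto
      then show ?thesis using pos le IH(1) by (intro mult_le_less_imp_less) auto
    qed
    moreover have "T (i # \<gamma>) * row_weight T i \<Gamma> \<le> T' (i # \<gamma>) * row_weight T' i \<Gamma>"
      using pos le IH(1,2) by (intro mult_mono) auto
    ultimately show ?case using pos IH(1) by (simp only: Cons_eq) simp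
  qed
  then show "0 < row_weight T i \<Gamma>" "row_weight T i \<Gamma> \<le> row_weight T' i \<Gamma>"
    "\<exists>\<gamma>\<in>set \<Gamma>. T (i # \<gamma>) < T' (i # \<gamma>) \<Longrightarrow> row_weight T i \<Gamma> < row_weight T' i \<Gamma>" by auto
qed

lemma obj_weight_strict_mono:
  assumes "finite V" "\<And>i \<gamma>. i \<in> V \<Longrightarrow> \<gamma> \<in> set (F i) \<Longrightarrow> 0 < T (i # \<gamma>)" "\<And>is. T is \<le> T' is"
    and "i \<in> V" "\<gamma> \<in> set (F i)" "T (i # \<gamma>) < T' (i # \<gamma>)"
  shows "obj_weight V T F < obj_weight V T' F"
proof -
  have row: "0 < row_weight T v (F v)" "row_weight T v (F v) \<le> row_weight T' v (F v)" if "v \<in> V" for v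
    using row_weight_strict_mono(1,2) [of "F v" T v T'] assms(2,3) that by auto
  have "row_weight T i (F i) < row_weight T' i (F i)"
    using row_weight_strict_mono(3) [of "F i" T i T'] assms(2-6) by blast
  moreover have "0 < (\<Prod>v\<in>V - {i}. row_weight T v (F v))" using row by (intro prod_pos) auto
  moreover have "(\<Prod>v\<in>V - {i}. row_weight T v (F v)) \<le> (\<Prod>v\<in>V - {i}. row_weight T' v (F v))"
    using row by (intro prod_mono) (auto intro: less_imp_le)
  ultimately have "row_weight T i (F i) * (\<Prod>v\<in>V - {i}. row_weight T v (F v)) <
      row_weight T' i (F i) * (\<Prod>v\<in>V - {i}. row_weight T' v (F v))"
    using row(1) [OF assms(4)] by (intro mult_less_le_imp_less) auto
  then show ?thesis unfolding obj_weight_def using assms(1,4) by (simp add: prod.remove)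
qed

text \<open>Any order will do, since neither the arcs of a bundle nor the adjacency entry depends on
  it.\<close>

definition enum :: "'a set \<Rightarrow> 'a list" where
  "enum X = (SOME xs. mset xs = mset_set X)"

lemma enum: "mset (enum X) = mset_set X"
  unfolding enum_def using ex_mset [of "mset_set X"] by (rule someI_ex)

lemma set_enum: "finite X \<Longrightarrow> set (enum X) = X"
  using enum [of X] by (metis finite_set_mset_mset_set set_mset_mset)

lemma length_enum: "length (enum X) = card X"
  using enum [of X] by (metis size_mset size_mset_set)

lemma row_arcs_append: "row_arcs v (xs @ ys) = row_arcs v xs + row_arcs v ys"
  by (simp add: row_arcs_def)

lemma row_arcs_filter_upt:
  "row_arcs v (map f (filter P [0..<n])) =
    (\<Sum>a<n. if P a then image_mset (Pair v) (mset (f a)) else {#})"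
  by (induction n) (simp_all add: row_arcs_def)

lemma length_filter_upt: "length (filter P [0..<n]) = (\<Sum>a<n. if P a then 1 else 0)"
  by (induction n) simp_all

lemma size_arcs: "size (arcs W) = length W - 1"
  by (simp add: arcs_def)

context broom_shift
begin

text \<open>The object realising the first difference: every edge of the short leg is used once from each
  of its vertices, and there is one loop bundle at each end of the leg.\<close>

definition leg_rows :: "broom_vertex \<Rightarrow> broom_vertex list list" where
  "leg_rows = (\<lambda>v\<in>V. map (\<lambda>a. enum (axis_edge k a - {v})) (filter (\<lambda>a. v \<in> axis_edge k a) [0..<j]) @
     (if v = Axis 0 \<or> v = Axis j then [replicate (k - 1) v] else []))"

definition leg_arcs :: "(broom_vertex \<times> broom_vertex) multiset" where
  "leg_arcs = (\<Sum>a<j. complete_arcs (axis_edge k a)) + (replicate_mset (k - 1) (Axis 0, Axis 0) +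
     replicate_mset (k - 1) (Axis j, Axis j))"

lemma finite_axis_edge: "finite (axis_edge k a)"
  by (simp add: axis_edge_def)

lemma jd: "j < d"
  using j t by simp

lemma leg_vertices: "(\<Union>a<j. axis_edge k a) \<subseteq> ball"
  using j jd by (auto simp: axis_edge_def)

lemma eulerian_leg: "eulerian leg_arcs (\<Union>a<j. axis_edge k a)"
proof -
  \<comment> \<open>\<open>Axis 0\<close> is inserted so that the statement also makes sense for
    \<open>n = 0\<close>, where the walk is that single vertex.\<close>
  have leg: "eulerian (\<Sum>a<n. complete_arcs (axis_edge k a)) (insert (Axis 0) (\<Union>a<n. axis_edge k a))" for n
  proof (induction n)
    case 0
    then show ?case using eulerian_loops [of 0 "Axis 0"] by simp
  next
    case (Suc n)
    have "Axis n \<in> insert (Axis 0) (\<Union>a<n. axis_edge k a)" by (cases n) auto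
    moreover have "eulerian (complete_arcs (axis_edge k n)) (axis_edge k n)"
      by (intro eulerian_complete finite_axis_edge) (auto simp: axis_edge_def)
    ultimately show ?case
      using eulerian_union [OF Suc.IH, of _ "axis_edge k n" "Axis n"] by (simp add: lessThan_Suc Un_commute add.commute)
  qed
  have ends: "Axis 0 \<in> (\<Union>a<j. axis_edge k a)" "Axis j \<in> (\<Union>a<j. axis_edge k a)"
    using j by (auto intro!: bexI [of _ "0"] bexI [of _ "j - 1"])
  have "eulerian (\<Sum>a<j. complete_arcs (axis_edge k a)) (\<Union>a<j. axis_edge k a)"
    using leg [of j] ends(1) by (simp add: insert_absorb)
  from eulerian_union [OF this eulerian_loops ends(1) singletonI, of "k - 1"]
  have "eulerian ((\<Sum>a<j. complete_arcs (axis_edge k a)) + replicate_mset (k - 1) (Axis 0, Axis 0))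
      (\<Union>a<j. axis_edge k a)"
    using ends by (simp add: insert_absorb)
  from eulerian_union [OF this eulerian_loops ends(2) singletonI, of "k - 1"]
  show ?thesis using ends by (simp add: leg_arcs_def insert_absorb add.assoc)
qed

lemma sum_axis_edge:
  fixes f :: "broom_vertex \<Rightarrow> 'b :: comm_monoid_add"
  assumes "a < j"
  shows "(\<Sum>v\<in>V. if v \<in> axis_edge k a then f v else 0) = (\<Sum>v\<in>axis_edge k a. f v)"
proof -
  have "axis_edge k a \<subseteq> V" using assms jd axis_edge_subset by simp
  then have "V \<inter> axis_edge k a = axis_edge k a" by blast
  then show ?thesis using sum.inter_restrict [OF finite_broom_verts, of f k d p "axis_edge k a"] by simp
qed

lemma sum_ends:
  fixes f :: "broom_vertex \<Rightarrow> 'b :: comm_monoid_add"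
  shows "(\<Sum>v\<in>V. if v = Axis 0 \<or> v = Axis j then f v else 0) = f (Axis 0) + f (Axis j)"
proof -
  have "V \<inter> {Axis 0, Axis j} = {Axis 0, Axis j}" using jd by auto
  then show ?thesis
    using sum.inter_restrict [OF finite_broom_verts, of f k d p "{Axis 0, Axis j}"] j by simp
qed

text \<open>Exchanging the sums over vertices and edges regroups the arcs from rows into complete
  digraphs, one for each edge of the leg.\<close>

lemma row_arcs_leg: "(\<Sum>v\<in>V. row_arcs v (leg_rows v)) = leg_arcs"
proof -
  have "row_arcs v (leg_rows v) =
      (\<Sum>a<j. if v \<in> axis_edge k a then image_mset (Pair v) (mset_set (axis_edge k a - {v})) else 0) +
      (if v = Axis 0 \<or> v = Axis j then replicate_mset (k - 1) (v, v) else 0)" if "v \<in> V" for v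
    using that by (simp add: leg_rows_def row_arcs_append row_arcs_filter_upt enum cong: if_cong)
      (simp add: row_arcs_def)
  then have "(\<Sum>v\<in>V. row_arcs v (leg_rows v)) =
      (\<Sum>v\<in>V. \<Sum>a<j. if v \<in> axis_edge k a then image_mset (Pair v) (mset_set (axis_edge k a - {v})) else 0) +
      (\<Sum>v\<in>V. if v = Axis 0 \<or> v = Axis j then replicate_mset (k - 1) (v, v) else 0)"
    by (simp only: sum.distrib cong: sum.cong)
  also have "\<dots> = leg_arcs"
    unfolding sum_ends leg_arcs_def
    by (subst sum.swap) (simp add: sum_axis_edge complete_arcs_def)
  finally show ?thesis .
qed

lemma length_leg: "(\<Sum>v\<in>V. length (leg_rows v)) = k * j + 2"
proof -
  have "length (leg_rows v) = (\<Sum>a<j. if v \<in> axis_edge k a then 1 else 0) +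
      (if v = Axis 0 \<or> v = Axis j then 1 else 0)" if "v \<in> V" for v
    using that by (simp add: leg_rows_def length_filter_upt)
  then have "(\<Sum>v\<in>V. length (leg_rows v)) =
      (\<Sum>v\<in>V. \<Sum>a<j. if v \<in> axis_edge k a then 1 else 0) +
      (\<Sum>v\<in>V. if v = Axis 0 \<or> v = Axis j then 1 else 0)"
    by (simp only: sum.distrib cong: sum.cong)
  also have "\<dots> = k * j + 2"
    unfolding sum_ends
    by (subst sum.swap) (simp add: sum_axis_edge card_axis_edge [OF k] del: sum.If_cases)
  finally show ?thesis .
qed

lemma leg_rows_cases:
  assumes "v \<in> V" "\<gamma> \<in> set (leg_rows v)"
  obtains (edge) a where "a < j" "v \<in> axis_edge k a" "\<gamma> = enum (axis_edge k a - {v})" "set (v # \<gamma>) = axis_edge k a"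
  | (loop) "v = Axis 0 \<or> v = Axis j" "\<gamma> = replicate (k - 1) v" "v # \<gamma> = replicate k v"
proof -
  consider a where "a < j" "v \<in> axis_edge k a" "\<gamma> = enum (axis_edge k a - {v})"
    | "v = Axis 0 \<or> v = Axis j" "\<gamma> = replicate (k - 1) v"
    using assms by (auto simp: leg_rows_def split: if_splits)
  then show ?thesis
  proof cases
    case 1
    then have "set (v # \<gamma>) = axis_edge k a" using finite_axis_edge by (auto simp: set_enum)
    with 1 show ?thesis by (rule edge)
  next
    case 2
    moreover have "v # replicate (k - 1) v = replicate k v" using k by (cases k) auto
    ultimately show ?thesis by (intro loop) auto
  qed
qed

lemma leg_tails:
  assumes "v \<in> V" "\<gamma> \<in> set (leg_rows v)"
  shows "\<gamma> \<in> tails V k"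
  using assms
proof (cases rule: leg_rows_cases)
  case (edge a)
  have "axis_edge k a \<subseteq> V" using edge(1) jd axis_edge_subset by simp
  moreover have "length \<gamma> = k - 1"
    using edge(2,3) card_axis_edge [OF k] by (simp add: length_enum)
  ultimately show ?thesis using edge(4) by (auto simp: tails_def)
next
  case loop
  then show ?thesis using assms(1) by (auto simp: tails_def)
qed

lemma leg_obj:
  obtains W where "(W, leg_rows) \<in> objs V k (k * j + 2)" "set W \<subseteq> ball"
proof -
  obtain W where W: "W \<noteq> []" "hd W = last W" "arcs W = leg_arcs" "set W = (\<Union>a<j. axis_edge k a)"
    using eulerian_leg by (auto simp: eulerian_def)
  have concat: "length (concat (leg_rows v)) = length (leg_rows v) * (k - 1)" if "v \<in> V" for v
  proof -
    have "\<forall>\<gamma>\<in>set (leg_rows v). length \<gamma> = k - 1" using leg_tails [OF that] by (auto simp: tails_def)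
    then have "map length (leg_rows v) = replicate (length (leg_rows v)) (k - 1)"
      by (simp add: map_replicate_const [symmetric])
    then show ?thesis by (simp add: length_concat sum_list_replicate)
  qed
  have "size (arcs W) = (\<Sum>v\<in>V. length (leg_rows v) * (k - 1))"
    unfolding W(3) row_arcs_leg [symmetric] using concat by (simp add: size_multiset_sum row_arcs_def)
  also have "\<dots> = (k * j + 2) * (k - 1)" by (simp only: length_leg flip: sum_distrib_right)
  finally have "length W = Suc ((k * j + 2) * (k - 1))" using W(1) by (cases W) (simp_all add: size_arcs)
  then have "W \<in> closed_walks V ((k * j + 2) * (k - 1))"
    using W leg_vertices by (auto simp: closed_walks_def)
  moreover have "leg_rows \<in> PiE V (\<lambda>_. {\<Gamma>. set \<Gamma> \<subseteq> tails V k})"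
  proof (rule PiE_I)
    show "leg_rows v \<in> {\<Gamma>. set \<Gamma> \<subseteq> tails V k}" if "v \<in> V" for v using leg_tails [OF that] by blast
    show "leg_rows v = undefined" if "v \<notin> V" for v using that unfolding leg_rows_def by simp
  qed
  ultimately have "(W, leg_rows) \<in> objs V k (k * j + 2)"
    unfolding objs_def using W(3) length_leg row_arcs_leg by simp
  then show ?thesis using that W(4) leg_vertices by blast
qed

text \<open>The edge entries are positive by \<alpha> < 1, the two loops by \<alpha> > 0 and the
  positive degree of their vertices in the bare path.\<close>

lemma T0_leg_pos:
  assumes "v \<in> V" "\<gamma> \<in> set (leg_rows v)"
  shows "0 < T0 (v # \<gamma>)"
  using assms
proof (cases rule: leg_rows_cases)
  case (edge a)
  then have "set (v # \<gamma>) \<in> edges (spine k d p)" using jd by (auto simp: edges_spine)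
  then have "adj_tensor k (spine k d p) (v # \<gamma>) > 0" by (simp add: adj_tensor_def)
  moreover have "degree_tensor k (spine k d p) (v # \<gamma>) \<ge> 0" by (simp add: degree_tensor_def)
  ultimately show ?thesis using \<alpha> by (simp add: A_tensor_def add_nonneg_pos)
next
  case loop
  have "degree (spine k d p) v > 0"
    using loop(1) j jd by (auto simp: degree_spine axis_degree_0 axis_degree_inner)
  then show ?thesis
    unfolding loop(3) A_tensor_loop [OF hypergraph_on_spine [OF k] k] using \<alpha> by simp
qed

lemma loop_in_leg: "v = Axis 0 \<or> v = Axis j \<Longrightarrow> v \<in> V \<and> replicate (k - 1) v \<in> set (leg_rows v)"
  using jd by (auto simp: leg_rows_def)

text \<open>Strict because of the loop at \<open>Axis j\<close>, whose degree is
  \<open>p + 2\<close> in the broom but 2 in the bare path.\<close>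

lemma leg_gain:
  assumes "p > 0"
  shows "gain leg_rows > 0"
proof -
  have V: "Axis j \<in> V" "replicate (k - 1) (Axis j) \<in> set (leg_rows (Axis j))"
    using loop_in_leg by blast+
  have rep: "Axis j # replicate (k - 1) (Axis j) = replicate k (Axis j)" using k by (cases k) auto
  have "T0 (Axis j # replicate (k - 1) (Axis j)) < T j (Axis j # replicate (k - 1) (Axis j))"
    unfolding rep A_tensor_loop [OF hypergraph_on_spine [OF k] k]
      A_tensor_loop [OF hypergraph_on_broom [OF k less_imp_le [OF jd]] k] degree_broom [OF k]
    using \<alpha> assms by simp
  from obj_weight_strict_mono [of V leg_rows T0 "T j", OF finite_broom_verts T0_leg_pos
      A_tensor_spine_le_broom(2) [OF k \<alpha>'] V this]
  show ?thesis by (simp add: gain_def)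
qed

lemma leg_boost: "obj_weight V boost leg_rows > 1"
proof -
  have V: "Axis 0 \<in> V" "replicate (k - 1) (Axis 0) \<in> set (leg_rows (Axis 0))"
    using loop_in_leg by blast+
  have "Axis 0 # replicate (k - 1) (Axis 0) = replicate k (Axis 0)" using k by (cases k) auto
  then have "(1::real) < boost (Axis 0 # replicate (k - 1) (Axis 0))" by (simp add: boost_def)
  from obj_weight_strict_mono [of V leg_rows "\<lambda>_. 1" boost, OF finite_broom_verts _ boost_ge_1 V this]
  show ?thesis by (simp add: obj_weight_1)
qed

theorem obj_sum_broom_less:
  assumes "p > 0"
  shows "obj_sum V k (T j) (k * j + 2) < obj_sum V k (T t) (k * j + 2)"
proof -
  obtain W where W: "(W, leg_rows) \<in> objs V k (k * j + 2)" "set W \<subseteq> ball" by (rule leg_obj)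
  have "gain' leg_rows = obj_weight V boost leg_rows * gain leg_rows"
    using gain'_inside [OF W(1)] W(2) by blast
  then have "gain leg_rows < gain' leg_rows" using leg_gain [OF assms] leg_boost by simp
  then show ?thesis by (rule obj_sum_less [OF W(1)])
qed

end


section \<open>Isomorphisms onto brooms\<close>

lemma isomorphicE:
  assumes "isomorphic G H" "\<forall>e\<in>edges G. e \<subseteq> verts G"
  obtains f g where "bij_betw f (verts G) (verts H)" "edges H = (`) f ` edges G"
    "bij_betw g (verts H) (verts G)" "edges G = (`) g ` edges H" "\<And>v. v \<in> verts G \<Longrightarrow> g (f v) = v"
proof -
  obtain f where f: "bij_betw f (verts G) (verts H)" "edges H = (`) f ` edges G"
    using assms(1) by (auto simp: isomorphic_def)
  define g where "g = the_inv_into (verts G) f"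
  have gf: "g (f v) = v" if "v \<in> verts G" for v
    using f(1) that by (simp add: g_def bij_betw_def the_inv_into_f_f)
  have "g ` f ` e = e" if "e \<in> edges G" for e
    using assms(2) that gf by (force simp: image_image)
  then have "edges G = (`) g ` edges H" unfolding f(2) by (force simp: image_image)
  moreover have "bij_betw g (verts H) (verts G)"
    unfolding g_def by (rule bij_betw_the_inv_into [OF f(1)])
  ultimately show ?thesis using that f gf by blast
qed

lemma isomorphic_sym:
  assumes "isomorphic G H" "\<forall>e\<in>edges G. e \<subseteq> verts G"
  shows "isomorphic H G"
  by (rule isomorphicE [OF assms]) (auto simp: isomorphic_def)

lemma isomorphic_trans:
  assumes "isomorphic G H" "isomorphic H K"
  shows "isomorphic G K"
proof -
  obtain f g where "bij_betw f (verts G) (verts H)" "edges H = (`) f ` edges G"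
    "bij_betw g (verts H) (verts K)" "edges K = (`) g ` edges H"
    using assms by (auto simp: isomorphic_def)
  then show ?thesis
    unfolding isomorphic_def
    by (intro exI [of _ "g \<circ> f"]) (auto simp: bij_betw_trans image_comp)
qed

lemma isomorphicI_edges:
  assumes "inj_on f (verts G)" "verts G = \<Union>(edges G)" "verts H = \<Union>(edges H)" "edges H = (`) f ` edges G"
  shows "isomorphic G H"
proof -
  have "f ` verts G = verts H" unfolding assms(2-4) by auto
  then show ?thesis using assms(1,4) by (auto simp: isomorphic_def bij_betw_def)
qed

lemma is_path_image:
  assumes f: "bij_betw f (verts G) (verts H)" "edges H = (`) f ` edges G"
    and uniform: "\<forall>e\<in>edges G. e \<subseteq> verts G" and p: "is_path G vs es"
  shows "is_path H (map f vs) (map ((`) f) es)"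
proof -
  have inj: "inj_on f (verts G)" and im: "f ` verts G = verts H" using f(1) by (auto simp: bij_betw_def)
  have "inj_on ((`) f) (edges G)" using inj uniform by (auto simp: inj_on_def inj_on_image_eq_iff)
  then have "inj_on ((`) f) (set es)" using p by (auto simp: is_path_def intro: inj_on_subset)
  moreover have "inj_on f (set vs)" using inj p by (auto simp: is_path_def intro: inj_on_subset)
  moreover have "f v \<in> verts H" if "v \<in> verts G" for v using im that by blast
  ultimately show ?thesis using p f(2) by (auto simp: is_path_def distinct_map)
qed

lemma is_cycle_image:
  assumes f: "bij_betw f (verts G) (verts H)" "edges H = (`) f ` edges G"
    and uniform: "\<forall>e\<in>edges G. e \<subseteq> verts G" and p: "is_cycle G vs es"
  shows "is_cycle H (map f vs) (map ((`) f) es)"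
proof -
  have inj: "inj_on f (verts G)" and im: "f ` verts G = verts H" using f(1) by (auto simp: bij_betw_def)
  have "inj_on ((`) f) (edges G)" using inj uniform by (auto simp: inj_on_def inj_on_image_eq_iff)
  then have "inj_on ((`) f) (set es)" using p by (auto simp: is_cycle_def intro: inj_on_subset)
  moreover have "inj_on f (set vs)" using inj p by (auto simp: is_cycle_def intro: inj_on_subset)
  moreover have "Suc i mod length es < length vs" if "i < length es" for i
  proof -
    have "Suc i mod length es < length es" using that by (intro mod_less_divisor) auto
    then show ?thesis using p by (simp add: is_cycle_def)
  qed
  moreover have "f v \<in> verts H" if "v \<in> verts G" for v using im that by blast
  ultimately show ?thesis using p f(2) by (auto simp: is_cycle_def distinct_map)
qed

lemma joins_image:
  assumes f: "bij_betw f (verts G) (verts H)" "edges H = (`) f ` edges G"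
    and uniform: "\<forall>e\<in>edges G. e \<subseteq> verts G" and p: "joins G u v q"
  shows "joins H (f u) (f v) q"
proof -
  obtain vs es where vs: "is_path G vs es" "hd vs = u" "last vs = v" "length es = q"
    using p by (auto simp: joins_def)
  then show ?thesis
    unfolding joins_def using is_path_image [OF f uniform vs(1)] path_ends(1) [OF vs(1)]
    by (intro exI [of _ "map f vs"] exI [of _ "map ((`) f) es"]) (auto simp: hd_map last_map)
qed

lemma hypertrees_isomorphic:
  assumes iso: "isomorphic G H" and G: "G \<in> hypertrees k m d"
  shows "H \<in> hypertrees k m d"
proof -
  have hyp: "hypergraph_on k G" and conn: "connected_hypergraph G" and acyc: "\<nexists>vs es. is_cycle G vs es"
    and m: "card (edges G) = m" and d: "diameter G = d"
    using G by (auto simp: hypertrees_def hypertree_def)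
  have uG: "\<forall>e\<in>edges G. e \<subseteq> verts G" using hyp by (simp add: hypergraph_on_def)
  obtain f g where f: "bij_betw f (verts G) (verts H)" "edges H = (`) f ` edges G"
    and g: "bij_betw g (verts H) (verts G)" "edges G = (`) g ` edges H"
    and gf: "\<And>v. v \<in> verts G \<Longrightarrow> g (f v) = v"
    by (rule isomorphicE [OF iso uG]) blast
  have inj: "inj_on f (verts G)" and im: "f ` verts G = verts H" using f(1) by (auto simp: bij_betw_def)
  have uH: "\<forall>e\<in>edges H. e \<subseteq> verts H" unfolding f(2) im [symmetric] using uG by blast
  have "card (f ` e) = k" if "e \<in> edges G" for e
  proof -
    have "inj_on f e" using inj uG that by (auto intro: inj_on_subset)
    then show ?thesis using that hyp by (simp add: card_image hypergraph_on_def)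
  qed
  moreover have "finite (verts H)" "verts H \<noteq> {}"
    unfolding im [symmetric] using hyp by (auto simp: hypergraph_on_def)
  ultimately have hypH: "hypergraph_on k H"
    using uH f(2) by (auto simp: hypergraph_on_def)
  have joins: "joins H (f u) (f v) q \<longleftrightarrow> joins G u v q" if "u \<in> verts G" "v \<in> verts G" for u v q
    using joins_image [OF f uG] joins_image [OF g uH, of "f u" "f v" q] gf that by auto
  have connH: "connected_hypergraph H"
  proof -
    have "\<exists>q. joins H (f u) (f v) q" if "u \<in> verts G" "v \<in> verts G" for u v
      using conn joins [OF that] that unfolding connected_hypergraph_def by blast
    then show ?thesis unfolding connected_hypergraph_def im [symmetric] by blast
  qed
  have acycH: "\<nexists>vs es. is_cycle H vs es" using is_cycle_image [OF g uH] acyc by blast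
  have "inj_on ((`) f) (edges G)" using inj uG by (auto simp: inj_on_def inj_on_image_eq_iff)
  then have mH: "card (edges H) = m" unfolding f(2) using m by (simp add: card_image)
  have hdist: "hdist H (f u) (f v) = hdist G u v" if "u \<in> verts G" "v \<in> verts G" for u v
    unfolding hdist_def joins [OF that] ..
  have "{hdist H u v | u v. u \<in> verts H \<and> v \<in> verts H} = {hdist G u v | u v. u \<in> verts G \<and> v \<in> verts G}"
  proof -
    have "{hdist H u v | u v. u \<in> verts H \<and> v \<in> verts H} =
        {hdist H (f u) (f v) | u v. u \<in> verts G \<and> v \<in> verts G}"
      unfolding im [symmetric] by blast
    also have "\<dots> = {hdist G u v | u v. u \<in> verts G \<and> v \<in> verts G}"
      using hdist by (intro Collect_cong ex_cong1) auto
    finally show ?thesis .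
  qed
  then have "diameter H = d" using d by (simp add: diameter_def)
  then show ?thesis using hypH connH acycH mH by (simp add: hypertrees_def hypertree_def)
qed

lemma broom_verts_Union: "c \<le> d \<Longrightarrow> 0 < d \<Longrightarrow> k \<ge> 2 \<Longrightarrow> broom_verts k d p = \<Union>(edges (broom k d p c))"
proof (intro equalityI subsetI)
  fix v assume *: "c \<le> d" "0 < d" "k \<ge> 2" "v \<in> broom_verts k d p"
  show "v \<in> \<Union>(edges (broom k d p c))"
  proof (cases v)
    case (Axis a)
    then have "v \<in> axis_edge k (if a < d then a else a - 1)" "(if a < d then a else a - 1) < d"
      using * by auto
    then show ?thesis unfolding edges_broom by blast
  next
    case (Link a i)
    then have "v \<in> axis_edge k a" "a < d" using * by auto
    then show ?thesis unfolding edges_broom by blast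
  next
    case (Leaf b i)
    then have "v \<in> leaf_edge k c b" "b < p" using * by auto
    then show ?thesis unfolding edges_broom by blast
  qed
next
  fix v assume "c \<le> d" "v \<in> \<Union>(edges (broom k d p c))"
  then show "v \<in> broom_verts k d p"
    unfolding edges_broom using axis_edge_subset leaf_edge_subset by blast
qed

lemma lessThan_reverse_image: "(\<lambda>a. n - Suc a) ` {..<n} = {..<n}"
proof (intro equalityI subsetI)
  fix x assume "x \<in> {..<n}"
  then show "x \<in> (\<lambda>a. n - Suc a) ` {..<n}" by (intro image_eqI [of _ _ "n - Suc x"]) auto
qed auto

text \<open>Reflection of the axis, by which the branching position can be moved to the left
  half.\<close>

lemma broom_reverse:
  assumes "k \<ge> 2" "c \<le> d" "0 < d"
  shows "isomorphic (broom k d p c) (broom k d p (d - c))"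
proof -
  define f where "f v = (case v of Axis a \<Rightarrow> Axis (d - a) | Link a i \<Rightarrow> Link (d - Suc a) i | Leaf b i \<Rightarrow> Leaf b i)" for v
  have axis: "f ` axis_edge k a = axis_edge k (d - Suc a)" if "a < d" for a
    using that by (auto simp: axis_edge_def f_def image_Un image_image)
  have leaf: "f ` leaf_edge k c b = leaf_edge k (d - c) b" for b
    by (auto simp: leaf_edge_def f_def image_image)
  show ?thesis
  proof (rule isomorphicI_edges)
    show "inj_on f (verts (broom k d p c))"
      by (rule inj_onI) (auto simp: f_def split: broom_vertex.splits)
    have "(`) f ` axis_edge k ` {..<d} = axis_edge k ` (\<lambda>a. d - Suc a) ` {..<d}"
      unfolding image_image using axis by (intro image_cong) auto
    then show "edges (broom k d p (d - c)) = (`) f ` edges (broom k d p c)"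
      unfolding edges_broom image_Un by (simp add: image_image leaf lessThan_reverse_image)
  qed (use assms broom_verts_Union [of c d k p] broom_verts_Union [of "d - c" d k p] in simp_all)
qed

section \<open>Starlike hypertrees as brooms\<close>

lemma verts_hyperpath: "0 < r \<Longrightarrow> verts (hyperpath k r) = \<Union>(edges (hyperpath k r))"
proof -
  assume r: "0 < r"
  have "Joint j \<in> \<Union>(hyperpath_edge k ` {..<r})" if "j \<le> r" for j
  proof -
    have "Joint j \<in> hyperpath_edge k (if j < r then j else j - 1)" "(if j < r then j else j - 1) < r"
      using that r by (auto simp: hyperpath_edge_def)
    then show ?thesis by blast
  qed
  then show ?thesis by (auto simp: hyperpath_def) (auto simp: hyperpath_edge_def)
qed

lemma verts_starlike:
  assumes "\<forall>b<length ns. 0 < ns ! b"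
  shows "verts (starlike k ns) = \<Union>(edges (starlike k ns))"
proof -
  have "glue b ` verts (hyperpath k (ns ! b)) = \<Union>((`) (glue b) ` edges (hyperpath k (ns ! b)))"
    if "b < length ns" for b
    using verts_hyperpath [of "ns ! b" k] assms that by auto
  then show ?thesis by (auto simp: starlike_def)
qed

text \<open>Branch 0 is the axis from joint \<open>t\<close> back to \<open>Axis 0\<close>, branch 1
  the rest of the axis, and pendant edge \<open>b\<close> is branch \<open>b + 2\<close>. Of its
  \<open>k - 1\<close> leaves the first becomes the end \<open>Joint 1\<close>, the others the
  inserted vertices.\<close>

definition starlike_label :: "nat \<Rightarrow> broom_vertex \<Rightarrow> nat \<times> path_vertex" where
  "starlike_label t v = (case v of
     Axis a \<Rightarrow> if a \<le> t then (0, Joint (t - a)) else (1, Joint (a - t))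
   | Link a i \<Rightarrow> if a < t then (0, Inner (t - Suc a) i) else (1, Inner (a - t) i)
   | Leaf b i \<Rightarrow> (b + 2, case i of 0 \<Rightarrow> Joint 1 | Suc l \<Rightarrow> Inner 0 l))"

lemma inj_starlike_label: "inj (starlike_label t)"
  by (rule injI) (auto simp: starlike_label_def split: broom_vertex.splits if_splits nat.splits)

lemma starlike_label_axis_edge:
  "a < t \<Longrightarrow> starlike_label t ` axis_edge k a = glue 0 ` hyperpath_edge k (t - Suc a)"
  "t \<le> a \<Longrightarrow> starlike_label t ` axis_edge k a = glue 1 ` hyperpath_edge k (a - t)"
  by (auto simp: starlike_label_def axis_edge_def hyperpath_edge_def glue_def image_Un image_image Suc_diff_Suc
      Suc_diff_le)

lemma starlike_label_leaf_edge:
  assumes "k \<ge> 2"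
  shows "starlike_label t ` leaf_edge k t b = glue (b + 2) ` hyperpath_edge k 0"
proof -
  have "{..<k - 1} = insert 0 (Suc ` {..<k - 2})"
  proof -
    have "k - 1 = Suc (k - 2)" using assms by simp
    then show ?thesis by (simp only: lessThan_Suc_eq_insert_0)
  qed
  then have "starlike_label t ` leaf_edge k t b =
      {(0, Joint 0), (b + 2, Joint 1)} \<union> (\<lambda>i. (b + 2, Inner 0 i)) ` {..<k - 2}"
    by (simp add: leaf_edge_def starlike_label_def image_image)
  moreover have "glue (b + 2) ` hyperpath_edge k 0 =
      {(0, Joint 0), (b + 2, Joint 1)} \<union> (\<lambda>i. (b + 2, Inner 0 i)) ` {..<k - 2}"
  proof -
    have "glue (b + 2) (Inner 0 i) = (b + 2, Inner 0 i)" for i by (simp add: glue_def)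
    moreover have "glue (b + 2) (Joint 0) = (0, Joint 0)" "glue (b + 2) (Joint (Suc 0)) = (b + 2, Joint 1)"
      by (simp_all add: glue_def)
    ultimately show ?thesis by (simp only: hyperpath_edge_def image_Un image_insert image_empty image_image)
  qed
  ultimately show ?thesis by simp
qed

lemma starlike_isomorphic_broom:
  assumes k: "k \<ge> 2" and t: "0 < t" "t < d"
  shows "isomorphic (broom k d p t) (starlike k ([t, d - t] @ replicate p 1))"
proof -
  let ?ns = "[t, d - t] @ replicate p 1" and ?f = "starlike_label t"
  have nth: "?ns ! (b + 2) = 1" if "b < p" for b using that by (simp add: nth_append)
  have len: "{..<length ?ns} = {0, 1} \<union> (\<lambda>b. b + 2) ` {..<p}"
  proof (intro equalityI subsetI)
    fix b assume "b \<in> {..<length ?ns}"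
    then have "b = 0 \<or> b = 1 \<or> b = (b - 2) + 2 \<and> b - 2 < p" by auto
    then show "b \<in> {0, 1} \<union> (\<lambda>b. b + 2) ` {..<p}" by blast
  qed auto
  let ?E = "\<lambda>b. (`) (glue b) ` edges (hyperpath k (?ns ! b))"
  have "edges (starlike k ?ns) = ?E 0 \<union> ?E 1 \<union> (\<Union>b<p. ?E (b + 2))"
    unfolding starlike_def hypergraph.simps len by auto
  moreover have "?E 0 = (`) ?f ` axis_edge k ` {..<t}"
  proof -
    have "(`) ?f ` axis_edge k ` {..<t} = (\<lambda>a. glue 0 ` hyperpath_edge k a) ` (\<lambda>a. t - Suc a) ` {..<t}"
      unfolding image_image using starlike_label_axis_edge(1) by (intro image_cong) auto
    then show ?thesis by (simp add: lessThan_reverse_image hyperpath_def image_image)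
  qed
  moreover have "?E 1 = (`) ?f ` axis_edge k ` {t..<d}"
  proof -
    have "(`) ?f ` axis_edge k ` {t..<d} = (\<lambda>a. glue 1 ` hyperpath_edge k a) ` (\<lambda>a. a - t) ` {t..<d}"
      unfolding image_image using starlike_label_axis_edge(2) by (intro image_cong) auto
    moreover have "(\<lambda>a. a - t) ` {t..<d} = {..<d - t}"
    proof (intro equalityI subsetI)
      fix x assume "x \<in> {..<d - t}"
      then show "x \<in> (\<lambda>a. a - t) ` {t..<d}" by (intro image_eqI [of _ _ "x + t"]) auto
    qed auto
    ultimately show ?thesis by (simp add: hyperpath_def image_image)
  qed
  moreover have "(\<Union>b<p. ?E (b + 2)) = (`) ?f ` leaf_edge k t ` {..<p}"
  proof -
    have "?E (b + 2) = {glue (b + 2) ` hyperpath_edge k 0}" if "b < p" for b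
      unfolding nth [OF that] by (simp add: hyperpath_def lessThan_Suc)
    then have "(\<Union>b<p. ?E (b + 2)) = (\<Union>b<p. {glue (b + 2) ` hyperpath_edge k 0})"
      by (intro SUP_cong) auto
    then show ?thesis using starlike_label_leaf_edge [OF k] by (auto simp: image_image)
  qed
  moreover have "{..<d} = {..<t} \<union> {t..<d}" using t(2) by auto
  ultimately have "edges (starlike k ?ns) = (`) ?f ` edges (broom k d p t)"
    unfolding edges_broom by (simp only: image_Un)
  moreover have "0 < ?ns ! b" if "b < length ?ns" for b
    using that t len nth by (auto simp: nth_append nth_Cons split: nat.splits)
  then have "verts (starlike k ?ns) = \<Union>(edges (starlike k ?ns))" by (intro verts_starlike) blast
  ultimately show ?thesis
    using broom_verts_Union [of t d k p] k t inj_on_subset [OF inj_starlike_label subset_UNIV]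
    by (intro isomorphicI_edges [of ?f]) (simp_all only: verts_broom less_imp_le)
qed

text \<open>The segment of the path from \<open>vs ! a\<close> to \<open>vs ! b\<close> would be
  closed to a cycle by \<open>e\<close>. In particular no path edge meets the path in a vertex
  beyond its own two.\<close>

lemma path_vertex_distant_edge:
  assumes H: "hypertree k H" and p: "is_path H vs es" and ab: "a < b" "b \<le> length es"
    and e: "e \<in> edges H" "e \<notin> (!) es ` {a..<b}" "vs ! a \<in> e" "vs ! b \<in> e"
  shows False
proof -
  let ?S = "(!) es ` {a..<b}"
  let ?K = "\<lparr>verts = \<Union>?S, edges = ?S\<rparr>"
  have in_edge: "vs ! i \<in> es ! i" "vs ! Suc i \<in> es ! i" if "i < length es" for i
    using p that by (auto simp: is_path_def)
  have "reach ?K (c - a) (vs ! a) (vs ! c)" if "a \<le> c" "c \<le> b" for c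
    using that
  proof (induction c rule: dec_induct)
    case base
    have "vs ! a \<in> \<Union>?S" using in_edge(1) [of a] ab by force
    then show ?case by (simp add: reach_refl)
  next
    case (step c)
    then have c: "c \<in> {a..<b}" "c < length es" using ab by auto
    then have "vs ! Suc c \<in> \<Union>?S" using in_edge(2) [of c] by blast
    moreover have "reach ?K (c - a) (vs ! a) (vs ! c)" using step by simp
    ultimately have "reach ?K (Suc (c - a)) (vs ! a) (vs ! Suc c)"
      using in_edge [OF c(2)] c(1) by (intro reach_step [where e = "es ! c"]) auto
    then show ?case using step by (simp add: Suc_diff_le)
  qed
  then have "reach ?K (b - a) (vs ! a) (vs ! b)" using ab by simp
  moreover have "?S \<subseteq> edges H" using p ab by (auto simp: is_path_def)
  ultimately have "vs ! a = vs ! b" using hypertree_edge_Int_connected [OF H _ e(1,2) _ e(3,4)] by blast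
  then show False using p ab by (auto simp: is_path_def nth_eq_iff_index_eq)
qed

text \<open>The prescribed degrees are used up by the edges of the path, except at
  \<open>vs ! j\<close>. There \<open>q\<close> further edges are due, which is the number of all
  edges off the path; so each of these contains \<open>vs ! j\<close>, and no other vertex of the
  path.\<close>

lemma broom_degrees_incidence:
  assumes H: "hypertree k H" and E: "card (edges H) = length es + q"
    and p: "is_path H vs es" and j: "1 \<le> j" "j < length es"
    and deg: "broom_degrees H vs q j" and a: "a \<le> length es" and e: "e \<in> edges H" "vs ! a \<in> e"
  shows "(a < length es \<and> e = es ! a) \<or> (1 \<le> a \<and> e = es ! (a - 1)) \<or> (a = j \<and> e \<notin> set es)"
    and "a = j \<Longrightarrow> e' \<in> edges H \<Longrightarrow> e' \<notin> set es \<Longrightarrow> vs ! a \<in> e'"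
proof -
  let ?d = "length es"
  have hyp: "hypergraph_on k H" using H by (simp add: hypertree_def)
  note finE = finite_edges [OF hyp]
  have len: "length vs = Suc ?d" "distinct vs" "distinct es" "set vs \<subseteq> verts H" "set es \<subseteq> edges H"
    and in_edge: "\<And>i. i < ?d \<Longrightarrow> vs ! i \<in> es ! i" "\<And>i. i < ?d \<Longrightarrow> vs ! Suc i \<in> es ! i"
    using p by (auto simp: is_path_def)
  have deg_eq: "degree H (vs ! b) = (if b = j then q + 2 else if 1 \<le> b \<and> b < ?d then 2 else 1)" if "b \<le> ?d" for b
  proof -
    have "vs ! b \<in> verts H" using that len by auto
    moreover have "vs ! b = vs ! j \<longleftrightarrow> b = j" using that len j by (simp add: nth_eq_iff_index_eq)
    moreover have "vs ! b \<in> inner_verts vs \<longleftrightarrow> 1 \<le> b \<and> b < ?d"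
      using that len by (auto simp: inner_verts_def nth_eq_iff_index_eq)
    ultimately show ?thesis using deg by (simp add: broom_degrees_def)
  qed
  let ?I = "\<lambda>b. {e \<in> edges H. vs ! b \<in> e}"
  have fin: "finite (?I b)" for b using finE by simp
  have at: "es ! (b - 1) \<in> ?I b" if "1 \<le> b" "b \<le> ?d" for b
    using in_edge(2) [of "b - 1"] len that by auto
  have at': "es ! b \<in> ?I b" if "b < ?d" for b using in_edge(1) [of b] len that by auto
  have two: "es ! (b - 1) \<noteq> es ! b" if "1 \<le> b" "b < ?d" for b
    using len that by (simp add: nth_eq_iff_index_eq)
  \<comment> \<open>A third path edge through \<open>vs ! j\<close> would close a cycle with the
    segment leading to it.\<close>
  have path_part: "?I j \<inter> set es = {es ! (j - 1), es ! j}"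
  proof (intro equalityI subsetI)
    fix e assume e: "e \<in> ?I j \<inter> set es"
    then obtain i where i: "i < ?d" "e = es ! i" by (auto simp: in_set_conv_nth)
    have "i = j - 1 \<or> i = j"
    proof (rule ccontr)
      assume "\<not> (i = j - 1 \<or> i = j)"
      then consider "j < i" | "Suc i < j" by linarith
      then show False
      proof cases
        case 1
        then show False
        proof (rule path_vertex_distant_edge [OF H p])
          show "e \<notin> (!) es ` {j..<i}" using i len by (auto simp: nth_eq_iff_index_eq)
        qed (use i e in_edge(1) [OF i(1)] len in auto)
      next
        case 2
        then show False
        proof (rule path_vertex_distant_edge [OF H p])
          show "e \<notin> (!) es ` {Suc i..<j}" using i len j by (auto simp: nth_eq_iff_index_eq)
        qed (use i e in_edge(2) [OF i(1)] len j in auto)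
      qed
    qed
    then show "e \<in> {es ! (j - 1), es ! j}" using i by auto
  qed (use at at' j in auto)
  have "card (?I j) = card (?I j \<inter> set es) + card (?I j - set es)"
    using fin card_Int_Diff by blast
  then have "card (?I j - set es) = q"
    using deg_eq [of j] j two [of j] unfolding path_part by (simp add: degree_def)
  moreover have "card (edges H - set es) = q"
    using E len finE by (simp add: card_Diff_subset distinct_card)
  moreover have "?I j - set es \<subseteq> edges H - set es" by auto
  ultimately have all: "?I j - set es = edges H - set es"
    using finE by (intro card_subset_eq) auto
  then show "a = j \<Longrightarrow> e' \<in> edges H \<Longrightarrow> e' \<notin> set es \<Longrightarrow> vs ! a \<in> e'" by blast
  have eI: "e \<in> ?I a" using e by simp
  consider "a = j" | "a \<noteq> j" "1 \<le> a" "a < ?d" | "a \<noteq> j" "a = 0" | "a \<noteq> j" "a = ?d" using a j by linarith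
  then show "(a < ?d \<and> e = es ! a) \<or> (1 \<le> a \<and> e = es ! (a - 1)) \<or> (a = j \<and> e \<notin> set es)"
  proof cases
    case 1
    then show ?thesis using eI path_part j by blast
  next
    case 2
    have "{es ! (a - 1), es ! a} = ?I a"
      using at [of a] at' [of a] 2 deg_eq [of a] two [of a] fin
      by (intro card_subset_eq) (auto simp: degree_def)
    then have "e \<in> {es ! (a - 1), es ! a}" using eI by blast
    then show ?thesis using 2 by auto
  next
    case 3
    have "es \<noteq> []" using j by auto
    then have "{es ! a} = ?I a"
      using at' [of a] 3 j deg_eq [of a] fin by (intro card_subset_eq) (auto simp: degree_def)
    then have "e \<in> {es ! a}" using eI by blast
    then show ?thesis using 3 \<open>es \<noteq> []\<close> by simp
  next
    case 4
    have "{es ! (a - 1)} = ?I a"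
      using at [of a] 4 j deg_eq [of a] fin by (intro card_subset_eq) (auto simp: degree_def)
    then have "e \<in> {es ! (a - 1)}" using eI by blast
    then show ?thesis using 4 j by simp
  qed
qed

text \<open>Off the path all degrees are 1, so apart from path vertices the edges are disjoint. The
  isomorphism sends joints to the path, and links and leaves by arbitrary enumerations to the
  private vertices of their edges.\<close>

lemma broom_degrees_isomorphic:
  assumes H: "hypertree k H" "k \<ge> 2" and E: "card (edges H) = d + q"
    and p: "is_path H vs es" "length es = d" and j: "1 \<le> j" "j < d"
    and deg: "broom_degrees H vs q j"
  shows "isomorphic (broom k d q j) H"
proof -
  have hyp: "hypergraph_on k H" using H(1) by (simp add: hypertree_def)
  note finE = finite_edges [OF hyp]
  have uniform: "e \<subseteq> verts H" "card e = k" "finite e" if "e \<in> edges H" for e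
    using hyp that H(2) by (auto simp: hypergraph_on_def card_ge_0_finite)
  have len: "length vs = Suc d" "distinct vs" "distinct es" "set vs \<subseteq> verts H" "set es \<subseteq> edges H"
    and in_edge: "\<And>i. i < d \<Longrightarrow> vs ! i \<in> es ! i" "\<And>i. i < d \<Longrightarrow> vs ! Suc i \<in> es ! i"
    using p by (auto simp: is_path_def)
  note inc = broom_degrees_incidence [OF H(1) _ p(1) j(1) _ deg, unfolded p(2), OF E j(2)]
  have setvs: "set vs = (!) vs ` {..d}" using len(1) by (auto simp: set_conv_nth)
  have setes: "set es = (!) es ` {..<d}" using p(2) by (auto simp: set_conv_nth)
  have es_inj: "es ! a = es ! b \<longleftrightarrow> a = b" if "a < d" "b < d" for a b
    using len(3) p(2) that by (simp add: nth_eq_iff_index_eq)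
  have path_Int: "es ! a \<inter> set vs = {vs ! a, vs ! Suc a}" if "a < d" for a
  proof (intro equalityI subsetI)
    fix v assume "v \<in> es ! a \<inter> set vs"
    then obtain b where b: "b \<le> d" "v = vs ! b" "vs ! b \<in> es ! a" using setvs by auto
    have "es ! a \<in> edges H" "es ! a \<in> set es" using that len p(2) by auto
    then have "(b < d \<and> es ! a = es ! b) \<or> (1 \<le> b \<and> es ! a = es ! (b - 1))"
      using inc(1) [OF b(1) _ b(3)] by blast
    then have "b = a \<or> b = Suc a" using es_inj that b(1) by auto
    then show "v \<in> {vs ! a, vs ! Suc a}" using b(2) by auto
  qed (use in_edge that len in auto)
  have leaf_Int: "e \<inter> set vs = {vs ! j}" if "e \<in> edges H" "e \<notin> set es" for e
  proof (intro equalityI subsetI)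
    fix v assume "v \<in> e \<inter> set vs"
    then obtain b where b: "b \<le> d" "v = vs ! b" "vs ! b \<in> e" using setvs by auto
    have "es ! b \<in> set es" if "b < d" using that p(2) by simp
    moreover have "es ! (b - 1) \<in> set es" if "1 \<le> b" using that b(1) p(2) by simp
    ultimately have "b = j" using inc(1) [OF b(1) that(1) b(3)] that(2) by auto
    then show "v \<in> {vs ! j}" using b(2) by simp
  next
    fix v assume "v \<in> {vs ! j}"
    moreover have "vs ! j \<in> e"
    proof (rule inc(2))
      show "es ! j \<in> edges H" using len(5) j(2) p(2) by auto
    qed (use in_edge(1) [OF j(2)] j(2) that in auto)
    moreover have "vs ! j \<in> set vs" using j(2) len(1) by simp
    ultimately show "v \<in> e \<inter> set vs" by blast
  qed
  have in_one_edge: "e = e'" if "e \<in> edges H" "e' \<in> edges H" "v \<in> e" "v \<in> e'" "v \<notin> set vs" for e e' v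
  proof (rule ccontr)
    assume "e \<noteq> e'"
    then have "card {e, e'} \<le> degree H v"
      unfolding degree_def using that finE by (intro card_mono) auto
    then have "degree H v \<ge> 2" using \<open>e \<noteq> e'\<close> by simp
    moreover have "v \<in> verts H" using that(1,3) uniform(1) by blast
    ultimately have "v = vs ! j \<or> v \<in> inner_verts vs" using deg by (auto simp: broom_degrees_def split: if_splits)
    then show False using that(5) j len(1) by (auto simp: inner_verts_def)
  qed
  have "\<forall>e\<in>edges H. \<exists>h. bij_betw h {0..<card (e - set vs)} (e - set vs)"
    using uniform(3) by (intro ballI ex_bij_betw_nat_finite) auto
  then obtain h where h: "\<And>e. e \<in> edges H \<Longrightarrow> bij_betw (h e) {0..<card (e - set vs)} (e - set vs)"
    by (metis bchoice)
  have "card (edges H - set es) = q"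
    using E len finE p(2) by (simp add: card_Diff_subset distinct_card)
  then obtain l where l: "bij_betw l {0..<q} (edges H - set es)"
    using finE ex_bij_betw_nat_finite [of "edges H - set es"] by auto
  have cards: "e \<in> edges H \<Longrightarrow> card (e - set vs) = k - card (e \<inter> set vs)" for e
    using uniform by (simp add: card_Diff_subset_Int)
  have path_edge: "es ! a \<in> edges H" if "a < d" for a using that len(5) p(2) by auto
  have hpath: "bij_betw (h (es ! a)) {0..<k - 2} (es ! a - set vs)" if "a < d" for a
  proof -
    have "vs ! a \<noteq> vs ! Suc a" using that len by (simp add: nth_eq_iff_index_eq)
    then show ?thesis using h [OF path_edge [OF that]] cards [OF path_edge [OF that]] path_Int [OF that]
      by (simp add: numeral_2_eq_2)
  qed
  have leaf: "l b \<in> edges H" "l b \<notin> set es" if "b < q" for b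
    using l that by (auto simp: bij_betw_def)
  have hleaf: "bij_betw (h (l b)) {0..<k - 1} (l b - set vs)" if "b < q" for b
    using h [OF leaf(1) [OF that]] cards [OF leaf(1) [OF that]] leaf_Int [OF leaf [OF that]] by simp
  define f where "f v = (case v of Axis a \<Rightarrow> vs ! a | Link a i \<Rightarrow> h (es ! a) i | Leaf b i \<Rightarrow> h (l b) i)" for v
  \<comment> \<open>The edge among whose private vertices \<open>f\<close> puts a link or a leaf;
    joints have none, hence the empty set.\<close>
  define host where "host v = (case v of Link a i \<Rightarrow> es ! a | Leaf b i \<Rightarrow> l b | _ \<Rightarrow> {})" for v
  have f_axis: "f (Axis a) \<in> set vs" if "a \<le> d" for a using that len(1) by (simp add: f_def)
  have f_link: "f (Link a i) \<in> es ! a - set vs" if "a < d" "i < k - 2" for a i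
    using hpath [OF that(1)] that(2) by (auto simp: f_def bij_betw_def)
  have f_leaf: "f (Leaf b i) \<in> l b - set vs" if "b < q" "i < k - 1" for b i
    using hleaf [OF that(1)] that(2) by (auto simp: f_def bij_betw_def)
  have inj: "inj_on f (broom_verts k d q)"
  proof (rule inj_onI)
    fix u v assume u: "u \<in> broom_verts k d q" and v: "v \<in> broom_verts k d q" and eq: "f u = f v"
    have vertex: "(\<exists>a\<le>d. w = Axis a) \<or> host w \<in> edges H \<and> f w \<in> host w \<and> f w \<notin> set vs"
      if "w \<in> broom_verts k d q" for w
      using that f_link f_leaf path_edge leaf(1) by (cases w) (auto simp: host_def)
    show "u = v"
    proof (cases "f u \<in> set vs")
      case True
      then obtain a b where "u = Axis a" "v = Axis b" "a \<le> d" "b \<le> d"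
        using vertex [OF u] vertex [OF v] eq by auto
      then show ?thesis using eq len by (simp add: f_def nth_eq_iff_index_eq)
    next
      case False
      then have not_axis: "u \<noteq> Axis a" "v \<noteq> Axis a" if "a \<le> d" for a
        using f_axis [OF that] eq by auto
      then have "host u = host v"
        using vertex [OF u] vertex [OF v] eq by (intro in_one_edge [of _ _ "f u"]) auto
      have link_leaf: False if "Link a i \<in> broom_verts k d q" "Leaf b i' \<in> broom_verts k d q" "es ! a = l b" for a i b i'
        using that leaf(2) [of b] p(2) nth_mem [of a es] by auto
      show ?thesis
      proof (cases u)
        case (Axis a)
        then show ?thesis using not_axis(1) u by auto
      next
        case u': (Link a i)
        show ?thesis
        proof (cases v)
          case (Axis b)
          then show ?thesis using not_axis(2) v by auto
        next
          case (Link b i')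
          then have "a = b" using \<open>host u = host v\<close> u u' v es_inj by (simp add: host_def)
          moreover from this have "i = i'"
            using eq u u' v Link hpath [of a] by (auto simp: f_def bij_betw_def dest: inj_onD)
          ultimately show ?thesis using u' Link by simp
        next
          case (Leaf b i')
          then show ?thesis using link_leaf [of a i b i'] \<open>host u = host v\<close> u u' v by (simp add: host_def)
        qed
      next
        case u': (Leaf a i)
        show ?thesis
        proof (cases v)
          case (Axis b)
          then show ?thesis using not_axis(2) v by auto
        next
          case (Link b i')
          then show ?thesis using link_leaf [of b i' a i] \<open>host u = host v\<close> u u' v by (simp add: host_def)
        next
          case (Leaf b i')
          then have "a = b" using \<open>host u = host v\<close> u u' v l by (auto simp: host_def bij_betw_def dest: inj_onD)
          moreover from this have "i = i'"
            using eq u u' v Leaf hleaf [of a] by (auto simp: f_def bij_betw_def dest: inj_onD)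
          ultimately show ?thesis using u' Leaf by simp
        qed
      qed
    qed
  qed
  have f_axis_edge: "f ` axis_edge k a = es ! a" if "a < d" for a
  proof -
    have "f ` axis_edge k a = {vs ! a, vs ! Suc a} \<union> h (es ! a) ` {0..<k - 2}"
      by (simp add: axis_edge_def f_def image_Un image_image lessThan_atLeast0)
    also have "\<dots> = (es ! a \<inter> set vs) \<union> (es ! a - set vs)"
      using hpath [OF that] path_Int [OF that] by (simp add: bij_betw_def)
    finally show ?thesis by blast
  qed
  have f_leaf_edge: "f ` leaf_edge k j b = l b" if "b < q" for b
  proof -
    have "f ` leaf_edge k j b = {vs ! j} \<union> h (l b) ` {0..<k - 1}"
      by (simp add: leaf_edge_def f_def image_image lessThan_atLeast0)
    also have "\<dots> = (l b \<inter> set vs) \<union> (l b - set vs)"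
      using hleaf [OF that] leaf_Int [OF leaf [OF that]] by (simp add: bij_betw_def)
    finally show ?thesis by blast
  qed
  have "(`) f ` edges (broom k d q j) = (!) es ` {..<d} \<union> l ` {..<q}"
    unfolding edges_broom image_Un image_image using f_axis_edge f_leaf_edge by (intro arg_cong2 [of _ _ _ _ "(\<union>)"] image_cong) auto
  also have "\<dots> = edges H"
    using l len(5) unfolding setes by (auto simp: bij_betw_def lessThan_atLeast0)
  finally have edges: "edges H = (`) f ` edges (broom k d q j)" by simp
  have "edges H \<noteq> {}" using E j by auto
  then have "verts H = \<Union>(edges H)"
    using hypertree_vertex_in_edge [OF H] uniform(1) by blast
  then show ?thesis
    using inj edges broom_verts_Union [of j d k q] j H(2) by (intro isomorphicI_edges [of f]) auto
qed


section \<open>The last hypertree\<close>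

lemma S_trace_broom_less:
  assumes k: "k \<ge> 2" and j: "1 \<le> j" "j < t" and t: "t + t \<le> d" and "0 < p" and \<alpha>: "0 < \<alpha>" "\<alpha> < 1"
  shows "r < k * j + 2 \<Longrightarrow> S_trace \<alpha> k (broom k d p j) r = S_trace \<alpha> k (broom k d p t) r"
    and "S_trace \<alpha> k (broom k d p j) (k * j + 2) < S_trace \<alpha> k (broom k d p t) (k * j + 2)"
proof -
  interpret broom_shift k d p j t \<alpha> by unfold_locales (use assms in auto)
  have S: "S_trace \<alpha> k (broom k d p c) s =
      real (k - 1) ^ (card (broom_verts k d p) - 1) * obj_sum (broom_verts k d p) k (A_tensor \<alpha> k (broom k d p c)) s"
    if "s > 0" for s c
    using that by (simp add: S_trace_def tensor_trace_eq_obj_sum)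
  show "S_trace \<alpha> k (broom k d p j) r = S_trace \<alpha> k (broom k d p t) r" if "r < k * j + 2"
  proof (cases "r = 0")
    case True
    then show ?thesis by (simp add: S_trace_def tensor_trace_def)
  next
    case False
    then show ?thesis using obj_sum_eq [OF that] by (simp add: S)
  qed
  have pos: "k * j + 2 > 0" by simp
  have "0 < real (k - 1) ^ (card (broom_verts k d p) - 1)" using k by simp
  then show "S_trace \<alpha> k (broom k d p j) (k * j + 2) < S_trace \<alpha> k (broom k d p t) (k * j + 2)"
    unfolding S [OF pos] using obj_sum_broom_less [OF \<open>0 < p\<close>] by (intro mult_strict_left_mono)
qed

text \<open>The order compares traces only at indices below the number of eigenvalues; this makes it
  sufficient to bound the deciding index by \<open>n - 1\<close>.\<close>

lemma eigenvalue_count_ge: "k \<ge> 2 \<Longrightarrow> n - 1 \<le> n * (k - 1) ^ (n - 1) - 1"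
proof -
  assume "k \<ge> 2"
  then have "1 \<le> (k - 1) ^ (n - 1)" by simp
  then have "n * 1 \<le> n * (k - 1) ^ (n - 1)" by (rule mult_le_mono2)
  from diff_le_mono [OF this, of 1] show ?thesis by (simp only: mult_1_right)
qed

lemma S_less_broom:
  assumes k: "k \<ge> 2" and j: "1 \<le> j" "j < t" and t: "t + t \<le> d" and p: "0 < p" and \<alpha>: "0 < \<alpha>" "\<alpha> < 1"
  shows "S_less \<alpha> k (broom k d p j) (broom k d p t)"
proof -
  let ?n = "card (broom_verts k d p)"
  have "edges (broom k d p t) \<noteq> {}" using card_edges_broom [OF k, of d p t] p by auto
  then have "?n = (d + p) * (k - 1) + 1"
    using card_verts_hypertree [OF hypertree_broom [OF k, of t d p] k] j t card_edges_broom [OF k] by simp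
  \<comment> \<open>The chain is \<open>k * j + 2 \<le> k * (j + 1) \<le> k * t \<le> 2 * t * (k -
    1) \<le> d * (k - 1)\<close>; its third step is \<open>k \<le> 2 * (k - 1)\<close>.\<close>
  moreover have "k * j + 2 \<le> d * (k - 1)"
  proof -
    have "k * j + k \<le> k * t" using j(2) mult_le_mono2 [of "Suc j" t k] by simp
    moreover have "k * t \<le> (t + t) * (k - 1)"
    proof -
      have "k \<le> 2 * (k - 1)" using k by simp
      then have "k * t \<le> 2 * (k - 1) * t" by (rule mult_le_mono1)
      also have "\<dots> = (t + t) * (k - 1)" by (simp only: mult_2 [symmetric] mult_ac)
      finally show ?thesis .
    qed
    moreover have "(t + t) * (k - 1) \<le> d * (k - 1)" using t by (rule mult_le_mono1)
    ultimately show ?thesis using k by linarith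
  qed
  moreover have "d * (k - 1) \<le> (d + p) * (k - 1)" by simp
  ultimately have "k * j + 2 \<le> ?n - 1" by linarith
  then have "k * j + 2 \<in> {1..?n * (k - 1) ^ (?n - 1) - 1}"
    using eigenvalue_count_ge [OF k, of ?n] by simp
  then show ?thesis
    unfolding S_less_def verts_broom using S_trace_broom_less [OF assms] by blast
qed

text \<open>The traces of index 0 and 1 depend on \<open>m\<close>, \<open>k\<close> and \<alpha>
  only, through the number of vertices and the sum of the degrees, so index 2 decides.\<close>

lemma S_less_degree_squares:
  assumes G: "hypertree k G" "card (edges G) = m" and H: "hypertree k H" "card (edges H) = m"
    and k: "k \<ge> 2" and m: "m \<ge> 2" and \<alpha>: "0 < \<alpha>"
    and less: "(\<Sum>v\<in>verts G. (real (degree G v))\<^sup>2) < (\<Sum>v\<in>verts H. (real (degree H v))\<^sup>2)"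
  shows "S_less \<alpha> k G H"
proof -
  have hyp: "hypergraph_on k G" "hypergraph_on k H" using G H by (auto simp: hypertree_def)
  have "edges G \<noteq> {}" "edges H \<noteq> {}" using G(2) H(2) m by auto
  then have n: "card (verts G) = m * (k - 1) + 1" "card (verts H) = m * (k - 1) + 1"
    using card_verts_hypertree [OF G(1) k] card_verts_hypertree [OF H(1) k] G(2) H(2) by auto
  have "S_trace \<alpha> k G r = S_trace \<alpha> k H r" if "r < 2" for r
  proof -
    have "r = 0 \<or> r = 1" using that by auto
    moreover have "S_trace \<alpha> k G 0 = S_trace \<alpha> k H 0" by (simp add: S_trace_def tensor_trace_def n)
    moreover have "(\<Sum>v\<in>verts G. \<alpha> * degree G v) = \<alpha> * (k * m)" "(\<Sum>v\<in>verts H. \<alpha> * degree H v) = \<alpha> * (k * m)"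
      using sum_degree [OF hyp(1)] sum_degree [OF hyp(2)] G(2) H(2)
      by (metis of_nat_sum sum_distrib_left)+
    then have "S_trace \<alpha> k G 1 = S_trace \<alpha> k H 1"
      unfolding S_trace_1 [OF hyp(1) k] S_trace_1 [OF hyp(2) k] n by simp
    ultimately show ?thesis by auto
  qed
  moreover have "S_trace \<alpha> k G 2 < S_trace \<alpha> k H 2"
  proof -
    have "(\<Sum>v\<in>verts G. (\<alpha> * degree G v)\<^sup>2) < (\<Sum>v\<in>verts H. (\<alpha> * degree H v)\<^sup>2)"
      using less \<alpha> by (simp add: power_mult_distrib flip: sum_distrib_left)
    moreover have "0 < real (k - 1) ^ (m * (k - 1) + 1 - 1)" using k by simp
    ultimately show ?thesis
      unfolding S_trace_2 [OF hyp(1) k] S_trace_2 [OF hyp(2) k] n G(2) H(2)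
      by (intro mult_strict_left_mono) auto
  qed
  moreover have "2 \<in> {1..card (verts H) * (k - 1) ^ (card (verts H) - 1) - 1}"
  proof -
    have "2 * 1 \<le> m * (k - 1)" using m k by (intro mult_le_mono) auto
    then have "2 \<le> card (verts H) - 1" unfolding n by simp
    then show ?thesis using eigenvalue_count_ge [OF k, of "card (verts H)"] by simp
  qed
  moreover have "card (verts G) = card (verts H)" using n by simp
  ultimately show ?thesis unfolding S_less_def by blast
qed

lemma S_less_isomorphic:
  assumes "isomorphic G G'" "isomorphic H H'" "hypergraph_on k G" "hypergraph_on k H" "S_less \<alpha> k G H"
  shows "S_less \<alpha> k G' H'"
proof -
  have "S_trace \<alpha> k G s = S_trace \<alpha> k G' s" "S_trace \<alpha> k H s = S_trace \<alpha> k H' s" for s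
    using S_trace_isomorphic [OF assms(1)] S_trace_isomorphic [OF assms(2)] assms(3,4)
    by (simp_all add: hypergraph_on_def)
  moreover have "card (verts G) = card (verts G')" "card (verts H) = card (verts H')"
    using assms(1,2) by (auto simp: isomorphic_def dest: bij_betw_same_card)
  ultimately show ?thesis using assms(5) by (simp add: S_less_def)
qed

lemma diameter_path:
  assumes "hypertree k H"
  obtains vs es where "is_path H vs es" "length es = diameter H"
proof -
  let ?D = "{hdist H u v | u v. u \<in> verts H \<and> v \<in> verts H}"
  have V: "finite (verts H)" "verts H \<noteq> {}" using assms by (auto simp: hypertree_def hypergraph_on_def)
  have "?D = (\<lambda>(u, v). hdist H u v) ` (verts H \<times> verts H)" by auto
  then have "finite ?D" "?D \<noteq> {}" using V by auto
  from Max_in [OF this] obtain u v where uv: "u \<in> verts H" "v \<in> verts H" "diameter H = hdist H u v"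
    unfolding diameter_def by blast
  then obtain q where "joins H u v q"
    using assms unfolding hypertree_def connected_hypergraph_def by blast
  then have "joins H u v (diameter H)" unfolding uv(3) hdist_def by (rule LeastI)
  then show ?thesis using that by (auto simp: joins_def)
qed

lemma S_less_last_broom:
  assumes k: "k \<ge> 2" and d: "2 \<le> d" "d \<le> m" and \<alpha>: "0 < \<alpha>" "\<alpha> < 1"
    and H: "H \<in> hypertrees k m d" and not_iso: "\<not> isomorphic H (broom k d (m - d) (d div 2))"
  shows "S_less \<alpha> k H (broom k d (m - d) (d div 2))"
proof -
  let ?t = "d div 2" and ?p = "m - d"
  let ?B = "broom k d ?p ?t"
  have tree: "hypertree k H" and m: "card (edges H) = m" and diam: "diameter H = d"
    using H by (auto simp: hypertrees_def)
  have t: "1 \<le> ?t" "?t < d" "?t + ?t \<le> d" using d by auto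
  have dp: "d + ?p = m" using d by simp
  obtain vs es where p: "is_path H vs es" "length es = d"
    using diameter_path [OF tree] diam by metis
  note ext = degree_squares_extremal [OF tree k m p d(1)]
  show ?thesis
  proof (cases "(\<Sum>v\<in>verts H. (real (degree H v))\<^sup>2) = max_square_sum k m d")
    case False
    then have "(\<Sum>v\<in>verts H. (real (degree H v))\<^sup>2) < max_square_sum k m d" using ext(1) by simp
    then have less: "(\<Sum>v\<in>verts H. (real (degree H v))\<^sup>2) < (\<Sum>v\<in>verts ?B. (real (degree ?B v))\<^sup>2)"
      using degree_squares_broom [OF k t(1,2), of ?p] dp by simp
    show ?thesis
      by (rule S_less_degree_squares [OF tree m hypertree_broom [OF k t(1,2)] _ k _ \<alpha>(1) less])
        (use card_edges_broom [OF k] dp d in auto)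
  next
    case True
    then obtain j where j: "1 \<le> j" "j < d" "broom_degrees H vs ?p j" using ext(2) by auto
    have iso: "isomorphic (broom k d ?p j) H"
      using broom_degrees_isomorphic [OF tree k _ p j] m dp by simp
    have uniform: "\<forall>e\<in>edges (broom k d ?p c). e \<subseteq> verts (broom k d ?p c)" if "c \<le> d" for c
      using hypergraph_on_broom [OF k that] by (auto simp: hypergraph_on_def)
    \<comment> \<open>By reflection the branching position may be replaced by its distance to the
      nearer end, which is at most \<open>d div 2\<close>.\<close>
    define i where "i = min j (d - j)"
    have iso_i: "isomorphic (broom k d ?p i) H"
    proof (cases "j \<le> d - j")
      case True
      then show ?thesis using iso by (simp add: i_def)
    next
      case False
      then have "isomorphic (broom k d ?p i) (broom k d ?p j)"
        using broom_reverse [OF k, of "d - j" d ?p] j by (simp add: i_def)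
      then show ?thesis using iso by (rule isomorphic_trans)
    qed
    have i: "1 \<le> i" "i < d" "i \<le> ?t" using j by (auto simp: i_def)
    have "broom k d ?p i \<noteq> ?B" using not_iso isomorphic_sym [OF iso_i] uniform [of i] i by auto
    \<comment> \<open>Without pendant edges all these brooms coincide, so \<open>?p = 0\<close> is
      excluded together with \<open>i = ?t\<close>.\<close>
    then have "i \<noteq> ?t" and "?p \<noteq> 0" by (auto simp: broom_def)
    then have "S_less \<alpha> k (broom k d ?p i) ?B"
      using i t by (intro S_less_broom [OF k _ _ _ _ \<alpha>]) auto
    moreover have "isomorphic ?B ?B" by (auto simp: isomorphic_def intro!: exI [of _ id])
    ultimately show ?thesis
      using S_less_isomorphic [OF iso_i] hypergraph_on_broom [OF k] i t by (meson less_imp_le)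
  qed
qed

theorem theorem6p5:
  fixes k m d t :: nat and \<alpha> :: real
  assumes "k \<ge> 2" and "2 \<le> d" and "d \<le> m" and "0 < \<alpha>" and "\<alpha> < 1"
    and "t = d div 2"
  shows "starlike k ([t, d - t] @ replicate (m - d) 1) \<in> hypertrees k m d \<and>
    (\<forall>H :: 'a hypergraph. H \<in> hypertrees k m d \<longrightarrow>
       \<not> isomorphic H (starlike k ([t, d - t] @ replicate (m - d) 1)) \<longrightarrow>
       S_less \<alpha> k H (starlike k ([t, d - t] @ replicate (m - d) 1)))"
proof -
  let ?S = "starlike k ([t, d - t] @ replicate (m - d) 1)" and ?B = "broom k d (m - d) t"
  have t: "1 \<le> t" "t < d" using assms by auto
  have iso: "isomorphic ?B ?S" using starlike_isomorphic_broom [OF assms(1)] t by simp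
  have hyp: "hypergraph_on k ?B" using hypergraph_on_broom [OF assms(1)] t by simp
  have "?B \<in> hypertrees k m d" using broom_in_hypertrees [OF assms(1) t, of "m - d"] assms(3) by simp
  then have "?S \<in> hypertrees k m d" by (rule hypertrees_isomorphic [OF iso])
  moreover have "S_less \<alpha> k H ?S" if H: "H \<in> hypertrees k m d" "\<not> isomorphic H ?S" for H :: "'a hypergraph"
  proof -
    have "\<not> isomorphic H ?B" using H(2) isomorphic_trans [OF _ iso] by blast
    then have "S_less \<alpha> k H ?B"
      using S_less_last_broom [OF assms(1-5) H(1)] assms(6) by simp
    moreover have "isomorphic H H" by (auto simp: isomorphic_def intro!: exI [of _ id])
    moreover have "hypergraph_on k H" using H(1) by (simp add: hypertrees_def hypertree_def)
    ultimately show ?thesis using S_less_isomorphic [OF _ iso _ hyp] by blast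
  qed
  ultimately show ?thesis by blast
qed

end
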